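(* Let $F\in\{\mathbb R,\mathbb C\}$ and $(G,H)$ a unitary GGP pair over $F$. Let $K$ be a compact subset of $\mathfrak g^\wedge_{\mathrm{stab}}$. Then there exist neighborhoods $U$ of the identity in $\bar G$ and $V_0$ of the identity in $Z_H$ and a constant $C>0$ such that for all $\tau\in K$, all $g\in U$ with $g\tau=\tau$ (i.e. $g\in\bar G_\tau$), and all $z\in V_0$, \[|z-1|\cdot|\mathrm{Ad}(g)-1|\le C\,\mathrm{dist}(gz\tau,H\tau).\]
   Context: Unitary GGP pair $(G,H)=(\mathrm U(V),\mathrm U(V_H))$ over $F$: $E$ quadratic étale over $F$, $V$ rank $n+1$ hermitian, $V_H=(Ee)^\perp$ for $e$ with $\langle e,e\rangle\in E^\times$; $Z,Z_H$ centers, $\bar G=G/Z$. $\mathfrak g^\wedge=\mathrm{Hom}(\mathfrak g,i\mathbb R)$ with coadjoint action; $\mathfrak g^\wedge_{\mathrm{stab}}$ = elements with finite $H$-stabilizer and closed $H$-orbit (equivalently eigenvalue multisets of $\xi$ and its restriction $\xi_H$ to $\mathfrak h$ disjoint). $|\cdot|$ on $\mathfrak g^\wedge$ comes from a fixed inner product, $\mathrm{dist}(\xi,S)=\inf_{\eta\in S}|\xi-\eta|$. $|\mathrm{Ad}(g)-1|$ is a fixed norm of $\mathrm{Ad}(g)-1\in\mathrm{End}(\mathfrak g)$; $|z-1|$ is a fixed norm of $z-1$ with $Z_H\subset\mathrm{GL}(V/E)\subset\mathrm{End}(V)$. *)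

theory Defs
  imports "HOL-Analysis.Analysis"
begin

text \<open>Componentwise ring structure on products, so that \<open>F \<times> F\<close> is available as an algebra.\<close>

instantiation prod :: (times, times) times
begin
definition times_prod_def: "x * y = (fst x * fst y, snd x * snd y)"
instance ..
end

instantiation prod :: (one, one) one
begin
definition one_prod_def: "1 = (1, 1)"
instance ..
end

lemma mult_Pair [simp]: "(a, b) * (c, d) = (a * c, b * d)"
  by (simp add: times_prod_def)

lemma fst_mult [simp]: "fst (x * y) = fst x * fst y"
  by (simp add: times_prod_def)

lemma snd_mult [simp]: "snd (x * y) = snd x * snd y"
  by (simp add: times_prod_def)

lemma fst_one [simp]: "fst 1 = 1"
  by (simp add: one_prod_def)

lemma snd_one [simp]: "snd 1 = 1"
  by (simp add: one_prod_def)

instance prod :: (comm_ring_1, comm_ring_1) comm_ring_1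
  by standard (auto simp: prod_eq_iff algebra_simps)

instance prod :: ("{real_algebra_1,comm_ring_1}", "{real_algebra_1,comm_ring_1}") real_algebra_1
  by standard (auto simp: prod_eq_iff)

definition unital_ring_hom :: "('a::comm_ring_1 \<Rightarrow> 'b::comm_ring_1) \<Rightarrow> bool" where
  "unital_ring_hom f \<longleftrightarrow>
     f 1 = 1 \<and> (\<forall>x y. f (x + y) = f x + f y) \<and> (\<forall>x y. f (x * y) = f x * f y)"

text \<open>
  \<open>\<iota>\<close> is the structure map of the \<open>F\<close>-algebra \<open>E\<close>.  An etale algebra over a field is a finite
  product of finite separable field extensions; in rank two it is therefore a quadratic field
  extension (separability is automatic in characteristic zero) or \<open>F \<times> F\<close>.  The condition on
  \<open>of_real\<close> says that the real vector space structure, hence the topology, carried by the type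
  of \<open>E\<close> is the one induced from \<open>F\<close>.
\<close>

definition quadratic_etale ::
  "('f::real_normed_field \<Rightarrow> 'e::{comm_ring_1,real_algebra_1}) \<Rightarrow> bool" where
  "quadratic_etale \<iota> \<longleftrightarrow>
     unital_ring_hom \<iota> \<and> (\<forall>r. \<iota> (of_real r) = of_real r) \<and>
     (\<exists>s t. bij (\<lambda>(a, b). \<iota> a * s + \<iota> b * t)) \<and>
     ((\<forall>x::'e. x \<noteq> 0 \<longrightarrow> (\<exists>y. x * y = 1)) \<or>
      (\<exists>\<phi>::'e \<Rightarrow> 'f \<times> 'f. unital_ring_hom \<phi> \<and> bij \<phi> \<and> (\<forall>a. \<phi> (\<iota> a) = (a, a))))"

lemma quadratic_etale_complex: "quadratic_etale (of_real :: real \<Rightarrow> complex)"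
proof -
  have "bij (\<lambda>(a, b). complex_of_real a * 1 + complex_of_real b * \<i>)"
    by (rule bij_betw_byWitness[where f' = "\<lambda>z. (Re z, Im z)"])
       (auto simp: complex_eq_iff)
  moreover have "\<exists>y. x * y = 1" if "x \<noteq> 0" for x :: complex
    using that right_inverse by blast
  ultimately show ?thesis
    unfolding quadratic_etale_def unital_ring_hom_def
    by (intro conjI exI[of _ 1] exI[of _ \<i>] disjI1) auto
qed

lemma quadratic_etale_split: "quadratic_etale (\<lambda>a::'f::real_normed_field. (a, a))"
proof -
  have "bij (\<lambda>(a, b). (a::'f, a) * (1, 0) + (b, b) * (0, 1))"
    by (rule bij_betw_byWitness[where f' = id]) auto
  moreover have "unital_ring_hom (id :: 'f \<times> 'f \<Rightarrow> 'f \<times> 'f)"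
    by (simp add: unital_ring_hom_def)
  moreover have "unital_ring_hom (\<lambda>a::'f. (a, a))"
    by (simp add: unital_ring_hom_def one_prod_def)
  moreover have "(of_real r :: 'f \<times> 'f) = (of_real r, of_real r)" for r
    by (simp add: of_real_def prod_eq_iff)
  ultimately show ?thesis
    unfolding quadratic_etale_def
    by (intro conjI exI[of _ "(1, 0)"] exI[of _ "(0, 1)"] disjI2 exI[of _ id]) auto
qed

text \<open>The involution \<open>\<sigma>\<close> of \<open>E\<close> over \<open>F\<close>: the nontrivial \<open>F\<close>-algebra automorphism.\<close>

definition nontrivial_involution ::
  "('f::real_normed_field \<Rightarrow> 'e::comm_ring_1) \<Rightarrow> ('e \<Rightarrow> 'e) \<Rightarrow> bool" where
  "nontrivial_involution \<iota> \<sigma> \<longleftrightarrow>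
     unital_ring_hom \<sigma> \<and> bij \<sigma> \<and> (\<forall>a. \<sigma> (\<iota> a) = \<iota> a) \<and> \<sigma> \<noteq> id"

definition hermitian_form ::
  "('e::comm_ring_1 \<Rightarrow> 'e) \<Rightarrow> ('e^'m \<Rightarrow> 'e^'m \<Rightarrow> 'e) \<Rightarrow> bool" where
  "hermitian_form \<sigma> h \<longleftrightarrow>
     (\<forall>u v w. h (u + v) w = h u w + h v w) \<and>
     (\<forall>c u v. h (c *s u) v = c * h u v) \<and>
     (\<forall>u v. h v u = \<sigma> (h u v)) \<and>
     (\<forall>u. (\<forall>v. h u v = 0) \<longrightarrow> u = 0)"

text \<open>
  The data of a unitary GGP pair over \<open>F\<close>: the hermitian space is \<open>V = E\<^sup>n\<^sup>+\<^sup>1\<close>, indexed by a finite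
  type with \<open>n + 1\<close> elements, with form \<open>h\<close> and distinguished vector \<open>e\<close>.
\<close>

definition unitary_GGP ::
  "('f::real_normed_field \<Rightarrow> 'e::{comm_ring_1,real_algebra_1}) \<Rightarrow> ('e \<Rightarrow> 'e) \<Rightarrow>
   ('e^'m \<Rightarrow> 'e^'m \<Rightarrow> 'e) \<Rightarrow> 'e^'m \<Rightarrow> bool" where
  "unitary_GGP \<iota> \<sigma> h e \<longleftrightarrow>
     quadratic_etale \<iota> \<and> nontrivial_involution \<iota> \<sigma> \<and> hermitian_form \<sigma> h \<and> h e e dvd 1"

definition U_V :: "('e::comm_ring_1^'m \<Rightarrow> 'e^'m \<Rightarrow> 'e) \<Rightarrow> ('e^'m^'m) set" where
  "U_V h = {g. invertible g \<and> (\<forall>u v. h (g *v u) (g *v v) = h u v)}"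

definition V_H :: "('e::comm_ring_1^'m \<Rightarrow> 'e^'m \<Rightarrow> 'e) \<Rightarrow> 'e^'m \<Rightarrow> ('e^'m) set" where
  "V_H h e = {v. h v e = 0}"

text \<open>Elements of \<open>U(V\<^sub>H)\<close>, extended to \<open>V = E e \<oplus> V\<^sub>H\<close> by the identity on \<open>E e\<close>.\<close>

definition U_VH :: "('e::comm_ring_1^'m \<Rightarrow> 'e^'m \<Rightarrow> 'e) \<Rightarrow> 'e^'m \<Rightarrow> ('e^'m^'m) set" where
  "U_VH h e = {x. invertible x \<and> x *v e = e \<and> (\<lambda>v. x *v v) ` V_H h e = V_H h e \<and>
     (\<forall>u\<in>V_H h e. \<forall>v\<in>V_H h e. h (x *v u) (x *v v) = h u v)}"

definition center_of :: "('e::comm_ring_1^'m^'m) set \<Rightarrow> ('e^'m^'m) set" where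
  "center_of G = {z \<in> G. \<forall>g\<in>G. z ** g = g ** z}"

definition coset_Z ::
  "('e::comm_ring_1^'m \<Rightarrow> 'e^'m \<Rightarrow> 'e) \<Rightarrow> 'e^'m^'m \<Rightarrow> ('e^'m^'m) set" where
  "coset_Z h g = (\<lambda>z. g ** z) ` center_of (U_V h)"

text \<open>\<open>G/Z\<close>, as the space of cosets \<open>g Z\<close> with the quotient topology.\<close>

definition Gbar_topology ::
  "('e::{comm_ring_1,euclidean_space}^'m \<Rightarrow> 'e^'m \<Rightarrow> 'e) \<Rightarrow> ('e^'m^'m) set topology" where
  "Gbar_topology h = topology (\<lambda>W. W \<subseteq> coset_Z h ` U_V h \<and>
     openin (top_of_set (U_V h)) {g \<in> U_V h. coset_Z h g \<in> W})"

lemma openin_Gbar_topology: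
  "openin (Gbar_topology h) W \<longleftrightarrow> W \<subseteq> coset_Z h ` U_V h \<and>
     openin (top_of_set (U_V h)) {g \<in> U_V h. coset_Z h g \<in> W}"
proof -
  let ?P = "\<lambda>g W. g \<in> U_V h \<and> coset_Z h g \<in> W"
  have "istopology (\<lambda>W. W \<subseteq> coset_Z h ` U_V h \<and> openin (top_of_set (U_V h)) {g. ?P g W})"
    unfolding istopology_def
  proof (intro conjI allI impI; (elim conjE)?)
    fix S T
    assume ST: "openin (top_of_set (U_V h)) {g. ?P g S}" "openin (top_of_set (U_V h)) {g. ?P g T}"
    have "{g. ?P g (S \<inter> T)} = {g. ?P g S} \<inter> {g. ?P g T}"
      by auto
    then show "openin (top_of_set (U_V h)) {g. ?P g (S \<inter> T)}"
      using openin_Int[OF ST] by simp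
  next
    fix \<K>
    assume K: "\<forall>K\<in>\<K>. K \<subseteq> coset_Z h ` U_V h \<and> openin (top_of_set (U_V h)) {g. ?P g K}"
    have "{g. ?P g (\<Union>\<K>)} = (\<Union>K\<in>\<K>. {g. ?P g K})"
      by auto
    moreover have "openin (top_of_set (U_V h)) (\<Union>K\<in>\<K>. {g. ?P g K})"
      using K by (intro openin_Union) blast
    ultimately show "openin (top_of_set (U_V h)) {g. ?P g (\<Union>\<K>)}"
      by simp
  qed auto
  then show ?thesis
    unfolding Gbar_topology_def by (simp add: topology_inverse')
qed

lemma quotient_map_coset_Z: "quotient_map (top_of_set (U_V h)) (Gbar_topology h) (coset_Z h)"
proof -
  have "openin (Gbar_topology h) (coset_Z h ` U_V h)"
  proof -
    have "{g \<in> U_V h. coset_Z h g \<in> coset_Z h ` U_V h} = U_V h"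
      by auto
    then show ?thesis
      by (simp add: openin_Gbar_topology)
  qed
  then have "topspace (Gbar_topology h) = coset_Z h ` U_V h"
    by (meson openin_Gbar_topology openin_subset openin_topspace subset_antisym)
  then show ?thesis
    by (auto simp: quotient_map_def openin_Gbar_topology)
qed

definition Ad :: "'e::comm_ring_1^'m^'m \<Rightarrow> 'e^'m^'m \<Rightarrow> 'e^'m^'m" where
  "Ad g X = g ** X ** matrix_inv g"

definition lie_g :: "('e::comm_ring_1^'m \<Rightarrow> 'e^'m \<Rightarrow> 'e) \<Rightarrow> ('e^'m^'m) set" where
  "lie_g h = {X. \<forall>u v. h (X *v u) v + h u (X *v v) = 0}"

text \<open>
  Maps defined on the real vector space \<open>\<gg>\<close> are represented by functions on all matrices that
  vanish off \<open>\<gg>\<close>; vector space operations on them are pointwise.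
\<close>

definition linear_on_g ::
  "('e::{comm_ring_1,real_vector}^'m \<Rightarrow> 'e^'m \<Rightarrow> 'e) \<Rightarrow> ('e^'m^'m \<Rightarrow> 'b::real_vector) \<Rightarrow> bool" where
  "linear_on_g h f \<longleftrightarrow>
     (\<forall>X\<in>lie_g h. \<forall>Y\<in>lie_g h. f (X + Y) = f X + f Y) \<and>
     (\<forall>X\<in>lie_g h. \<forall>r. f (r *\<^sub>R X) = r *\<^sub>R f X) \<and>
     (\<forall>X. X \<notin> lie_g h \<longrightarrow> f X = 0)"

text \<open>
  \<open>Hom(\<gg>, i\<real>)\<close>.  It is finite dimensional, so the product topology which it inherits from the
  function type (pointwise convergence) is its topology as a real vector space.
\<close>

definition g_wedge ::
  "('e::{comm_ring_1,real_vector}^'m \<Rightarrow> 'e^'m \<Rightarrow> 'e) \<Rightarrow> ('e^'m^'m \<Rightarrow> complex) set" where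
  "g_wedge h = {\<xi>. linear_on_g h \<xi> \<and> (\<forall>X\<in>lie_g h. Re (\<xi> X) = 0)}"

definition End_g ::
  "('e::{comm_ring_1,real_vector}^'m \<Rightarrow> 'e^'m \<Rightarrow> 'e) \<Rightarrow> ('e^'m^'m \<Rightarrow> 'e^'m^'m) set" where
  "End_g h = {T. linear_on_g h T \<and> T ` lie_g h \<subseteq> lie_g h}"

definition Ad_minus_1 ::
  "('e::comm_ring_1^'m \<Rightarrow> 'e^'m \<Rightarrow> 'e) \<Rightarrow> 'e^'m^'m \<Rightarrow> 'e^'m^'m \<Rightarrow> 'e^'m^'m" where
  "Ad_minus_1 h g = (\<lambda>X. if X \<in> lie_g h then Ad g X - X else 0)"

definition coAd ::
  "'e::comm_ring_1^'m^'m \<Rightarrow> ('e^'m^'m \<Rightarrow> complex) \<Rightarrow> 'e^'m^'m \<Rightarrow> complex" where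
  "coAd g \<xi> = (\<lambda>X. \<xi> (Ad (matrix_inv g) X))"

definition H_orbit ::
  "('e::comm_ring_1^'m \<Rightarrow> 'e^'m \<Rightarrow> 'e) \<Rightarrow> 'e^'m \<Rightarrow> ('e^'m^'m \<Rightarrow> complex) \<Rightarrow>
   ('e^'m^'m \<Rightarrow> complex) set" where
  "H_orbit h e \<xi> = (\<lambda>x. coAd x \<xi>) ` U_VH h e"

definition g_stab ::
  "('e::{comm_ring_1,real_vector}^'m \<Rightarrow> 'e^'m \<Rightarrow> 'e) \<Rightarrow> 'e^'m \<Rightarrow> ('e^'m^'m \<Rightarrow> complex) set" where
  "g_stab h e = {\<xi> \<in> g_wedge h. finite {x \<in> U_VH h e. coAd x \<xi> = \<xi>} \<and>
     closedin (top_of_set (g_wedge h)) (H_orbit h e \<xi>)}"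

definition End_V :: "('e::comm_ring_1^'m \<Rightarrow> 'e^'m) set" where
  "End_V = range (\<lambda>(A::'e^'m^'m) v. A *v v)"

definition norm_on :: "('a \<Rightarrow> 'b::real_vector) set \<Rightarrow> (('a \<Rightarrow> 'b) \<Rightarrow> real) \<Rightarrow> bool" where
  "norm_on S N \<longleftrightarrow>
     (\<forall>f\<in>S. 0 \<le> N f) \<and>
     (\<forall>f\<in>S. N f = 0 \<longleftrightarrow> f = (\<lambda>_. 0)) \<and>
     (\<forall>f\<in>S. \<forall>r. N (\<lambda>x. r *\<^sub>R f x) = \<bar>r\<bar> * N f) \<and>
     (\<forall>f\<in>S. \<forall>g\<in>S. N (\<lambda>x. f x + g x) \<le> N f + N g)"

definition inner_product_on ::
  "('a \<Rightarrow> 'b::real_vector) set \<Rightarrow> (('a \<Rightarrow> 'b) \<Rightarrow> ('a \<Rightarrow> 'b) \<Rightarrow> real) \<Rightarrow> bool" where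
  "inner_product_on S B \<longleftrightarrow>
     (\<forall>f\<in>S. \<forall>g\<in>S. B f g = B g f) \<and>
     (\<forall>f\<in>S. \<forall>g\<in>S. \<forall>k\<in>S. B (\<lambda>x. f x + g x) k = B f k + B g k) \<and>
     (\<forall>f\<in>S. \<forall>g\<in>S. \<forall>r. B (\<lambda>x. r *\<^sub>R f x) g = r * B f g) \<and>
     (\<forall>f\<in>S. f \<noteq> (\<lambda>_. 0) \<longrightarrow> 0 < B f f)"

definition dist_to ::
  "(('a \<Rightarrow> complex) \<Rightarrow> ('a \<Rightarrow> complex) \<Rightarrow> real) \<Rightarrow> ('a \<Rightarrow> complex) \<Rightarrow> ('a \<Rightarrow> complex) set \<Rightarrow> real" where
  "dist_to B \<xi> S = (INF \<eta>\<in>S. sqrt (B (\<lambda>X. \<xi> X - \<eta> X) (\<lambda>X. \<xi> X - \<eta> X)))"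

end

theory Submission
  imports Defs
begin

text \<open>
  A trace form identifies \<open>\<gg>\<^sup>\<and>\<close> with \<open>\<gg>\<close>, so that \<open>\<tau>\<close> becomes a skew-hermitian matrix \<open>T\<close>, the
  coadjoint action becomes conjugation, and \<open>f\<^sub>k(T) = \<langle>T\<^sup>k e, e\<rangle>\<close> are \<open>H\<close>-invariants.  They are
  Lipschitz on bounded sets, so \<open>dist(g z \<tau>, H \<tau>)\<close> dominates \<open>f\<^sub>k(g z T) - f\<^sub>k(T)\<close>.  If \<open>g\<close> commutes
  with \<open>T\<close> and \<open>z\<close> acts on \<open>V\<^sub>H\<close> by \<open>c\<close>, this difference equals \<open>\<langle>Q T\<^sup>k e, e\<rangle>\<close> with \<open>Q = (c - 1) R\<close>
  commuting with \<open>T\<close>, where for \<open>\<nu> = \<langle>g\<^sup>-\<^sup>1 e, e\<rangle> / \<langle>e, e\<rangle>\<close>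
  \<open>R = \<nu> g - \<nu> \<sigma>(\<nu>) - c\<^sup>-\<^sup>1 (\<sigma>(\<nu>) g\<^sup>-\<^sup>1 - \<nu> \<sigma>(\<nu>))\<close>.  Stability of \<open>\<tau>\<close> forces \<open>e\<close> to be cyclic for
  \<open>T\<close>, so these numbers control \<open>Q\<close>, uniformly on compact sets.  Finally \<open>R\<close> controls \<open>Ad(g) - 1\<close>:
  writing \<open>Y = Ad(g) X - X\<close>, the matrix \<open>[R, X] g\<^sup>-\<^sup>1 = \<nu> Y + c\<^sup>-\<^sup>1 \<sigma>(\<nu>) g\<^sup>-\<^sup>1 Y g\<^sup>-\<^sup>1\<close> is close to \<open>2 Y\<close>
  when \<open>g\<close> and \<open>c\<close> are close to \<open>1\<close>.
\<close>

section \<open>Matrices over a finite-dimensional real algebra\<close>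

text \<open>The obstacle is that E may be F x F, so that \<open>'e\<close> has zero divisors: in
  general |(c - 1) R| does not dominate |c - 1| |R|, and V is only a module. Three remedies recur.
  Injectivity is turned into surjectivity by counting real dimensions. Nonzero elements fixed by
  \<sigma> come from the field F and are therefore units. Finally, c \<sigma>(c) = 1 with c near 1
  forces c - 1 to be a scalar of F times a unit of E; in the split case c = (a, 1/a), whose two
  coordinates tend to 1 at the same rate. Stability enters through its two defining conditions. A
  finite stabilizer excludes a nonzero X in the Lie algebra that kills e and commutes with T; a
  closed orbit keeps limits of H-conjugates of T conjugate to T. Together they give the cyclicity of
  e. Group elements are produced from Lie algebra elements by Cayley transforms, for which
  commutation relations pass in both directions.\<close>

lemma matrix_vector_mult_smult:
  fixes A :: "'e::comm_ring_1^'n^'m"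
  shows "A *v (c *s x) = c *s (A *v x)"
  by (simp add: vector_scalar_mult_def matrix_vector_mult_def mult_ac sum_distrib_left)

lemma mat_vector_mult:
  fixes v :: "'e::comm_ring_1^'n"
  shows "mat c *v v = c *s v"
  by (simp add: vec_eq_iff matrix_vector_mult_def mat_def if_distrib if_distribR cong: if_cong)

lemma scaleR_conv_smult:
  fixes v :: "'e::real_algebra_1^'n"
  shows "r *\<^sub>R v = of_real r *s v"
  by (simp add: vec_eq_iff of_real_def)

lemma matrix_vector_mult_scaleR_left:
  fixes A :: "'e::real_algebra_1^'n^'m"
  shows "(r *\<^sub>R A) *v v = r *\<^sub>R (A *v v)"
  by (simp add: vec_eq_iff matrix_vector_mult_def scaleR_sum_right)

lemma matrix_vector_mult_scaleR_right:
  fixes A :: "'e::real_algebra_1^'n^'m"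
  shows "A *v (r *\<^sub>R v) = r *\<^sub>R (A *v v)"
  by (simp add: vec_eq_iff matrix_vector_mult_def scaleR_sum_right)

lemma matrix_vector_mult_uminus_left:
  fixes A :: "'e::ring_1^'n^'m"
  shows "(- A) *v v = - (A *v v)"
  by (simp add: vec_eq_iff matrix_vector_mult_def sum_negf)

lemma matrix_vector_mult_uminus_right:
  fixes A :: "'e::ring_1^'n^'m"
  shows "A *v (- v) = - (A *v v)"
  by (simp add: vec_eq_iff matrix_vector_mult_def sum_negf)

lemmas matrix_apply = matrix_vector_mul_assoc[symmetric] matrix_vector_mult_add_rdistrib
  matrix_vector_mult_diff_rdistrib matrix_vector_mult_uminus_left matrix_vector_mult_scaleR_left
  mat_vector_mult matrix_vector_right_distrib matrix_vector_mult_diff_distrib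
  matrix_vector_mult_uminus_right matrix_vector_mult_scaleR_right matrix_vector_mult_smult

lemma matrix_vector_mult_matrix:
  fixes f :: "'e::comm_ring_1^'n \<Rightarrow> 'e^'m"
  assumes add: "\<And>x y. f (x + y) = f x + f y" and smult: "\<And>c x. f (c *s x) = c *s f x"
  shows "matrix f *v x = f x"
proof -
  have zero: "f 0 = 0"
    using add[of 0 0] by simp
  have "f x = f (\<Sum>i\<in>UNIV. x$i *s axis i 1)"
    by (simp add: basis_expansion)
  also have "\<dots> = (\<Sum>i\<in>UNIV. f (x$i *s axis i 1))"
    using sum_comp_morphism[of f "\<lambda>i. x$i *s axis i 1" UNIV] zero add by (simp add: o_def)
  also have "\<dots> = matrix f *v x"
    by (simp add: vec_eq_iff smult matrix_def matrix_vector_mult_def mult.commute)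
  finally show ?thesis ..
qed

lemma matrix_left_inverse_imp_right:
  fixes A B :: "'e::{comm_ring_1,real_algebra_1,euclidean_space}^'m^'m"
  assumes "B ** A = mat 1"
  shows "A ** B = mat 1"
proof -
  have "inj ((*v) A)"
    by (metis assms inj_on_inverseI matrix_vector_mul_assoc matrix_vector_mul_lid)
  then have "surj ((*v) A)"
    by (intro linear_injective_imp_surjective) auto
  then have "A *v (B *v x) = x" for x
    by (metis assms matrix_vector_mul_assoc matrix_vector_mul_lid surjD)
  then show ?thesis
    by (simp add: matrix_eq matrix_vector_mul_assoc)
qed

text \<open>Counting real dimensions gives surjectivity even when \<open>'e\<close> has zero
  divisors. The set-theoretic inverse is \<open>'e\<close>-linear because each identity can be
  tested after applying the injective \<open>A\<close>.\<close>

lemma inj_imp_invertible: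
  fixes A :: "'e::{comm_ring_1,real_algebra_1,euclidean_space}^'m^'m"
  assumes "\<And>x. A *v x = 0 \<Longrightarrow> x = 0"
  shows "invertible A"
proof -
  have inj: "inj ((*v) A)"
  proof (rule injI)
    fix x y assume "A *v x = A *v y"
    then have "A *v (x - y) = 0"
      by (simp add: matrix_vector_mult_diff_distrib)
    then show "x = y"
      using assms by fastforce
  qed
  then have "surj ((*v) A)"
    by (intro linear_injective_imp_surjective) auto
  then obtain f where f: "\<And>x. A *v f x = x"
    by (metis surjD)
  have "matrix f *v x = f x" for x
    by (rule matrix_vector_mult_matrix; rule injD[OF inj])
       (simp_all add: f matrix_vector_right_distrib matrix_vector_mult_smult)
  then have "A ** matrix f = mat 1"
    by (simp add: matrix_eq f flip: matrix_vector_mul_assoc)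
  then show ?thesis
    using matrix_left_inverse_imp_right unfolding invertible_def by blast
qed

lemma matrix_inv_eqI:
  assumes "A ** B = mat 1" "B ** A = mat 1"
  shows "matrix_inv A = B"
proof -
  have "A ** matrix_inv A = mat 1 \<and> matrix_inv A ** A = mat 1"
    unfolding matrix_inv_def by (rule someI[of _ B]) (use assms in simp)
  then show ?thesis
    by (metis assms(1) matrix_mul_assoc matrix_mul_lid matrix_mul_rid)
qed

section \<open>Bilinearity and continuity of the matrix operations\<close>

lemma matrix_mul_add_left: "(A + B) ** C = A ** C + B ** C"
  by (simp add: vec_eq_iff matrix_matrix_mult_def distrib_right sum.distrib)

lemma matrix_mul_scaleR_left:
  fixes A :: "'e::real_algebra_1^'n^'m"
  shows "(r *\<^sub>R A) ** B = r *\<^sub>R (A ** B)"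
  by (simp add: scalar_matrix_assoc)

lemma matrix_mul_scaleR_right:
  fixes B :: "'e::real_algebra_1^'n^'m"
  shows "A ** (r *\<^sub>R B) = r *\<^sub>R (A ** B)"
  by (simp add: vec_eq_iff matrix_matrix_mult_def scaleR_sum_right)

lemma trace_scaleR:
  fixes A :: "'e::real_algebra_1^'n^'n"
  shows "trace (r *\<^sub>R A) = r *\<^sub>R trace A"
  by (simp add: trace_def scaleR_sum_right)

lemma bounded_bilinear_algebra_mult:
  "bounded_bilinear ((*) :: 'e::{real_algebra_1,euclidean_space} \<Rightarrow> 'e \<Rightarrow> 'e)"
  unfolding bilinear_conv_bounded_bilinear[symmetric] bilinear_def
  by (auto intro!: linearI simp: algebra_simps)

lemma bounded_bilinear_matrix_mult:
  "bounded_bilinear ((**) :: 'e::{real_algebra_1,euclidean_space}^'n^'m \<Rightarrow> 'e^'p^'n \<Rightarrow> 'e^'p^'m)"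
  unfolding bilinear_conv_bounded_bilinear[symmetric] bilinear_def
  by (auto intro!: linearI simp: matrix_mul_add_left matrix_add_ldistrib matrix_mul_scaleR_left
      matrix_mul_scaleR_right)

lemma bounded_bilinear_matrix_vector_mult:
  "bounded_bilinear ((*v) :: 'e::{real_algebra_1,euclidean_space}^'n^'m \<Rightarrow> 'e^'n \<Rightarrow> 'e^'m)"
  unfolding bilinear_conv_bounded_bilinear[symmetric] bilinear_def
  by (auto intro!: linearI simp: matrix_vector_mult_add_rdistrib matrix_vector_right_distrib
      matrix_vector_mult_scaleR_left matrix_vector_mult_scaleR_right)

lemma bounded_bilinear_smult:
  "bounded_bilinear ((*s) :: 'e::{real_algebra_1,euclidean_space} \<Rightarrow> 'e^'n \<Rightarrow> 'e^'n)"
  unfolding bilinear_conv_bounded_bilinear[symmetric] bilinear_def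
  by (auto intro!: linearI simp: vec_eq_iff algebra_simps)

lemmas continuous_on_bilinear = bounded_bilinear.continuous_on[OF bounded_bilinear_algebra_mult]
  bounded_bilinear.continuous_on[OF bounded_bilinear_matrix_mult]
  bounded_bilinear.continuous_on[OF bounded_bilinear_matrix_vector_mult]
  bounded_bilinear.continuous_on[OF bounded_bilinear_smult]

lemma continuous_on_mat:
  fixes f :: "'a::topological_space \<Rightarrow> 'e::euclidean_space"
  assumes "continuous_on S f"
  shows "continuous_on S (\<lambda>x. mat (f x) :: 'e^'n^'n)"
proof -
  have "linear (mat :: 'e \<Rightarrow> 'e^'n^'n)"
    by (auto intro!: linearI simp: vec_eq_iff mat_def)
  then have "bounded_linear (mat :: 'e \<Rightarrow> 'e^'n^'n)"
    by (simp add: linear_conv_bounded_linear)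
  then show ?thesis
    using assms by (rule bounded_linear.continuous_on)
qed

section \<open>Compactness and finite-dimensional norms\<close>

text \<open>The explicit constant matters: it is a finite sum that varies continuously when
  \<open>f\<close> depends on parameters, as in \<open>Theta_near_identity\<close>.\<close>

lemma linear_norm_le_sum_Basis:
  fixes f :: "'a::euclidean_space \<Rightarrow> 'b::real_normed_vector"
  assumes "linear f"
  shows "norm (f x) \<le> (\<Sum>b\<in>Basis. norm (f b)) * norm x"
proof -
  have "f x = (\<Sum>b\<in>Basis. (x \<bullet> b) *\<^sub>R f b)"
    by (metis (no_types, lifting) assms euclidean_representation linear_sum linear_scale sum.cong)
  also have "norm \<dots> \<le> (\<Sum>b\<in>Basis. norm ((x \<bullet> b) *\<^sub>R f b))"
    by (rule norm_sum)
  also have "\<dots> \<le> (\<Sum>b\<in>Basis. norm (f b) * norm x)"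
    by (rule sum_mono) (simp add: Basis_le_norm mult.commute[of _ "norm (f _)"] mult_left_mono)
  finally show ?thesis
    by (simp add: sum_distrib_right)
qed

lemma compact_uniformly_nonzero:
  fixes f :: "nat \<Rightarrow> 'a::topological_space \<Rightarrow> real"
  assumes "compact S" and cont: "\<And>k. continuous_on UNIV (f k)"
    and nz: "\<And>x. x \<in> S \<Longrightarrow> \<exists>k. f k x \<noteq> 0"
  shows "\<exists>n. \<exists>c>0. \<forall>x\<in>S. \<exists>k<n. c \<le> \<bar>f k x\<bar>"
proof -
  \<comment> \<open>The same \<open>n\<close> bounds the index and sets the threshold, so these open
    sets increase with \<open>n\<close> and a finite subcover amounts to a single one of
    them.\<close>
  define O' where "O' n = (\<Union>k<n. {x. 1 / real (Suc n) < \<bar>f k x\<bar>})" for n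
  have "open (O' n)" for n
    unfolding O'_def by (intro open_UN ballI open_Collect_less continuous_intros cont)
  moreover have "S \<subseteq> (\<Union>n\<in>UNIV. O' n)"
  proof
    fix x assume "x \<in> S"
    then obtain k where "0 < \<bar>f k x\<bar>"
      using nz by force
    then obtain j where j: "1 / real (Suc j) < \<bar>f k x\<bar>"
      using nat_approx_posE by blast
    have "1 / real (Suc (max j (Suc k))) \<le> 1 / real (Suc j)"
      by (simp add: frac_le)
    then have "1 / real (Suc (max j (Suc k))) < \<bar>f k x\<bar>" "k < max j (Suc k)"
      using j by linarith+
    then have "x \<in> O' (max j (Suc k))"
      unfolding O'_def by blast
    then show "x \<in> (\<Union>n\<in>UNIV. O' n)"
      by blast
  qed
  ultimately obtain D where D: "finite D" "S \<subseteq> (\<Union>n\<in>D. O' n)"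
    using compactE_image[OF \<open>compact S\<close>, of UNIV O'] by metis
  define n where "n = Max (insert 0 D)"
  have "\<exists>k<n. 1 / real (Suc n) \<le> \<bar>f k x\<bar>" if x: "x \<in> S" for x
  proof -
    obtain j where j: "j \<in> D" "x \<in> O' j"
      using D x by blast
    then obtain k where k: "k < j" "1 / real (Suc j) < \<bar>f k x\<bar>"
      by (auto simp: O'_def)
    have "j \<le> n"
      using D j by (simp add: n_def)
    moreover from this have "1 / real (Suc n) \<le> 1 / real (Suc j)"
      by (simp add: frac_le)
    ultimately show ?thesis
      using k by (intro exI[of _ k]) linarith
  qed
  then show ?thesis
    by (intro exI[of _ n] exI[of _ "1 / real (Suc n)"]) auto
qed

text \<open>Membership is part of the conclusion because \<open>norm_on\<close> speaks only about
  elements of \<open>S\<close>, so the induction needs it to apply subadditivity.\<close>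

lemma norm_on_sum_le:
  assumes N: "norm_on S N" and fin: "finite I"
    and zero: "(\<lambda>_. 0) \<in> S"
    and add: "\<And>f g. f \<in> S \<Longrightarrow> g \<in> S \<Longrightarrow> (\<lambda>x. f x + g x) \<in> S"
    and scale: "\<And>f r. f \<in> S \<Longrightarrow> (\<lambda>x. r *\<^sub>R f x) \<in> S"
    and F: "\<And>i. i \<in> I \<Longrightarrow> F i \<in> S"
  shows "(\<lambda>x. \<Sum>i\<in>I. a i *\<^sub>R F i x) \<in> S \<and> N (\<lambda>x. \<Sum>i\<in>I. a i *\<^sub>R F i x) \<le> (\<Sum>i\<in>I. \<bar>a i\<bar> * N (F i))"
  using fin F
proof (induction I rule: finite_induct)
  case empty
  then show ?case
    using N zero by (auto simp: norm_on_def)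
next
  case (insert i I)
  let ?G = "\<lambda>x. \<Sum>i\<in>I. a i *\<^sub>R F i x"
  have *: "?G \<in> S" "N ?G \<le> (\<Sum>i\<in>I. \<bar>a i\<bar> * N (F i))" "(\<lambda>x. a i *\<^sub>R F i x) \<in> S" "F i \<in> S"
    using insert scale by auto
  then have "N (\<lambda>x. a i *\<^sub>R F i x + ?G x) \<le> N (\<lambda>x. a i *\<^sub>R F i x) + N ?G"
    using N unfolding norm_on_def by fast
  moreover have "N (\<lambda>x. a i *\<^sub>R F i x) = \<bar>a i\<bar> * N (F i)"
    using N * by (simp add: norm_on_def)
  ultimately show ?case
    using insert.hyps * add[of "\<lambda>x. a i *\<^sub>R F i x" ?G] by simp
qed

text \<open>The minimum of \<open>b x x\<close> over the compact unit sphere of \<open>V\<close> is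
  positive; homogeneity of degree 2 makes its square root the constant.\<close>

lemma positive_bilinear_lower_bound:
  fixes b :: "'a::euclidean_space \<Rightarrow> 'a \<Rightarrow> real"
  assumes b: "bilinear b" and V: "subspace V" and pos: "\<And>x. x \<in> V \<Longrightarrow> x \<noteq> 0 \<Longrightarrow> 0 < b x x"
  shows "\<exists>c>0. \<forall>x\<in>V. c * norm x \<le> sqrt (b x x)"
proof -
  have "bounded_bilinear b"
    using b by (simp add: bilinear_conv_bounded_bilinear)
  then have cont: "continuous_on (V \<inter> sphere 0 1) (\<lambda>x. b x x)"
    by (rule bounded_bilinear.continuous_on) (rule continuous_on_id)+
  have "compact (V \<inter> sphere 0 1)"
    using V by (intro closed_Int_compact closed_subspace) auto
  then obtain m where m: "m > 0" "\<And>x. x \<in> V \<inter> sphere 0 1 \<Longrightarrow> m \<le> b x x"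
  proof (cases "V \<inter> sphere 0 1 = {}")
    case True
    then show ?thesis
      using that[of 1] by auto
  next
    case False
    then obtain x where x: "x \<in> V \<inter> sphere 0 1" "\<And>y. y \<in> V \<inter> sphere 0 1 \<Longrightarrow> b x x \<le> b y y"
      using continuous_attains_inf[OF \<open>compact (V \<inter> sphere 0 1)\<close> False cont] by blast
    moreover have "0 < b x x"
      using x by (intro pos) auto
    ultimately show ?thesis
      using that[of "b x x"] by blast
  qed
  have "sqrt m * norm x \<le> sqrt (b x x)" if x: "x \<in> V" for x
  proof (cases "x = 0")
    case True
    then show ?thesis
      using bilinear_lzero[OF b] by simp
  next
    case False
    let ?y = "x /\<^sub>R norm x"
    have "m \<le> b ?y ?y"
      using False x V by (intro m) (auto simp: subspace_scale)
    also have "\<dots> = b x x / (norm x)\<^sup>2"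
      using False by (simp add: bilinear_lmul[OF b] bilinear_rmul[OF b] field_simps power2_eq_square)
    finally have "m * (norm x)\<^sup>2 \<le> b x x"
      using False by (simp add: field_simps)
    then have "sqrt (m * (norm x)\<^sup>2) \<le> sqrt (b x x)"
      by (rule real_sqrt_le_mono)
    then show ?thesis
      by (simp add: real_sqrt_mult)
  qed
  then show ?thesis
    using m(1) by (intro exI[of _ "sqrt m"]) auto
qed

lemma matrix_mult_norm_bound:
  obtains C where "C > 0"
    "\<And>(A :: 'e::{real_algebra_1,euclidean_space}^'m^'m) (B :: 'e^'m^'m). norm (A ** B) \<le> C * norm A * norm B"
proof -
  obtain C where "C > 0" "\<And>(A :: 'e^'m^'m) (B :: 'e^'m^'m). norm (A ** B) \<le> norm A * norm B * C"
    using bounded_bilinear.pos_bounded[OF bounded_bilinear_matrix_mult] by blast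
  then show ?thesis
    by (intro that[of C]) (auto simp: mult_ac)
qed

lemma mat_mult_norm_bound:
  obtains C where "C > 0"
    "\<And>c (A :: 'e::{real_algebra_1,euclidean_space}^'m^'m). norm (mat c ** A) \<le> C * norm c * norm A"
proof -
  obtain C where C: "C > 0" "\<And>(A :: 'e^'m^'m) (B :: 'e^'m^'m). norm (A ** B) \<le> C * norm A * norm B"
    by (rule matrix_mult_norm_bound[where 'e = 'e and 'm = 'm]) blast
  have "linear (mat :: 'e \<Rightarrow> 'e^'m^'m)"
    by (auto intro!: linearI simp: vec_eq_iff mat_def)
  then obtain D where D: "D > 0" "\<And>c::'e. norm (mat c :: 'e^'m^'m) \<le> D * norm c"
    using linear_bounded_pos by blast
  have "norm (mat c ** A) \<le> C * D * norm c * norm A" for c and A :: "'e^'m^'m"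
  proof -
    have "norm (mat c ** A) \<le> C * norm (mat c :: 'e^'m^'m) * norm A"
      by (rule C)
    also have "\<dots> \<le> C * (D * norm c) * norm A"
      using C D by (intro mult_right_mono mult_left_mono) auto
    finally show ?thesis
      by (simp add: mult_ac)
  qed
  then show ?thesis
    using C D by (intro that[of "C * D"]) auto
qed

section \<open>The quadratic algebra and the hermitian form\<close>

text \<open>The field stays abstract so that F real and F complex become two interpretations of one
  argument; \<open>euclidean_space\<close> supplies the real dimension counts.\<close>

locale unitary_pair =
  fixes \<iota> :: "'f::{real_normed_field,euclidean_space} \<Rightarrow> 'e::{comm_ring_1,real_algebra_1,euclidean_space}"
    and \<sigma> :: "'e \<Rightarrow> 'e" and h :: "'e^'m \<Rightarrow> 'e^'m \<Rightarrow> 'e" and e :: "'e^'m"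
  assumes GGP: "unitary_GGP \<iota> \<sigma> h e"
begin

lemma etale: "quadratic_etale \<iota>" and involution: "nontrivial_involution \<iota> \<sigma>"
  and hermitian: "hermitian_form \<sigma> h" and h_e_e_dvd: "h e e dvd 1"
  using GGP by (auto simp: unitary_GGP_def)

lemma iota_1 [simp]: "\<iota> 1 = 1" and iota_add: "\<iota> (a + b) = \<iota> a + \<iota> b"
  and iota_mult: "\<iota> (a * b) = \<iota> a * \<iota> b" and iota_of_real [simp]: "\<iota> (of_real r) = of_real r"
  using etale by (auto simp: quadratic_etale_def unital_ring_hom_def)

lemma iota_scaleR: "\<iota> (r *\<^sub>R a) = r *\<^sub>R \<iota> a"
  by (simp add: scaleR_conv_of_real iota_mult)

lemma linear_iota: "linear \<iota>"
  by (rule linearI) (simp_all add: iota_add iota_scaleR)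

lemma iota_0 [simp]: "\<iota> 0 = 0"
  using linear_0[OF linear_iota] .

lemma iota_eq_0_iff [simp]: "\<iota> a = 0 \<longleftrightarrow> a = 0"
proof
  assume "\<iota> a = 0"
  then have "a \<noteq> 0 \<Longrightarrow> \<iota> 1 = 0"
    by (metis iota_mult mult_zero_left right_inverse)
  then show "a = 0"
    by auto
qed simp

lemma sigma_1 [simp]: "\<sigma> 1 = 1" and sigma_add [simp]: "\<sigma> (a + b) = \<sigma> a + \<sigma> b"
  and sigma_mult [simp]: "\<sigma> (a * b) = \<sigma> a * \<sigma> b" and sigma_iota [simp]: "\<sigma> (\<iota> x) = \<iota> x"
  using involution by (auto simp: nontrivial_involution_def unital_ring_hom_def)

lemma sigma_scaleR [simp]: "\<sigma> (r *\<^sub>R a) = r *\<^sub>R \<sigma> a"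
proof -
  have "\<sigma> (of_real r) = of_real r"
    by (metis iota_of_real sigma_iota)
  then show ?thesis
    by (simp add: scaleR_conv_of_real)
qed

lemma linear_sigma: "linear \<sigma>"
  by (rule linearI) simp_all

lemma sigma_0 [simp]: "\<sigma> 0 = 0" and sigma_uminus [simp]: "\<sigma> (- a) = - \<sigma> a"
  and sigma_diff [simp]: "\<sigma> (a - b) = \<sigma> a - \<sigma> b" and sigma_sum: "\<sigma> (sum f A) = (\<Sum>i\<in>A. \<sigma> (f i))"
  using linear_0[OF linear_sigma] linear_neg[OF linear_sigma] linear_diff[OF linear_sigma]
    linear_sum[OF linear_sigma] by auto

lemma h_flip: "h v u = \<sigma> (h u v)"
  and h_add_left: "h (u + v) w = h u w + h v w"
  and h_smult_left: "h (c *s u) v = c * h u v"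
  and h_nondegenerate: "(\<And>v. h u v = 0) \<Longrightarrow> u = 0"
  using hermitian unfolding hermitian_form_def by blast+

lemma h_add_right: "h u (v + w) = h u v + h u w"
  by (metis h_add_left h_flip sigma_add)

lemma h_smult_right: "h u (c *s v) = \<sigma> c * h u v"
  by (metis h_smult_left h_flip sigma_mult)

lemma h_scaleR_left: "h (r *\<^sub>R u) v = r *\<^sub>R h u v"
  by (simp add: scaleR_conv_smult h_smult_left scaleR_conv_of_real)

lemma h_scaleR_right: "h u (r *\<^sub>R v) = r *\<^sub>R h u v"
  by (metis h_scaleR_left h_flip sigma_scaleR)

lemma h_0_left [simp]: "h 0 v = 0" and h_0_right [simp]: "h v 0 = 0"
  using h_scaleR_left[of 0 0 v] h_scaleR_right[of v 0 0] by simp_all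

lemma h_uminus_left: "h (- u) v = - h u v" and h_uminus_right: "h u (- v) = - h u v"
  using h_scaleR_left[of "-1" u v] h_scaleR_right[of u "-1" v] by simp_all

lemma h_diff_left: "h (u - v) w = h u w - h v w" and h_diff_right: "h u (v - w) = h u v - h u w"
  using h_add_left[of u "- v" w] h_add_right[of u v "- w"] by (simp_all add: h_uminus_left h_uminus_right)

lemmas h_simps = h_add_left h_add_right h_smult_left h_smult_right h_scaleR_left h_scaleR_right
  h_uminus_left h_uminus_right h_diff_left h_diff_right

lemma h_nondegenerate_right: "(\<And>u. h u v = 0) \<Longrightarrow> v = 0"
  by (metis h_flip h_nondegenerate sigma_0)

lemma h_eqI_right: "(\<And>u. h u v = h u v') \<Longrightarrow> v = v'"
  using h_nondegenerate_right[of "v - v'"] by (simp add: h_diff_right)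

lemma bounded_bilinear_h: "bounded_bilinear h"
  unfolding bilinear_conv_bounded_bilinear[symmetric] bilinear_def
  by (auto intro!: linearI simp: h_simps)

definition \<epsilon> where "\<epsilon> = (SOME x. h e e * x = 1)"

lemma h_e_e [simp]: "h e e * \<epsilon> = 1" "\<epsilon> * h e e = 1"
proof -
  have "\<exists>x. h e e * x = 1"
    using h_e_e_dvd by (auto simp: dvd_def)
  then show "h e e * \<epsilon> = 1"
    unfolding \<epsilon>_def by (rule someI_ex)
  then show "\<epsilon> * h e e = 1"
    by (simp add: mult.commute)
qed

text \<open>Flipping the arguments of \<open>h\<close> twice changes nothing, so applying \<sigma>
  twice fixes every value of \<open>h\<close>; every \<open>x\<close> is such a value because
  \<open>h e e\<close> is a unit.\<close>

lemma sigma_sigma [simp]: "\<sigma> (\<sigma> x) = x"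
proof -
  have "h ((x * \<epsilon>) *s e) e = \<sigma> (\<sigma> (h ((x * \<epsilon>) *s e) e))"
    by (metis h_flip)
  then show ?thesis
    by (simp add: h_smult_left mult.assoc)
qed

lemma half_eq_0: "x + x = 0 \<Longrightarrow> x = (0::'e)"
  by (metis scaleR_2 scaleR_eq_0_iff zero_neq_numeral)

section \<open>The skew unit \<open>\<delta>\<close> and the splitting E = F + F
  \<open>\<delta>\<close>\<close>

lemma ex_delta: "\<exists>\<delta>. \<sigma> \<delta> = - \<delta> \<and> \<delta> \<noteq> 0"
proof -
  obtain x where x: "\<sigma> x \<noteq> x"
    using involution by (force simp: nontrivial_involution_def)
  show ?thesis
    by (rule exI[of _ "x - \<sigma> x"]) (use x in auto)
qed

definition \<delta> where "\<delta> = (SOME \<delta>. \<sigma> \<delta> = - \<delta> \<and> \<delta> \<noteq> 0)"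

lemma sigma_delta [simp]: "\<sigma> \<delta> = - \<delta>" and delta_nonzero: "\<delta> \<noteq> 0"
  using someI_ex[OF ex_delta] unfolding \<delta>_def by auto

lemma iota_delta_eq_0: "\<iota> b * \<delta> = 0 \<Longrightarrow> b = 0"
  by (metis delta_nonzero iota_1 iota_mult left_inverse mult.assoc mult_1_left mult_zero_right)

text \<open>Applying \<sigma> separates the two summands, so the map from F x F is injective.
  Composed with the inverse of the coordinates given by \<open>s\<close> and \<open>t\<close> it is
  a real-linear endomorphism of F x F, hence surjective.\<close>

lemma iota_delta_decomposition: obtains a b where "x = \<iota> a + \<iota> b * \<delta>"
proof -
  obtain s t where st: "bij (\<lambda>(a, b). \<iota> a * s + \<iota> b * t)"
    using etale by (auto simp: quadratic_etale_def)
  define G where "G = (\<lambda>(a, b). \<iota> a * s + \<iota> b * t)"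
  define F where "F = (\<lambda>(a, b). \<iota> a + \<iota> b * \<delta>)"
  have lin: "linear G" "linear F"
    by (auto intro!: linearI simp: G_def F_def iota_add iota_scaleR algebra_simps)
  have bij: "bij G"
    using st by (simp add: G_def)
  have "linear (inv G)"
    by (rule linearI; rule injD[OF bij_is_inj[OF bij]])
       (simp_all add: linear_add[OF lin(1)] linear_scale[OF lin(1)] surj_f_inv_f[OF bij_is_surj[OF bij]])
  then have lin': "linear (inv G \<circ> F)"
    using lin linear_compose by blast
  have "ab = 0" if "F ab = 0" for ab
  proof -
    obtain a b where ab: "ab = (a, b)" by (cases ab)
    have 1: "\<iota> a + \<iota> b * \<delta> = 0"
      using that by (simp add: F_def ab)
    then have "\<sigma> (\<iota> a + \<iota> b * \<delta>) = 0"
      by (simp only: sigma_0)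
    then have 2: "\<iota> a - \<iota> b * \<delta> = 0"
      by simp
    have "\<iota> a + \<iota> a = (\<iota> a + \<iota> b * \<delta>) + (\<iota> a - \<iota> b * \<delta>)"
      by simp
    then have "\<iota> a = 0"
      unfolding 1 2 by (simp add: half_eq_0 del: iota_eq_0_iff)
    then show ?thesis
      using 1 iota_delta_eq_0 by (auto simp: ab zero_prod_def)
  qed
  then have "inj F"
    using linear_injective_0[OF lin(2)] by blast
  then have "inj (inv G \<circ> F)"
    using bij by (intro inj_compose bij_is_inj[OF bij_imp_bij_inv])
  then have "surj (inv G \<circ> F)"
    using lin' linear_injective_imp_surjective by blast
  then obtain ab where "inv G (F ab) = inv G x"
    by (metis comp_apply surjD)
  then have "F ab = x"
    by (metis bij bij_inv_eq_iff)
  then show ?thesis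
    using that by (cases ab) (auto simp: F_def)
qed

lemma sigma_fixed: assumes "\<sigma> x = x" obtains a where "x = \<iota> a"
proof -
  obtain a b where ab: "x = \<iota> a + \<iota> b * \<delta>"
    by (rule iota_delta_decomposition)
  have "\<iota> b * \<delta> = 0"
    by (rule half_eq_0) (use assms in \<open>simp add: ab eq_neg_iff_add_eq_0[symmetric]\<close>)
  then show ?thesis
    using that ab by simp
qed

lemma sigma_skew: assumes "\<sigma> x = - x" obtains b where "x = \<iota> b * \<delta>"
proof -
  obtain a b where ab: "x = \<iota> a + \<iota> b * \<delta>"
    by (rule iota_delta_decomposition)
  have "\<iota> a = 0"
    by (rule half_eq_0) (use assms in \<open>simp add: ab eq_neg_iff_add_eq_0[symmetric]\<close>)
  then show ?thesis
    using that ab by simp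
qed

text \<open>This is where etale excludes the dual numbers: a nonzero square-zero element is neither
  a unit nor present in F x F.\<close>

lemma delta_square_nonzero: "\<delta> * \<delta> \<noteq> 0"
proof
  assume *: "\<delta> * \<delta> = 0"
  consider y where "\<delta> * y = 1" |
    \<phi> :: "'e \<Rightarrow> 'f \<times> 'f" where "unital_ring_hom \<phi>" "bij \<phi>"
    using etale delta_nonzero unfolding quadratic_etale_def by metis
  then show False
  proof cases
    case 1
    then have "\<delta> * \<delta> * y = \<delta>"
      by (simp add: mult.assoc)
    then show ?thesis
      using * delta_nonzero by simp
  next
    case 2
    have add: "\<phi> (x + y) = \<phi> x + \<phi> y" for x y
      using 2 by (simp add: unital_ring_hom_def)
    have "\<phi> 0 = 0"
      using add[of 0 0] by simp
    moreover have "\<phi> \<delta> * \<phi> \<delta> = \<phi> 0"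
      using 2 * by (metis unital_ring_hom_def)
    ultimately have "\<phi> \<delta> = \<phi> 0"
      by (cases "\<phi> \<delta>") (simp add: zero_prod_def)
    then show ?thesis
      using 2 delta_nonzero by (metis bij_is_inj injD)
  qed
qed

lemma delta_unit: "\<exists>y. \<delta> * y = 1 \<and> \<sigma> y = - y"
proof -
  obtain d where d: "\<delta> * \<delta> = \<iota> d"
    by (rule sigma_fixed[of "\<delta> * \<delta>"]) simp_all
  then have "d \<noteq> 0"
    using delta_square_nonzero by auto
  then have "\<delta> * (\<delta> * \<iota> (inverse d)) = 1"
    by (simp add: d flip: mult.assoc iota_mult)
  then show ?thesis
    by (intro exI[of _ "\<delta> * \<iota> (inverse d)"]) simp
qed

definition \<delta>' where "\<delta>' = (SOME y. \<delta> * y = 1 \<and> \<sigma> y = - y)"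

lemma delta_inverse [simp]: "\<delta> * \<delta>' = 1" "\<delta>' * \<delta> = 1" "\<sigma> \<delta>' = - \<delta>'"
  using someI_ex[OF delta_unit] unfolding \<delta>'_def by (auto simp: mult.commute)

text \<open>The fixed ring of \<sigma> is the field F. Applied to \<open>h a a\<close>, this allows
  division by the length of an anisotropic vector.\<close>

lemma sigma_fixed_unit:
  assumes "\<sigma> x = x" "x \<noteq> 0"
  obtains y where "x * y = 1" "\<sigma> y = y"
proof -
  obtain a where a: "x = \<iota> a"
    using assms sigma_fixed by blast
  show ?thesis
    by (rule that[of "\<iota> (inverse a)"]) (use assms a in \<open>auto simp flip: iota_mult\<close>)
qed

text \<open>Nondegeneracy of the trace pairing of E over F: either \<open>c\<close> itself has
  nonzero trace, or \<open>c\<close> is skew and \<open>\<delta> * c\<close> is fixed by \<sigma>,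
  with trace twice itself. A nonzero trace is a unit.\<close>

lemma ex_trace_eq_1:
  assumes "c \<noteq> 0"
  shows "\<exists>\<gamma>. \<gamma> * c + \<sigma> (\<gamma> * c) = 1"
proof -
  have *: ?thesis if t: "\<gamma> * c + \<sigma> (\<gamma> * c) \<noteq> 0" for \<gamma>
  proof -
    obtain y where y: "(\<gamma> * c + \<sigma> (\<gamma> * c)) * y = 1" "\<sigma> y = y"
      by (rule sigma_fixed_unit[OF _ t]) (auto simp: add.commute)
    show ?thesis
      by (rule exI[of _ "y * \<gamma>"]) (use y in \<open>simp add: algebra_simps\<close>)
  qed
  show ?thesis
  proof (cases "c + \<sigma> c = 0")
    case False
    then show ?thesis using *[of 1] by simp
  next
    case True
    then have "\<sigma> c = - c"
      by (simp add: eq_neg_iff_add_eq_0 add.commute)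
    then have 1: "\<delta> * c + \<sigma> (\<delta> * c) = \<delta> * c + \<delta> * c"
      by simp
    have "\<delta> * c \<noteq> 0"
      using assms by (metis delta_inverse(2) mult.assoc mult_1_left mult_zero_right)
    then show ?thesis
      using *[of \<delta>] 1 half_eq_0 by metis
  qed
qed

text \<open>A real functional of the trace \<open>x + \<sigma> x\<close>. The inner product with 1
  merely selects a real coordinate that does not vanish at 1.\<close>

definition re :: "'e \<Rightarrow> real" where "re x = (x + \<sigma> x) \<bullet> 1"

lemma linear_re: "linear re"
  by (auto intro!: linearI simp: re_def algebra_simps inner_add_left)

lemma ex_re_nonzero:
  assumes "c \<noteq> 0"
  shows "\<exists>\<gamma>. re (\<gamma> * c) \<noteq> 0"
proof -
  obtain \<gamma> where "\<gamma> * c + \<sigma> (\<gamma> * c) = 1"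
    using ex_trace_eq_1 assms by blast
  then have "re (\<gamma> * c) = 1 \<bullet> (1::'e)"
    by (simp only: re_def)
  then show ?thesis
    by (metis inner_eq_zero_iff zero_neq_one)
qed

section \<open>Adjoints, the unitary group and its Lie algebra\<close>

text \<open>Nondegeneracy makes the map from \<open>w\<close> to the values
  \<open>h (axis i 1) w\<close> injective. It is conjugate-linear over E but linear over the reals,
  so a dimension count makes it surjective.\<close>

lemma h_representation:
  assumes add: "\<And>x y. f (x + y) = f x + f y" and smult: "\<And>c x. f (c *s x) = c * f x"
  shows "\<exists>w. \<forall>u. h u w = f u"
proof -
  define R :: "'e^'m \<Rightarrow> 'e^'m" where "R w = (\<chi> i. h (axis i 1) w)" for w
  have f0: "f 0 = 0"
    using add[of 0 0] by simp
  have expand: "f u = (\<Sum>i\<in>UNIV. u$i * f (axis i 1))"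
    if add: "\<And>x y. f (x + y) = f x + f y" and smult: "\<And>c x. f (c *s x) = c * f x" and f0: "f 0 = 0"
    for f :: "'e^'m \<Rightarrow> 'e" and u
  proof -
    have "f u = f (\<Sum>i\<in>UNIV. u$i *s axis i 1)"
      by (simp add: basis_expansion)
    also have "\<dots> = (\<Sum>i\<in>UNIV. f (u$i *s axis i 1))"
      using sum_comp_morphism[of f "\<lambda>i. u$i *s axis i 1" UNIV] f0 add by (simp add: o_def)
    finally show ?thesis
      by (simp add: smult)
  qed
  have h_expand: "h u w = (\<Sum>i\<in>UNIV. u$i * h (axis i 1) w)" for u w
    by (rule expand) (simp_all add: h_simps)
  have lin: "linear R"
    by (auto intro!: linearI simp: R_def vec_eq_iff h_simps)
  have "w = 0" if "R w = 0" for w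
  proof (rule h_nondegenerate_right)
    have "h (axis i 1) w = 0" for i
      using arg_cong[OF that, of "\<lambda>v. v $ i"] by (simp add: R_def)
    then show "h u w = 0" for u
      by (subst h_expand) simp
  qed
  then have "surj R"
    using lin linear_injective_0 linear_injective_imp_surjective by blast
  then obtain w where w: "R w = (\<chi> i. f (axis i 1))"
    by (metis surjD)
  have "h (axis i 1) w = f (axis i 1)" for i
    using arg_cong[OF w, of "\<lambda>v. v $ i"] by (simp add: R_def)
  then have "h u w = f u" for u
    unfolding h_expand[of u] expand[of f u, OF add smult f0] by simp
  then show ?thesis
    by blast
qed

definition adj :: "'e^'m^'m \<Rightarrow> 'e^'m^'m" where
  "adj X = (SOME Y. \<forall>u v. h (X *v u) v = h u (Y *v v))"

lemma h_adj_left: "h (X *v u) v = h u (adj X *v v)"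
proof -
  have "\<exists>w. \<forall>u. h u w = h (X *v u) v" for v
    by (rule h_representation) (simp_all add: matrix_apply h_simps)
  then obtain f where f: "\<And>u v. h u (f v) = h (X *v u) v"
    by metis
  have "matrix f *v v = f v" for v
    by (rule matrix_vector_mult_matrix; rule h_eqI_right) (simp_all add: f h_simps)
  then have "\<exists>Y. \<forall>u v. h (X *v u) v = h u (Y *v v)"
    using f by metis
  from someI_ex[OF this] show ?thesis
    unfolding adj_def by blast
qed

lemma h_adj_right: "h (adj X *v u) v = h u (X *v v)"
  by (metis h_adj_left h_flip)

lemma adj_eqI:
  assumes "\<And>u v. h (X *v u) v = h u (Y *v v)"
  shows "adj X = Y"
  unfolding matrix_eq by (metis assms h_adj_left h_eqI_right)

lemma adj_adj [simp]: "adj (adj X) = X"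
  by (rule adj_eqI) (rule h_adj_right)

lemma adj_mult: "adj (X ** Y) = adj Y ** adj X"
  by (rule adj_eqI) (simp add: h_adj_left flip: matrix_vector_mul_assoc)

lemma adj_mat [simp]: "adj (mat c) = mat (\<sigma> c)"
  by (rule adj_eqI) (simp add: mat_vector_mult h_simps)

lemma adj_add: "adj (X + Y) = adj X + adj Y"
  and adj_diff: "adj (X - Y) = adj X - adj Y"
  and adj_scaleR: "adj (r *\<^sub>R X) = r *\<^sub>R adj X"
  by (rule adj_eqI; simp add: matrix_apply h_simps h_adj_left)+

lemma adj_0 [simp]: "adj 0 = 0"
  using adj_scaleR[of 0 0] by simp

lemma linear_adj: "linear adj"
  by (rule linearI) (simp_all add: adj_add adj_scaleR)

section \<open>The Lie algebra and the unitary groups in terms of adjoints\<close>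

lemma lie_g_iff: "X \<in> lie_g h \<longleftrightarrow> adj X = - X"
proof
  assume X: "X \<in> lie_g h"
  have "h (X *v u) v = h u ((- X) *v v)" for u v
    using X by (simp add: lie_g_def eq_neg_iff_add_eq_0 matrix_apply h_simps)
  then show "adj X = - X"
    by (rule adj_eqI)
next
  assume "adj X = - X"
  then show "X \<in> lie_g h"
    by (simp add: lie_g_def h_adj_left matrix_apply h_simps)
qed

lemma subspace_lie_g: "subspace (lie_g h)"
  by (auto simp: subspace_def lie_g_iff adj_add adj_scaleR)

lemma U_V_iff: "g \<in> U_V h \<longleftrightarrow> adj g ** g = mat 1"
proof
  assume "g \<in> U_V h"
  then have "(adj g ** g) *v v = v" for v
    by (intro h_eqI_right) (simp add: U_V_def h_adj_left[symmetric] flip: matrix_vector_mul_assoc)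
  then show "adj g ** g = mat 1"
    by (simp add: matrix_eq)
next
  assume *: "adj g ** g = mat 1"
  then have "h (g *v u) (g *v v) = h u v" for u v
    by (simp add: h_adj_left matrix_vector_mul_assoc)
  moreover have "g ** adj g = mat 1"
    using * by (rule matrix_left_inverse_imp_right)
  ultimately show "g \<in> U_V h"
    using * by (auto simp: U_V_def invertible_def)
qed

lemma U_V_preserves: "g \<in> U_V h \<Longrightarrow> h (g *v u) (g *v v) = h u v"
  by (simp add: U_V_def)

lemma U_V_right: "g \<in> U_V h \<Longrightarrow> g ** adj g = mat 1"
  by (simp add: U_V_iff matrix_left_inverse_imp_right)

lemma U_V_apply [simp]:
  assumes "g \<in> U_V h"
  shows "adj g *v (g *v v) = v" "g *v (adj g *v v) = v"
  using assms U_V_right[OF assms] by (simp_all add: matrix_vector_mul_assoc U_V_iff)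

lemma matrix_inv_U_V: "g \<in> U_V h \<Longrightarrow> matrix_inv g = adj g"
  by (rule matrix_inv_eqI) (auto simp: U_V_iff matrix_left_inverse_imp_right)

lemma U_V_mat_1: "mat 1 \<in> U_V h"
  by (simp add: U_V_iff)

lemma U_V_adj: "g \<in> U_V h \<Longrightarrow> adj g \<in> U_V h"
  by (simp add: U_V_iff matrix_left_inverse_imp_right)

lemma U_V_mult:
  assumes "g \<in> U_V h" "g' \<in> U_V h"
  shows "g ** g' \<in> U_V h"
proof -
  have "adj (g ** g') ** (g ** g') = adj g' ** ((adj g ** g) ** g')"
    by (simp add: adj_mult matrix_mul_assoc)
  then show ?thesis
    using assms by (simp add: U_V_iff)
qed

text \<open>As \<open>h e e\<close> is a unit, V is the orthogonal sum of E e and its complement, so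
  being isometric on both summands is being isometric. Conversely the adjoint of an isometry fixing
  \<open>e\<close> also fixes \<open>e\<close>, and therefore both preserve the complement.\<close>

lemma U_VH_iff: "x \<in> U_VH h e \<longleftrightarrow> x \<in> U_V h \<and> x *v e = e"
proof
  assume x: "x \<in> U_VH h e"
  have e: "x *v e = e" and V: "v \<in> V_H h e \<Longrightarrow> x *v v \<in> V_H h e" for v
    using x by (auto simp: U_VH_def)
  have dec: "\<exists>c w. w \<in> V_H h e \<and> v = c *s e + w" for v
    by (rule exI[of _ "h v e * \<epsilon>"], rule exI[of _ "v - (h v e * \<epsilon>) *s e"])
       (simp add: V_H_def h_simps mult.assoc)
  have perp: "h e w = 0" if "w \<in> V_H h e" for w
    using that h_flip[of e w] by (simp add: V_H_def)
  have "h (x *v u) (x *v v) = h u v" for u v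
  proof -
    obtain c w c' w' where *: "u = c *s e + w" "v = c' *s e + w'" "w \<in> V_H h e" "w' \<in> V_H h e"
      using dec by metis
    then have "h w e = 0" "h w' e = 0" "h (x *v w) e = 0" "h (x *v w') e = 0"
      using V by (auto simp: V_H_def)
    moreover have "h (x *v w) (x *v w') = h w w'"
      using x * by (auto simp: U_VH_def)
    ultimately show ?thesis
      using * perp V by (simp add: matrix_apply h_simps e)
  qed
  then show "x \<in> U_V h \<and> x *v e = e"
    using x by (auto simp: U_VH_def U_V_def)
next
  assume *: "x \<in> U_V h \<and> x *v e = e"
  then have adj_e: "adj x *v e = e"
    by (metis U_V_apply(1))
  have "(\<lambda>v. x *v v) ` V_H h e = V_H h e"
  proof (intro equalityI subsetI)
    fix y assume "y \<in> V_H h e"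
    then have "h (adj x *v y) e = 0"
      using * by (simp add: V_H_def h_adj_right)
    then show "y \<in> (\<lambda>v. x *v v) ` V_H h e"
      using * by (intro image_eqI[of _ _ "adj x *v y"]) (auto simp: V_H_def)
  qed (use adj_e in \<open>auto simp: V_H_def h_adj_left\<close>)
  then show "x \<in> U_VH h e"
    using * by (auto simp: U_VH_def U_V_def)
qed

text \<open>With the Gram matrix \<open>G\<close>, the identity
  \<open>transpose X ** G = G ** S (adj X)\<close> makes the entrywise conjugate of
  \<open>adj X\<close> similar to the transpose of \<open>X\<close>.\<close>

lemma trace_adj: "trace (adj X) = \<sigma> (trace X)"
proof -
  define G :: "'e^'m^'m" where "G = (\<chi> i j. h (axis i 1) (axis j 1))"
  define S :: "'e^'m^'m \<Rightarrow> 'e^'m^'m" where "S Y = (\<chi> i j. \<sigma> (Y$i$j))" for Y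
  have h_sum_left: "h (sum f A) v = (\<Sum>i\<in>A. h (f i) v)" for f :: "'m \<Rightarrow> 'e^'m" and A v
    by (induction A rule: infinite_finite_induct) (simp_all add: h_simps)
  have h_sum_right: "h v (sum f A) = (\<Sum>i\<in>A. h v (f i))" for f :: "'m \<Rightarrow> 'e^'m" and A v
    by (induction A rule: infinite_finite_induct) (simp_all add: h_simps)
  have column: "X *v axis j 1 = (\<Sum>i\<in>UNIV. X$i$j *s axis i 1)" for X :: "'e^'m^'m" and j
    by (simp add: vec_eq_iff matrix_vector_mult_def axis_def if_distrib sum.If_cases cong: if_cong)
  have right: "h (axis j 1) (X *v v) = (G *v (\<chi> i. \<sigma> ((X *v v)$i)))$j" for X :: "'e^'m^'m" and v j
  proof -
    have "h (axis j 1) (X *v v) = h (axis j 1) (\<Sum>i\<in>UNIV. (X *v v)$i *s axis i 1)"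
      by (simp add: basis_expansion)
    also have "\<dots> = (G *v (\<chi> i. \<sigma> ((X *v v)$i)))$j"
      by (simp add: h_sum_right h_simps G_def matrix_vector_mult_def mult.commute)
    finally show ?thesis .
  qed
  have "v = 0" if "G *v v = 0" for v
  proof -
    have "h (axis j 1) (mat 1 *v (\<chi> i. \<sigma> (v$i))) = 0" for j
      by (subst right) (simp add: that)
    then have "h (\<Sum>j\<in>UNIV. u$j *s axis j 1) (\<chi> i. \<sigma> (v$i)) = 0" for u :: "'e^'m"
      by (simp add: h_sum_left h_simps)
    then have "h u (\<chi> i. \<sigma> (v$i)) = 0" for u
      by (simp add: basis_expansion)
    then have "(\<chi> i. \<sigma> (v$i)) = 0"
      by (rule h_nondegenerate_right)
    then show "v = 0"
      by (metis (mono_tags) sigma_0 sigma_sigma vec_eq_iff vec_lambda_beta zero_index)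
  qed
  then obtain G' where G': "G' ** G = mat 1" "G ** G' = mat 1"
    using inj_imp_invertible unfolding invertible_def by blast
  have "transpose X ** G = G ** S (adj X)"
  proof -
    have "(transpose X ** G)$j$k = h (X *v axis j 1) (axis k 1)" for j k
      by (simp add: column h_sum_left h_simps G_def matrix_matrix_mult_def transpose_def)
    also have "h (X *v axis j 1) (axis k 1) = (G ** S (adj X))$j$k" for j k
      unfolding h_adj_left
      by (simp add: column h_sum_right h_simps G_def S_def matrix_matrix_mult_def mult.commute)
    finally show ?thesis
      by (simp add: vec_eq_iff)
  qed
  then have "S (adj X) = G' ** (transpose X ** G)"
    using G' by (metis matrix_mul_assoc matrix_mul_lid)
  then have "trace (S (adj X)) = trace (transpose X ** G ** G')"
    by (simp add: trace_mul_sym[of G'])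
  also have "\<dots> = trace X"
    using G' by (simp add: trace_def transpose_def flip: matrix_mul_assoc)
  finally have "\<sigma> (trace (adj X)) = trace X"
    by (simp add: S_def trace_def sigma_sum)
  then show ?thesis
    by (metis sigma_sigma)
qed

section \<open>Identification of the dual of the Lie algebra\<close>

definition skew :: "'e^'m^'m \<Rightarrow> 'e^'m^'m" where "skew X = (1/2) *\<^sub>R (X - adj X)"

lemma linear_skew: "linear skew"
  by (rule linearI) (simp_all add: skew_def adj_add adj_scaleR algebra_simps)

lemma skew_in_lie_g: "skew X \<in> lie_g h"
  by (simp add: lie_g_iff skew_def adj_scaleR adj_diff flip: scaleR_minus_right)

lemma skew_lie_g: "X \<in> lie_g h \<Longrightarrow> skew X = X"
  by (simp add: lie_g_iff skew_def flip: scaleR_2)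

lemma adj_minus_skew: "adj (X - skew X) = X - skew X"
proof -
  have "X - skew X = (1/2) *\<^sub>R (X + adj X)"
    by (simp add: skew_def scaleR_add_right scaleR_diff_right)
  then show ?thesis
    by (simp add: adj_scaleR adj_add add.commute)
qed

lemma re_skew: "\<sigma> x = - x \<Longrightarrow> re x = 0"
  by (simp add: re_def)

text \<open>Skew and self-adjoint matrices are orthogonal for the trace form. Hence the form,
  nondegenerate on all matrices, represents functionals on the Lie algebra by skew matrices.\<close>

lemma re_trace_selfadjoint:
  assumes "T \<in> lie_g h" "adj S = S"
  shows "re (trace (T ** S)) = 0" "re (trace (S ** T)) = 0"
proof -
  have "\<sigma> (trace (T ** S)) = trace (adj (T ** S))"
    by (simp add: trace_adj)
  also have "\<dots> = trace (S ** (- T))"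
    using assms by (simp add: adj_mult lie_g_iff)
  also have "\<dots> = - trace (S ** T)"
    by (simp add: trace_def matrix_matrix_mult_def sum_negf)
  finally have "\<sigma> (trace (T ** S)) = - trace (T ** S)"
    by (simp add: trace_mul_sym[of T])
  then show "re (trace (T ** S)) = 0"
    by (rule re_skew)
  then show "re (trace (S ** T)) = 0"
    by (simp add: trace_mul_sym[of S])
qed

lemma linear_re_trace: "linear (\<lambda>X. re (trace (T ** X)))" "linear (\<lambda>T. re (trace (T ** X)))"
  by (auto intro!: linearI simp: matrix_add_ldistrib matrix_mul_add_left trace_add linear_add[OF linear_re]
      matrix_mul_scaleR_left matrix_mul_scaleR_right trace_scaleR linear_scale[OF linear_re])

lemma re_trace_skew:
  assumes "T \<in> lie_g h"
  shows "re (trace (T ** skew X)) = re (trace (T ** X))" "re (trace (skew X ** T)) = re (trace (X ** T))"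
proof -
  show "re (trace (T ** skew X)) = re (trace (T ** X))"
    using re_trace_selfadjoint(1)[OF assms adj_minus_skew, of X] linear_diff[OF linear_re_trace(1)[of T], of X "skew X"] by simp
  then show "re (trace (skew X ** T)) = re (trace (X ** T))"
    by (simp add: trace_mul_sym[of T])
qed

section \<open>Functionals as trace pairings\<close>

definition riesz :: "'e^'m^'m \<Rightarrow> 'e^'m^'m" where
  "riesz T = (\<Sum>b\<in>Basis. re (trace (T ** b)) *\<^sub>R b)"

lemma sum_linear_Basis:
  fixes f :: "'e^'m^'m \<Rightarrow> real"
  assumes "linear f"
  shows "(\<Sum>b\<in>Basis. f b *\<^sub>R b) \<bullet> X = f X"
proof -
  have "f X = f (\<Sum>b\<in>Basis. (X \<bullet> b) *\<^sub>R b)"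
    by (simp add: euclidean_representation)
  also have "\<dots> = (\<Sum>b\<in>Basis. (X \<bullet> b) *\<^sub>R f b)"
    by (simp add: linear_sum[OF assms] linear_scale[OF assms])
  finally show ?thesis
    by (simp add: inner_sum_left mult.commute inner_commute[of X])
qed

lemma riesz_inner: "riesz T \<bullet> X = re (trace (T ** X))"
  unfolding riesz_def by (rule sum_linear_Basis) (rule linear_re_trace)

lemma linear_riesz: "linear riesz"
  by (rule linearI) (simp_all add: riesz_def linear_add[OF linear_re_trace(2)]
      linear_scale[OF linear_re_trace(2)] scaleR_add_left sum.distrib scaleR_sum_right)

lemma bij_riesz: "bij riesz"
proof -
  have "T = 0" if T: "riesz T = 0" for T
  proof (rule ccontr)
    assume "T \<noteq> 0"
    then obtain i j where "T$i$j \<noteq> 0"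
      by (auto simp: vec_eq_iff)
    then obtain \<gamma> where \<gamma>: "re (\<gamma> * T$i$j) \<noteq> 0"
      using ex_re_nonzero by blast
    define X :: "'e^'m^'m" where "X = (\<chi> k l. if k = j \<and> l = i then \<gamma> else 0)"
    have "(T ** X)$k$k = (if k = i then \<gamma> * T$i$j else 0)" for k
      by (auto simp: matrix_matrix_mult_def X_def if_distrib mult.commute cong: if_cong)
    then have "trace (T ** X) = \<gamma> * T$i$j"
      by (simp add: trace_def)
    then show False
      using \<gamma> riesz_inner[of T X] T by simp
  qed
  then have "inj riesz"
    using linear_injective_0[OF linear_riesz] by blast
  then show ?thesis
    using linear_injective_imp_surjective[OF linear_riesz] by (simp add: bij_def)
qed

lemma linear_inv_riesz: "linear (inv riesz)"
  by (rule linearI; rule injD[OF bij_is_inj[OF bij_riesz]])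
     (simp_all add: linear_add[OF linear_riesz] linear_scale[OF linear_riesz]
       surj_f_inv_f[OF bij_is_surj[OF bij_riesz]])

definition xi :: "'e^'m^'m \<Rightarrow> 'e^'m^'m \<Rightarrow> complex" where
  "xi T = (\<lambda>X. if X \<in> lie_g h then Complex 0 (re (trace (T ** X))) else 0)"

text \<open>The functional is extended to all matrices by precomposition with \<open>skew\<close>,
  represented there, and its representative projected back. Only the values of \<open>\<xi>\<close>
  at finitely many points enter, so continuity for pointwise convergence can be read off.\<close>

definition xi_inv :: "('e^'m^'m \<Rightarrow> complex) \<Rightarrow> 'e^'m^'m" where
  "xi_inv \<xi> = skew (inv riesz (\<Sum>b\<in>Basis. Im (\<xi> (skew b)) *\<^sub>R b))"

lemma xi_add: "xi (S + T) = (\<lambda>X. xi S X + xi T X)"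
  by (rule ext) (simp add: xi_def linear_add[OF linear_re_trace(2)] complex_eq_iff)

lemma xi_scaleR: "xi (r *\<^sub>R T) = (\<lambda>X. r *\<^sub>R xi T X)"
  by (auto simp: xi_def linear_scale[OF linear_re_trace(2)] complex_eq_iff)

lemma xi_diff: "xi (S - T) = (\<lambda>X. xi S X - xi T X)"
  by (rule ext) (simp add: xi_def linear_diff[OF linear_re_trace(2)] complex_eq_iff)

lemma xi_in_g_wedge: "xi T \<in> g_wedge h"
  using subspace_add[OF subspace_lie_g] subspace_scale[OF subspace_lie_g]
  by (auto simp: g_wedge_def linear_on_g_def xi_def linear_add[OF linear_re_trace(1)]
      linear_scale[OF linear_re_trace(1)] complex_eq_iff)

lemma xi_inv_in_lie_g: "xi_inv \<xi> \<in> lie_g h"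
  by (simp add: xi_inv_def skew_in_lie_g)

lemma xi_inv_xi:
  assumes "T \<in> lie_g h"
  shows "xi_inv (xi T) = T"
proof -
  have "(\<Sum>b\<in>Basis. Im (xi T (skew b)) *\<^sub>R b) = riesz T"
    by (simp add: riesz_def xi_def skew_in_lie_g re_trace_skew assms)
  then show ?thesis
    by (simp add: xi_inv_def inv_f_f[OF bij_is_inj[OF bij_riesz]] skew_lie_g assms)
qed

lemma xi_xi_inv:
  assumes \<xi>: "\<xi> \<in> g_wedge h"
  shows "xi (xi_inv \<xi>) = \<xi>"
proof
  fix X
  define f where "f = (\<lambda>X. Im (\<xi> (skew X)))"
  define T where "T = inv riesz (\<Sum>b\<in>Basis. f b *\<^sub>R b)"
  have lin: "linear f"
    using \<xi> skew_in_lie_g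
    by (auto intro!: linearI simp: f_def g_wedge_def linear_on_g_def linear_add[OF linear_skew]
        linear_scale[OF linear_skew])
  have "riesz T = (\<Sum>b\<in>Basis. f b *\<^sub>R b)"
    by (simp add: T_def surj_f_inv_f[OF bij_is_surj[OF bij_riesz]])
  then have T: "re (trace (T ** X)) = f X" for X
    using riesz_inner[of T X] sum_linear_Basis[OF lin, of X] by simp
  have [simp]: "xi_inv \<xi> = skew T"
    by (simp add: xi_inv_def T_def f_def)
  show "xi (xi_inv \<xi>) X = \<xi> X"
  proof (cases "X \<in> lie_g h")
    case True
    then have "xi (xi_inv \<xi>) X = Complex 0 (f X)"
      by (simp add: xi_def re_trace_skew T)
    also have "\<dots> = \<xi> X"
      using True \<xi> by (simp add: f_def skew_lie_g g_wedge_def complex_eq_iff)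
    finally show ?thesis .
  qed (use \<xi> in \<open>auto simp: xi_def g_wedge_def linear_on_g_def\<close>)
qed

lemma xi_inject: "T \<in> lie_g h \<Longrightarrow> T' \<in> lie_g h \<Longrightarrow> xi T = xi T' \<Longrightarrow> T = T'"
  by (metis xi_inv_xi)

lemma continuous_xi_inv: "continuous_on A xi_inv"
proof -
  have "linear (\<lambda>x. skew (inv riesz x))"
    using linear_compose[OF linear_inv_riesz linear_skew] by (simp add: o_def)
  then have "bounded_linear (\<lambda>x. skew (inv riesz x))"
    by (simp add: linear_conv_bounded_linear)
  moreover have "continuous_on A (\<lambda>\<xi>. \<Sum>b\<in>Basis. Im (\<xi> (skew b)) *\<^sub>R b)"
    by (intro continuous_intros continuous_on_subset[OF continuous_on_product_coordinates]) auto
  ultimately show ?thesis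
    unfolding xi_inv_def by (rule bounded_linear.continuous_on)
qed

lemma continuous_xi: "continuous_on A xi"
proof (rule continuous_on_coordinatewise_then_product)
  fix X
  have "continuous_on A (\<lambda>T. re (trace (T ** X)))"
    using linear_continuous_on linear_re_trace(2) linear_conv_bounded_linear by blast
  then show "continuous_on A (\<lambda>T. xi T X)"
    unfolding xi_def Complex_eq by (cases "X \<in> lie_g h") (auto intro!: continuous_intros)
qed

section \<open>The coadjoint action as conjugation\<close>

lemma conj_in_lie_g: "X \<in> lie_g h \<Longrightarrow> x ** X ** adj x \<in> lie_g h"
  by (auto simp: lie_g_iff adj_mult matrix_mul_assoc matrix_eq matrix_apply)

lemma Ad_adj: "x \<in> U_V h \<Longrightarrow> Ad (adj x) X = adj x ** X ** x"
  by (simp add: Ad_def matrix_inv_U_V U_V_adj)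

lemma conj_in_lie_g_iff:
  assumes "x \<in> U_V h"
  shows "adj x ** X ** x \<in> lie_g h \<longleftrightarrow> X \<in> lie_g h"
proof
  assume "adj x ** X ** x \<in> lie_g h"
  from conj_in_lie_g[OF this, of x] have "x ** (adj x ** X ** x) ** adj x \<in> lie_g h" .
  moreover have "x ** (adj x ** X ** x) ** adj x = X"
    using assms by (simp add: matrix_eq matrix_apply)
  ultimately show "X \<in> lie_g h"
    by simp
qed (use conj_in_lie_g[of X "adj x"] in simp)

lemma coAd_xi:
  assumes "x \<in> U_V h"
  shows "coAd x (xi T) = xi (x ** T ** adj x)"
proof
  fix X
  have "trace (T ** (adj x ** X ** x)) = trace (T ** adj x ** X ** x)"
    by (simp add: matrix_mul_assoc)
  also have "\<dots> = trace (x ** T ** adj x ** X)"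
    by (subst trace_mul_sym) (simp add: matrix_mul_assoc)
  finally show "coAd x (xi T) X = xi (x ** T ** adj x) X"
    using assms by (simp add: coAd_def xi_def matrix_inv_U_V Ad_adj conj_in_lie_g_iff)
qed

section \<open>Cayley transforms\<close>

text \<open>The Cayley transform (1 + t X) / (1 - t X), an algebraic substitute for the exponential
  of 2 t X. The equations say that \<open>c\<close> times 1 - t X, in either order, is 1 + t X; the
  last clause is injectivity of 1 - t X.\<close>

definition is_cayley :: "'e^'m^'m \<Rightarrow> real \<Rightarrow> 'e^'m^'m \<Rightarrow> bool" where
  "is_cayley X t c \<longleftrightarrow> c \<in> U_V h \<and> (\<forall>v. c *v (v - t *\<^sub>R (X *v v)) = v + t *\<^sub>R (X *v v)) \<and>
     (\<forall>v. c *v v - t *\<^sub>R (X *v (c *v v)) = v + t *\<^sub>R (X *v v)) \<and>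
     (\<forall>v. v - t *\<^sub>R (X *v v) = 0 \<longrightarrow> v = 0)"

lemma U_V_I:
  assumes "\<And>u v. h (g *v u) (g *v v) = h u v"
  shows "g \<in> U_V h"
proof -
  have "g *v v = 0 \<Longrightarrow> v = 0" for v
    by (rule h_nondegenerate) (metis assms h_0_left)
  then show ?thesis
    using assms inj_imp_invertible by (auto simp: U_V_def)
qed

text \<open>For small \<open>t\<close> the matrix 1 - t X is injective by a norm estimate. It
  commutes with its adjoint 1 + t X, which makes the quotient an isometry.\<close>

lemma ex_cayley:
  assumes X: "X \<in> lie_g h"
  shows "\<exists>t0>0. \<forall>t. 0 < t \<and> t < t0 \<longrightarrow> (\<exists>c. is_cayley X t c)"
proof -
  obtain C where C: "C > 0" "\<And>v. norm (X *v v) \<le> C * norm v"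
    using linear_bounded_pos[OF matrix_vector_mul_linear[of X]] by blast
  have "\<exists>c. is_cayley X t c" if t: "0 < t" "t < 1 / C" for t
  proof -
    define A where "A = mat 1 - t *\<^sub>R X"
    define B where "B = mat 1 + t *\<^sub>R X"
    have A: "A *v v = v - t *\<^sub>R (X *v v)" and B: "B *v v = v + t *\<^sub>R (X *v v)" for v
      by (simp_all add: A_def B_def matrix_apply)
    have inj: "v = 0" if "A *v v = 0" for v
    proof (rule ccontr)
      assume "v \<noteq> 0"
      have "norm v = norm (t *\<^sub>R (X *v v))"
        using that by (simp add: A)
      also have "\<dots> \<le> t * (C * norm v)"
        using t C by simp
      also have "\<dots> < norm v"
        using t C \<open>v \<noteq> 0\<close> by (simp add: field_simps)
      finally show False
        by simp
    qed
    then obtain A' where A': "A ** A' = mat 1" "A' ** A = mat 1"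
      using inj_imp_invertible unfolding invertible_def by blast
    have A'v: "A *v (A' *v v) = v" "A' *v (A *v v) = v" for v
      by (simp_all add: A' matrix_vector_mul_assoc)
    have AB: "A *v (B *v v) = B *v (A *v v)" for v
      by (simp add: A B algebra_simps matrix_apply)
    have adj: "adj A = B" "adj B = A"
      using X by (simp_all add: A_def B_def adj_diff adj_add adj_scaleR lie_g_iff)
    define c where "c = A' ** B"
    have cA: "c *v (A *v v) = B *v v" and Ac: "A *v (c *v v) = B *v v" for v
      by (simp_all add: c_def A'v AB[symmetric] flip: matrix_vector_mul_assoc)
    have "h (c *v (A *v u)) (c *v (A *v v)) = h (A *v u) (A *v v)" for u v
      by (simp add: cA h_adj_left adj AB)
    then have "h (c *v u) (c *v v) = h u v" for u v
      by (metis A'v(1))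
    then have "c \<in> U_V h"
      by (rule U_V_I)
    then show ?thesis
      using cA Ac inj by (auto simp: is_cayley_def A B)
  qed
  then show ?thesis
    using C by (intro exI[of _ "1 / C"]) simp
qed

lemma cayley_kernel:
  assumes "is_cayley X t c" "X *v v = 0"
  shows "c *v v = v"
  using assms unfolding is_cayley_def by (metis add_0_right diff_0_right scaleR_zero_right)

text \<open>The inverse formula t X = (c - 1) / (c + 1): with v = (1 - t X) w the sum c v + v is 2
  w, so every vector \<open>w + w\<close> is in the image of c + 1. The parameter \<open>z\<close>
  prepares the proof that whatever commutes with \<open>c\<close> commutes with \<open>X\<close>;
  \<open>mat 1\<close> gives the plain formula.\<close>

lemma cayley_recover:
  assumes "is_cayley X t c"
  obtains v where "w + w = c *v v + v" "\<And>z. z ** c = c ** z \<Longrightarrow> t *\<^sub>R (X *v (z *v (w + w))) = z *v (c *v v - v)"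
proof
  let ?v = "w - t *\<^sub>R (X *v w)"
  have 1: "t *\<^sub>R (X *v (c *v v + v)) = c *v v - v" for v
  proof -
    have "c *v v - t *\<^sub>R (X *v (c *v v)) = v + t *\<^sub>R (X *v v)"
      using assms by (auto simp: is_cayley_def)
    then show ?thesis
      by (simp add: matrix_apply algebra_simps)
  qed
  show 2: "w + w = c *v ?v + ?v"
    using assms by (auto simp: is_cayley_def)
  fix z assume "z ** c = c ** z"
  then have z: "z *v (c *v u) = c *v (z *v u)" for u
    by (metis matrix_vector_mul_assoc)
  have "t *\<^sub>R (X *v (z *v (w + w))) = t *\<^sub>R (X *v (c *v (z *v ?v) + z *v ?v))"
    unfolding 2 by (simp add: matrix_vector_right_distrib z)
  also have "\<dots> = c *v (z *v ?v) - z *v ?v"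
    by (rule 1)
  finally show "t *\<^sub>R (X *v (z *v (w + w))) = z *v (c *v ?v - ?v)"
    by (simp add: matrix_vector_mult_diff_distrib z)
qed

lemma cayley_commute:
  assumes c: "is_cayley X t c" and t: "t \<noteq> 0" and z: "z ** c = c ** z"
  shows "z ** X = X ** z"
proof -
  have "z *v (X *v w) = X *v (z *v w)" for w
  proof -
    obtain v where v: "w + w = c *v v + v"
      "\<And>z. z ** c = c ** z \<Longrightarrow> t *\<^sub>R (X *v (z *v (w + w))) = z *v (c *v v - v)"
      using c by (rule cayley_recover) blast
    have "z *v (t *\<^sub>R (X *v (w + w))) = t *\<^sub>R (X *v (z *v (w + w)))"
      using v(2)[OF z] v(2)[of "mat 1"] by simp
    then have "(2 * t) *\<^sub>R (z *v (X *v w)) = (2 * t) *\<^sub>R (X *v (z *v w))"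
      by (simp add: matrix_apply flip: scaleR_2)
    then show ?thesis
      using t by simp
  qed
  then show ?thesis
    by (simp add: matrix_eq flip: matrix_vector_mul_assoc)
qed

lemma cayley_commute_converse:
  assumes c: "is_cayley X t c" and Y: "X ** Y = Y ** X"
  shows "c ** Y = Y ** c"
proof -
  have Yv: "X *v (Y *v v) = Y *v (X *v v)" for v
    by (simp add: matrix_vector_mul_assoc Y)
  have "c *v (Y *v v) - Y *v (c *v v) = 0" for v
  proof -
    let ?w = "c *v (Y *v v) - Y *v (c *v v)"
    have "c *v (Y *v v) - t *\<^sub>R (X *v (c *v (Y *v v))) = Y *v (c *v v - t *\<^sub>R (X *v (c *v v)))"
      using c by (simp add: is_cayley_def matrix_apply Yv)
    then have "?w - t *\<^sub>R (X *v ?w) = 0"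
      by (simp add: matrix_apply Yv algebra_simps)
    then show ?thesis
      using c unfolding is_cayley_def by blast
  qed
  then show ?thesis
    by (simp add: matrix_eq flip: matrix_vector_mul_assoc)
qed

section \<open>Cayley transforms in stabilizers and commutants\<close>

lemma infinite_stabilizer:
  assumes X: "X \<in> lie_g h" "X \<noteq> 0" "X *v e = 0" "X ** T = T ** X"
  shows "infinite {x \<in> U_VH h e. x ** T = T ** x}"
proof -
  obtain t0 f where t0: "t0 > 0" and f: "\<And>t. 0 < t \<Longrightarrow> t < t0 \<Longrightarrow> is_cayley X t (f t)"
    using ex_cayley[OF X(1)] by metis
  \<comment> \<open>The group element \<open>f t\<close> determines \<open>t *\<^sub>R X\<close>,
    and \<open>X\<close> is nonzero, so distinct parameters give distinct elements of the
    stabilizer.\<close>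
  have "inj_on f {0<..<t0}"
  proof (rule inj_onI)
    fix s t assume st: "s \<in> {0<..<t0}" "t \<in> {0<..<t0}" "f s = f t"
    obtain w where w: "X *v w \<noteq> 0"
      using X(2) by (auto simp: matrix_eq)
    have cs: "is_cayley X s (f s)" "is_cayley X t (f s)"
      using f[of s] f[of t] st by auto
    obtain v where v: "w + w = f s *v v + v"
      "\<And>z. z ** f s = f s ** z \<Longrightarrow> t *\<^sub>R (X *v (z *v (w + w))) = z *v (f s *v v - v)"
      using cs(2) by (rule cayley_recover) blast
    have "f s *v v - s *\<^sub>R (X *v (f s *v v)) = v + s *\<^sub>R (X *v v)"
      using cs by (auto simp: is_cayley_def)
    then have "s *\<^sub>R (X *v (w + w)) = f s *v v - v"
      unfolding v(1) by (simp add: matrix_apply algebra_simps)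
    then have "s *\<^sub>R (X *v (w + w)) = t *\<^sub>R (X *v (w + w))"
      using v(2)[of "mat 1"] by simp
    moreover have "X *v (w + w) \<noteq> 0"
      using w by (simp add: matrix_apply flip: scaleR_2)
    ultimately show "s = t"
      by simp
  qed
  then have "infinite (f ` {0<..<t0})"
    using t0 finite_imageD infinite_Ioo by blast
  moreover have "f ` {0<..<t0} \<subseteq> {x \<in> U_VH h e. x ** T = T ** x}"
  proof clarsimp
    fix t assume "0 < t" "t < t0"
    then have c: "is_cayley X t (f t)"
      by (rule f)
    then have "f t \<in> U_V h"
      by (simp add: is_cayley_def)
    then show "f t \<in> U_VH h e \<and> f t ** T = T ** f t"
      using cayley_kernel[OF c X(3)] cayley_commute_converse[OF c X(4)] by (simp add: U_VH_iff)
  qed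
  ultimately show ?thesis
    using infinite_super by blast
qed

text \<open>A Cayley transform of \<open>X\<close> with a small nonzero parameter lies in the group,
  and commuting with that one element already implies commuting with \<open>X\<close>.\<close>

lemma center_commutes_lie_g:
  assumes "z \<in> center_of (U_V h)" "X \<in> lie_g h"
  shows "z ** X = X ** z"
proof -
  obtain t0 where t0: "t0 > 0" "\<And>t. 0 < t \<Longrightarrow> t < t0 \<Longrightarrow> \<exists>c. is_cayley X t c"
    using ex_cayley[OF assms(2)] by metis
  then obtain c where c: "is_cayley X (t0/2) c"
    by (metis half_gt_zero field_sum_of_halves less_add_same_cancel1)
  then show ?thesis
    using assms t0 by (intro cayley_commute[OF c]) (auto simp: center_of_def is_cayley_def)
qed

lemma center_H_commutes:
  assumes "z \<in> center_of (U_VH h e)" "X \<in> lie_g h" "X *v e = 0"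
  shows "z ** X = X ** z"
proof -
  obtain t0 where t0: "t0 > 0" "\<And>t. 0 < t \<Longrightarrow> t < t0 \<Longrightarrow> \<exists>c. is_cayley X t c"
    using ex_cayley[OF assms(2)] by metis
  then obtain c where c: "is_cayley X (t0/2) c"
    by (metis half_gt_zero field_sum_of_halves less_add_same_cancel1)
  have "c \<in> U_VH h e"
    using c cayley_kernel[OF c assms(3)] by (auto simp: U_VH_iff is_cayley_def)
  then show ?thesis
    using assms t0 by (intro cayley_commute[OF c]) (auto simp: center_of_def)
qed

section \<open>The center of the smaller unitary group\<close>

definition rank1 :: "'e^'m \<Rightarrow> 'e^'m \<Rightarrow> 'e^'m^'m" where "rank1 w v = matrix (\<lambda>x. h x v *s w)"

lemma rank1_apply: "rank1 w v *v x = h x v *s w"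
  unfolding rank1_def
  by (rule matrix_vector_mult_matrix) (simp_all add: h_simps vec_eq_iff algebra_simps)

lemma adj_rank1: "adj (rank1 w v) = rank1 v w"
  by (rule adj_eqI) (simp add: rank1_apply h_simps h_flip[of w] mult.commute)

text \<open>The Lie algebra of U(V_H) contains \<open>rank1 w v - rank1 v w\<close> and \<delta>
  times \<open>rank1 w v + rank1 v w\<close>. A central \<open>z\<close> commutes with both;
  cancelling the unit \<delta> and adding, it commutes with \<open>rank1 w v\<close> itself.\<close>

lemma center_H_rank1:
  assumes z: "z \<in> center_of (U_VH h e)" and v: "v \<in> V_H h e" and w: "w \<in> V_H h e"
  shows "h x v *s (z *v w) = h (z *v x) v *s w"
proof -
  have perp: "h e v = 0" "h e w = 0"
    using v w h_flip[of e v] h_flip[of e w] by (auto simp: V_H_def)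
  let ?X = "rank1 w v - rank1 v w" and ?Y = "mat \<delta> ** (rank1 w v + rank1 v w)"
  have X: "z ** ?X = ?X ** z"
    by (rule center_H_commutes[OF z]) (simp_all add: lie_g_iff adj_diff adj_rank1 matrix_apply rank1_apply perp)
  have Y: "z ** ?Y = ?Y ** z"
  proof (rule center_H_commutes[OF z])
    have "adj ?Y *v x = (- ?Y) *v x" for x
      by (simp add: adj_mult adj_add adj_rank1 matrix_apply algebra_simps vector_smult_lneg)
    then show "?Y \<in> lie_g h"
      unfolding lie_g_iff by (simp only: matrix_eq simp_thms)
  qed (simp add: matrix_apply rank1_apply perp)
  have "z *v (?Y *v x) = ?Y *v (z *v x)"
    using Y by (simp add: matrix_vector_mul_assoc)
  then have "\<delta>' *s (z *v (?Y *v x)) = \<delta>' *s (?Y *v (z *v x))"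
    by simp
  then have "z *v (rank1 w v *v x) + z *v (rank1 v w *v x) = rank1 w v *v (z *v x) + rank1 v w *v (z *v x)"
    by (simp add: matrix_apply vector_smult_assoc)
  moreover have "z *v (?X *v x) = ?X *v (z *v x)"
    using X by (simp add: matrix_vector_mul_assoc)
  then have "z *v (rank1 w v *v x) - z *v (rank1 v w *v x) = rank1 w v *v (z *v x) - rank1 v w *v (z *v x)"
    by (simp add: matrix_apply)
  ultimately have "2 *\<^sub>R (z *v (rank1 w v *v x)) = 2 *\<^sub>R (rank1 w v *v (z *v x))"
    by (smt (verit) add_diff_cancel_left' add_diff_eq diff_add_cancel scaleR_2 add.commute)
  then show ?thesis
    by (simp add: rank1_apply matrix_apply)
qed

text \<open>Polarization: after scaling \<open>u\<close> so that the cross terms with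
  \<open>v'\<close> sum to 1, the lengths of \<open>u\<close>, \<open>v'\<close> and
  \<open>u + v'\<close> cannot all vanish.\<close>

lemma ex_anisotropic:
  assumes u: "u \<in> V_H h e" "u \<noteq> 0"
  shows "\<exists>a\<in>V_H h e. h a a \<noteq> 0"
proof -
  obtain v where v: "h u v \<noteq> 0"
    using u h_nondegenerate by blast
  define v' where "v' = v - (h v e * \<epsilon>) *s e"
  have v': "h v' e = 0"
    by (simp add: v'_def h_simps mult.assoc)
  have "h u v' = h u v"
    using u by (simp add: v'_def h_simps V_H_def)
  then obtain \<gamma> where \<gamma>: "\<gamma> * h u v' + \<sigma> (\<gamma> * h u v') = 1"
    using v ex_trace_eq_1 by metis
  let ?u = "\<gamma> *s u"
  have 1: "h ?u v' + h v' ?u = 1"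
    using \<gamma> h_flip[of v' ?u] by (simp add: h_simps)
  have "h (?u + v') (?u + v') = h ?u ?u + h v' v' + (h ?u v' + h v' ?u)"
    by (simp add: h_add_left h_add_right algebra_simps)
  then have "h ?u ?u \<noteq> 0 \<or> h v' v' \<noteq> 0 \<or> h (?u + v') (?u + v') \<noteq> 0"
    unfolding 1 by auto
  moreover have "?u \<in> V_H h e" "v' \<in> V_H h e" "?u + v' \<in> V_H h e"
    using u v' by (auto simp: V_H_def h_simps)
  ultimately show ?thesis
    by blast
qed

lemma decompose: obtains w where "w \<in> V_H h e" "v = (h v e * \<epsilon>) *s e + w"
  by (rule that[of "v - (h v e * \<epsilon>) *s e"]) (simp_all add: V_H_def h_simps mult.assoc)

text \<open>The center acts on V_H by norm-one scalars. Having \<open>\<zeta>\<close> linear on all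
  matrices makes it continuous at \<open>mat 1\<close>, so that \<open>z\<close> near 1 gives a
  scalar near 1.\<close>

lemma center_H_scalar:
  obtains \<zeta> where "linear \<zeta>" "\<zeta> (mat 1) = 1"
    "\<And>z. z \<in> center_of (U_VH h e) \<Longrightarrow> \<zeta> z * \<sigma> (\<zeta> z) = 1"
    "\<And>z v. z \<in> center_of (U_VH h e) \<Longrightarrow> v \<in> V_H h e \<Longrightarrow> z *v v = \<zeta> z *s v"
proof (cases "\<exists>u\<in>V_H h e. u \<noteq> 0")
  case True
  then obtain a where a: "a \<in> V_H h e" "h a a \<noteq> 0"
    using ex_anisotropic by blast
  then obtain k where k: "h a a * k = 1"
    using sigma_fixed_unit[of "h a a"] h_flip by metis
  \<comment> \<open>If \<open>z\<close> scales \<open>a\<close>, pairing with the anisotropic vector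
    \<open>a\<close> reads off the scalar by a formula that makes sense for every matrix.\<close>
  define \<zeta> where "\<zeta> z = k * h (z *v a) a" for z
  have scalar: "z *v v = \<zeta> z *s v" if "z \<in> center_of (U_VH h e)" "v \<in> V_H h e" for z v
  proof -
    have "k *s (h a a *s (z *v v)) = k *s (h (z *v a) a *s v)"
      using center_H_rank1[OF that(1) a(1) that(2)] by simp
    then show ?thesis
      using k by (simp add: \<zeta>_def vector_smult_assoc mult.commute)
  qed
  show ?thesis
  proof (rule that[of \<zeta>])
    show "linear \<zeta>"
      by (rule linearI) (simp_all add: \<zeta>_def matrix_apply h_simps algebra_simps)
    show "\<zeta> (mat 1) = 1"
      using k by (simp add: \<zeta>_def mult.commute)
    fix z assume z: "z \<in> center_of (U_VH h e)"
    then have "h (z *v a) (z *v a) = h a a"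
      by (auto simp: center_of_def U_VH_iff U_V_preserves)
    then have "\<zeta> z * \<sigma> (\<zeta> z) * h a a = h a a"
      using scalar[OF z a(1)] by (simp add: h_simps algebra_simps)
    then have "\<zeta> z * \<sigma> (\<zeta> z) * (h a a * k) = h a a * k"
      by (simp flip: mult.assoc)
    then show "\<zeta> z * \<sigma> (\<zeta> z) = 1"
      by (simp add: k)
  qed (rule scalar)
next
  case False
  have z: "z = mat 1" if "z \<in> center_of (U_VH h e)" for z
  proof -
    have "z *v v = v" for v
    proof -
      obtain w where "w \<in> V_H h e" "v = (h v e * \<epsilon>) *s e + w"
        by (rule decompose)
      then have "v = (h v e * \<epsilon>) *s e"
        using False by auto
      then show ?thesis
        using that by (metis (no_types, lifting) U_VH_iff center_of_def matrix_vector_mult_smult mem_Collect_eq)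
    qed
    then show ?thesis
      by (simp add: matrix_eq)
  qed
  \<comment> \<open>With V_H zero the only central element is \<open>mat 1\<close>, so any diagonal
    entry is a linear function with the required value 1.\<close>
  show ?thesis
  proof (rule that[of "\<lambda>z. z $ undefined $ undefined"])
    show "linear (\<lambda>z::'e^'m^'m. z $ undefined $ undefined)"
      by (rule linearI) auto
    show "z *v v = z $ undefined $ undefined *s v"
      if "z \<in> center_of (U_VH h e)" "v \<in> V_H h e" for z v
      using that False by auto
    show "z $ undefined $ undefined * \<sigma> (z $ undefined $ undefined) = 1"
      if "z \<in> center_of (U_VH h e)" for z
      unfolding z[OF that] by (simp add: mat_def)
  qed (simp add: mat_def)
qed

section \<open>Stable elements\<close>

definition submodule :: "('e^'m) set \<Rightarrow> bool" where
  "submodule N \<longleftrightarrow> 0 \<in> N \<and> (\<forall>u\<in>N. \<forall>v\<in>N. u + v \<in> N) \<and> (\<forall>c. \<forall>u\<in>N. c *s u \<in> N)"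

text \<open>Complements exist over the field F, and being invertible in E the element \<delta>
  allows an averaging that restores E-linearity. Prescribing the kernel on \<open>N'\<close> is what
  lets the projections used for stability kill \<open>e\<close>.\<close>

lemma ex_projection:
  assumes N: "submodule N" and N': "submodule N'" and disj: "N \<inter> N' \<subseteq> {0}"
  shows "\<exists>p. (\<forall>v. p *v v \<in> N) \<and> (\<forall>v\<in>N. p *v v = v) \<and> (\<forall>v\<in>N'. p *v v = 0)"
proof -
  define scl :: "'f \<Rightarrow> 'e^'m \<Rightarrow> 'e^'m" where "scl = (\<lambda>a v. \<iota> a *s v)"
  interpret vs: vector_space scl
    by unfold_locales (simp_all add: scl_def iota_add iota_mult vec_eq_iff algebra_simps)
  interpret vp: vector_space_pair scl scl ..
  have sub: "vs.subspace N" "vs.subspace N'"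
    using N N' unfolding vs.subspace_def submodule_def by (auto simp: scl_def)
  have "Vector_Spaces.linear scl scl id"
    by (rule vs.linear_id)
  then obtain q where q: "range q \<subseteq> N'" "Vector_Spaces.linear scl scl q" "\<And>v. v \<in> N' \<Longrightarrow> q v = v"
    using vp.linear_exists_left_inverse_on[OF _ sub(2), of id] by auto
  \<comment> \<open>The map 1 - q kills \<open>N'\<close> and is injective on \<open>N\<close>,
    since the two submodules meet only in 0. A left inverse of it on \<open>N\<close> then yields
    the projection.\<close>
  define f where "f v = v - q v" for v
  have f: "Vector_Spaces.linear scl scl f"
    unfolding f_def by (intro vp.linear_compose_sub q) (use vs.linear_id in \<open>simp add: id_def\<close>)
  have diff: "u - v \<in> N" if "u \<in> N" "v \<in> N" for u v
    using vs.subspace_diff[OF sub(1) that] .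
  have "inj_on f N"
  proof (rule inj_onI)
    fix u v assume uv: "u \<in> N" "v \<in> N" "f u = f v"
    then have "u - v = q u - q v"
      by (simp add: f_def algebra_simps)
    moreover have "q u - q v \<in> N'"
      using q(1) by (intro vs.subspace_diff[OF sub(2)]) auto
    ultimately have "u - v \<in> N \<inter> N'"
      using diff[OF uv(1,2)] by auto
    then have "u - v = 0"
      using disj by blast
    then show "u = v"
      by simp
  qed
  then obtain g where g: "range g \<subseteq> N" "Vector_Spaces.linear scl scl g" "\<And>v. v \<in> N \<Longrightarrow> g (f v) = v"
    using vp.linear_exists_left_inverse_on[OF f sub(1)] by auto
  define p where "p v = g (f v)" for v
  have p_add: "p (u + v) = p u + p v" for u v
    by (simp add: p_def vp.linear_add[OF f] vp.linear_add[OF g(2)])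
  have p_iota: "p (\<iota> a *s v) = \<iota> a *s p v" for a v
    using vp.linear_scale[OF f] vp.linear_scale[OF g(2)] by (simp add: p_def scl_def)
  have p_range: "p v \<in> N" and p_N: "v \<in> N \<Longrightarrow> p v = v" for v
    using g by (auto simp: p_def)
  have p_N': "p v = 0" if "v \<in> N'" for v
    using q(3)[OF that] vp.linear_0[OF g(2)] by (simp add: p_def f_def)
  obtain d where d: "\<delta> * \<delta> = \<iota> d"
    by (rule sigma_fixed[of "\<delta> * \<delta>"]) simp_all
  \<comment> \<open>Averaging over conjugation by \<open>\<delta>\<close> turns an \<open>F\<close>-linear projection into an \<open>E\<close>-linear one.\<close>
  define P where "P v = (1/2) *\<^sub>R (p v + \<delta> *s p (\<delta>' *s v))" for v
  have P_add: "P (u + v) = P u + P v" for u v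
    by (simp add: P_def p_add vector_add_ldistrib algebra_simps)
  have P_iota: "P (\<iota> a *s v) = \<iota> a *s P v" for a v
  proof -
    have "p (\<delta>' *s (\<iota> a *s v)) = \<iota> a *s p (\<delta>' *s v)"
      by (simp add: vector_smult_assoc mult.commute flip: p_iota)
    then show ?thesis
      by (simp add: P_def p_iota vec_eq_iff algebra_simps)
  qed
  have P_delta: "P (\<delta> *s v) = \<delta> *s P v" for v
  proof -
    have "\<delta> *s (\<delta> *s p (\<delta>' *s v)) = p ((\<delta> * \<delta>) *s (\<delta>' *s v))"
      unfolding d p_iota by (simp add: vector_smult_assoc d)
    also have "(\<delta> * \<delta>) *s (\<delta>' *s v) = \<delta> *s v"
      by (simp add: vector_smult_assoc mult.assoc)
    finally have 1: "\<delta> *s (\<delta> *s p (\<delta>' *s v)) = p (\<delta> *s v)" .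
    have "P (\<delta> *s v) = (1/2) *\<^sub>R (p (\<delta> *s v) + \<delta> *s p v)"
      by (simp add: P_def vector_smult_assoc)
    moreover have "\<delta> *s P v = (1/2) *\<^sub>R (\<delta> *s p v + \<delta> *s (\<delta> *s p (\<delta>' *s v)))"
      by (simp add: P_def vec_eq_iff algebra_simps)
    ultimately show ?thesis
      unfolding 1 by (simp add: add.commute)
  qed
  have P_smult: "P (c *s v) = c *s P v" for c v
  proof -
    obtain a b where c: "c = \<iota> a + \<iota> b * \<delta>"
      by (rule iota_delta_decomposition)
    have "P (c *s v) = P (\<iota> a *s v) + P (\<iota> b *s (\<delta> *s v))"
      by (simp add: c vector_sadd_rdistrib vector_smult_assoc P_add)
    also have "\<dots> = \<iota> a *s P v + \<iota> b *s (\<delta> *s P v)"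
      by (simp only: P_iota P_delta)
    finally show ?thesis
      by (simp add: c vector_sadd_rdistrib vector_smult_assoc)
  qed
  have mP: "matrix P *v v = P v" for v
    by (rule matrix_vector_mult_matrix) (simp_all add: P_add P_smult)
  have "P v \<in> N" for v
    using N p_range by (simp add: submodule_def P_def scaleR_conv_smult)
  moreover have "P v = v" if "v \<in> N" for v
  proof -
    have "\<delta>' *s v \<in> N"
      using N that by (simp add: submodule_def)
    then show ?thesis
      using that by (simp add: P_def p_N vector_smult_assoc flip: scaleR_2)
  qed
  moreover have "P v = 0" if "v \<in> N'" for v
  proof -
    have "\<delta>' *s v \<in> N'"
      using N' that by (simp add: submodule_def)
    then show ?thesis
      using that by (simp add: P_def p_N')
  qed
  ultimately show ?thesis
    by (intro exI[of _ "matrix P"]) (auto simp: mP)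
qed

section \<open>Stability expressed for matrices\<close>

lemma coAd_fix_iff:
  assumes "x \<in> U_V h" "T \<in> lie_g h"
  shows "coAd x (xi T) = xi T \<longleftrightarrow> x ** T = T ** x"
proof -
  have "coAd x (xi T) = xi T \<longleftrightarrow> x ** T ** adj x = T"
    using assms conj_in_lie_g xi_inject by (auto simp: coAd_xi)
  also have "\<dots> \<longleftrightarrow> x ** T = T ** x"
    by (metis U_V_iff U_V_right assms(1) matrix_mul_assoc matrix_mul_rid)
  finally show ?thesis .
qed

text \<open>The form in which closedness of the orbit is used: a degeneration of \<open>T\<close>
  along \<open>H\<close> stays conjugate to \<open>T\<close>.\<close>

lemma stable_limit:
  assumes T: "T \<in> lie_g h" and stab: "xi T \<in> g_stab h e"
    and y: "\<And>n. y n \<in> U_VH h e" and lim: "(\<lambda>n. y n ** T ** adj (y n)) \<longlonglongrightarrow> T0"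
  shows "\<exists>x\<in>U_VH h e. T0 = x ** T ** adj x"
proof -
  obtain C where C: "closed C" "H_orbit h e (xi T) = C \<inter> g_wedge h"
    using stab unfolding g_stab_def closedin_closed by auto
  have "xi (y n ** T ** adj (y n)) \<in> H_orbit h e (xi T)" for n
    using y by (auto simp: H_orbit_def U_VH_iff simp flip: coAd_xi)
  then have "xi (y n ** T ** adj (y n)) \<in> C" for n
    using C by blast
  moreover have "(\<lambda>n. xi (y n ** T ** adj (y n))) \<longlonglongrightarrow> xi T0"
    by (rule isCont_tendsto_compose[OF _ lim])
       (use continuous_xi[of UNIV] in \<open>simp add: continuous_on_eq_continuous_at\<close>)
  ultimately have "xi T0 \<in> C"
    by (intro Lim_in_closed_set[OF C(1), where F = sequentially]) auto
  then have "xi T0 \<in> H_orbit h e (xi T)"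
    using C xi_in_g_wedge by blast
  then obtain x where x: "x \<in> U_VH h e" "xi T0 = xi (x ** T ** adj x)"
    by (auto simp: H_orbit_def U_VH_iff coAd_xi)
  have "T0 \<in> lie_g h"
    using closed_sequentially[OF closed_subspace[OF subspace_lie_g] _ lim] conj_in_lie_g[OF T] by blast
  then show ?thesis
    using x xi_inject conj_in_lie_g[OF T] by blast
qed

definition pow_e :: "'e^'m^'m \<Rightarrow> nat \<Rightarrow> 'e^'m" where "pow_e T k = ((*v) T ^^ k) e"

lemma pow_e_0 [simp]: "pow_e T 0 = e" and pow_e_Suc: "pow_e T (Suc k) = T *v pow_e T k"
  by (simp_all add: pow_e_def)

lemma lie_g_skew: "T \<in> lie_g h \<Longrightarrow> h (T *v u) v = - h u (T *v v)"
  by (simp add: lie_g_iff h_adj_left matrix_apply h_simps)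

text \<open>A nonzero such \<open>X\<close> would be tangent to the stabilizer, whose Cayley
  transforms make it infinite.\<close>

lemma no_stabilizing_lie_element:
  assumes T: "T \<in> lie_g h" and stab: "xi T \<in> g_stab h e"
    and X: "X \<in> lie_g h" "X *v e = 0" "X ** T = T ** X"
  shows "X = 0"
proof (rule ccontr)
  assume "X \<noteq> 0"
  with X have "infinite {x \<in> U_VH h e. x ** T = T ** x}"
    by (intro infinite_stabilizer)
  moreover have "{x \<in> U_VH h e. x ** T = T ** x} = {x \<in> U_VH h e. coAd x (xi T) = xi T}"
    using T by (auto simp: U_VH_iff coAd_fix_iff)
  ultimately show False
    using stab by (simp add: g_stab_def)
qed

text \<open>Otherwise the orthogonal of the cyclic span of \<open>e\<close> either splits off, and \<open>T\<close> is centralized by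
  a circle or torus acting on it, or it contains a \<open>T\<close>-stable isotropic submodule, along which \<open>T\<close>
  degenerates within the closed orbit to an element centralized by a one-parameter group.\<close>

lemma stable_imp_cyclic:
  assumes T: "T \<in> lie_g h" and stab: "xi T \<in> g_stab h e" and w: "\<And>k. h w (pow_e T k) = 0"
  shows "w = 0"
proof (rule ccontr)
  assume "w \<noteq> 0"
  define N where "N = {v. \<forall>k. h v (pow_e T k) = 0}"
  define M where "M = {v. \<forall>n\<in>N. h v n = 0}"
  have sub: "submodule N" "submodule M" "submodule (N \<inter> M)"
    by (auto simp: submodule_def N_def M_def h_simps)
  have NM: "h n v = 0" if "v \<in> M" "n \<in> N" for n v
    using that h_flip[of n v] by (simp add: M_def)
  have TN: "T *v v \<in> N" if "v \<in> N" for v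
    using that by (simp add: N_def lie_g_skew[OF T] flip: pow_e_Suc)
  have TM: "T *v v \<in> M" if "v \<in> M" for v
    using that TN by (simp add: M_def lie_g_skew[OF T])
  have N_e: "h v e = 0" if "v \<in> N" for v
    using that pow_e_0[of T] by (simp add: N_def del: pow_e_0) (metis pow_e_0)
  have e_M: "e \<in> M"
    using N_e h_flip[of e] by (auto simp: M_def)
  show False
  proof (cases "N \<inter> M \<subseteq> {0}")
    case True
    then obtain p where p: "\<And>v. p *v v \<in> N" "\<And>v. v \<in> N \<Longrightarrow> p *v v = v" "\<And>v. v \<in> M \<Longrightarrow> p *v v = 0"
      using ex_projection[OF sub(1,2)] by blast
    \<comment> \<open>As \<open>p\<close> is the identity on \<open>N\<close>, the difference of
      \<open>v\<close> and \<open>adj p *v v\<close> is orthogonal to \<open>N\<close>, hence killed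
      by \<open>p\<close>. This makes \<open>p\<close> self-adjoint, the orthogonal projection onto
      \<open>N\<close>.\<close>
    have "p *v v = p *v (adj p *v v)" for v
    proof -
      have "v - adj p *v v \<in> M"
        using p(2) by (simp add: M_def h_simps h_adj_right)
      from p(3)[OF this] show ?thesis
        by (simp add: matrix_apply)
    qed
    then have pp: "p = p ** adj p"
      by (simp add: matrix_eq flip: matrix_vector_mul_assoc)
    have sa: "adj p = p"
      by (subst (1 2) pp) (simp add: adj_mult)
    have "p ** (T ** p) = T ** p"
      using p TN by (simp add: matrix_eq flip: matrix_vector_mul_assoc)
    moreover from this have "adj (p ** (T ** p)) = adj (T ** p)"
      by simp
    then have "p ** T ** p = p ** T"
      using T by (auto simp: adj_mult sa lie_g_iff matrix_eq matrix_apply)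
    ultimately have comm: "p ** T = T ** p"
      by (simp add: matrix_mul_assoc)
    then have comm': "p *v (T *v v) = T *v (p *v v)" for v
      by (simp add: matrix_vector_mul_assoc)
    \<comment> \<open>Up to a scalar of F, \<delta> times the projection is the infinitesimal form
      of norm-one scalars acting on \<open>N\<close> and trivially on its complement.\<close>
    have "mat \<delta> ** p = 0"
    proof (rule no_stabilizing_lie_element[OF T stab])
      show "mat \<delta> ** p \<in> lie_g h"
        by (simp add: lie_g_iff adj_mult sa matrix_eq matrix_apply vector_smult_lneg)
      show "(mat \<delta> ** p) *v e = 0"
        using p(3)[OF e_M] by (simp add: matrix_apply)
      show "mat \<delta> ** p ** T = T ** (mat \<delta> ** p)"
        by (simp add: matrix_eq matrix_apply comm')
    qed
    then have "(mat \<delta> ** p) *v w = 0"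
      by simp
    moreover have "p *v w = w"
      using w by (intro p) (simp add: N_def)
    ultimately have "\<delta>' *s (\<delta> *s w) = 0"
      by (simp add: matrix_apply)
    then show False
      using \<open>w \<noteq> 0\<close> by (simp add: vector_smult_assoc)
  next
    case False
    then obtain u where u: "u \<in> N" "u \<in> M" "u \<noteq> 0"
      by auto
    have sub_e: "submodule (range (\<lambda>c. c *s e))"
    proof -
      have "(0::'e^'m) \<in> range (\<lambda>c. c *s e)"
        by (rule image_eqI[of _ _ 0]) auto
      then show ?thesis
        by (auto simp: submodule_def vector_smult_assoc simp flip: vector_sadd_rdistrib)
    qed
    \<comment> \<open>The line of \<open>e\<close> is anisotropic while \<open>N\<close> is
      orthogonal to \<open>e\<close>, so the projection onto the isotropic part can be chosen to
      kill \<open>e\<close>.\<close>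
    have "N \<inter> M \<inter> range (\<lambda>c. c *s e) \<subseteq> {0}"
    proof clarsimp
      fix c assume "c *s e \<in> N"
      then have "c * h e e = 0"
        using N_e[of "c *s e"] by (simp add: h_simps)
      then have "c * h e e * \<epsilon> = 0"
        by simp
      then show "c *s e = 0"
        by (simp add: mult.assoc)
    qed
    then obtain p where p: "\<And>v. p *v v \<in> N \<inter> M" "\<And>v. v \<in> N \<inter> M \<Longrightarrow> p *v v = v"
        "\<And>v. v \<in> range (\<lambda>c. c *s e) \<Longrightarrow> p *v v = 0"
      using ex_projection[OF sub(3) sub_e] by blast
    have p_e: "p *v e = 0"
      by (rule p(3)) (rule image_eqI[of _ _ 1], auto)
    have p'_I: "adj p *v v = 0" if "v \<in> M" for v
      by (rule h_nondegenerate) (use p(1) that in \<open>auto simp: h_adj_right M_def\<close>)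
    define p' where "p' = adj p"
    have [simp]: "p *v (p *v v) = p *v v" "p' *v (p *v v) = 0" for v
      using p p'_I by (auto simp: p'_def)
    have "p' ** p' = p'"
      unfolding p'_def adj_mult[symmetric] by (rule arg_cong[of _ _ adj]) (simp add: matrix_eq flip: matrix_vector_mul_assoc)
    then have [simp]: "p' *v (p' *v v) = p' *v v" for v
      by (simp add: matrix_vector_mul_assoc)
    \<comment> \<open>The idempotents \<open>p\<close> and \<open>p'\<close> satisfy
      \<open>p' ** p = 0\<close>, but \<open>p ** p'\<close> may be nonzero. Subtracting half of it
      from each makes both products vanish and keeps them adjoint to each other: a pair of isotropic
      submodules in duality.\<close>
    define q where "q = p - (1/2) *\<^sub>R (p ** p')"
    define q' where "q' = p' - (1/2) *\<^sub>R (p ** p')"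
    have adj_q [simp]: "adj q = q'" "adj q' = q"
      by (simp_all add: q_def q'_def p'_def adj_diff adj_scaleR adj_mult)
    have q [simp]: "q *v (q *v v) = q *v v" "q' *v (q *v v) = 0" "q *v (q' *v v) = 0"
        "q' *v (q' *v v) = q' *v v" for v
      by (simp_all add: q_def q'_def matrix_apply)
    have q_e [simp]: "q *v e = 0" "q' *v e = 0"
      using p'_I[OF e_M] p_e by (simp_all add: q_def q'_def p'_def matrix_apply)
    have q_I: "q *v v = v" "q' *v v = 0" if "v \<in> N \<inter> M" for v
      using that p'_I p(2) by (simp_all add: q_def q'_def p'_def matrix_apply)
    have q_range: "q *v v \<in> N \<inter> M" for v
    proof -
      have "q *v v = p *v (v - (1/2) *\<^sub>R (p' *v v))"
        by (simp add: q_def matrix_apply)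
      then show ?thesis
        using p(1) by simp
    qed
    have TI: "T *v (q *v v) \<in> N \<inter> M" for v
      using q_range TN TM by blast
    have Tq [simp]: "q *v (T *v (q *v v)) = T *v (q *v v)" "q' *v (T *v (q *v v)) = 0" for v
      using q_I[OF TI] by auto
    have "adj (q ** (T ** q)) = adj (T ** q)"
      by (rule arg_cong[of _ _ adj]) (simp add: matrix_eq flip: matrix_vector_mul_assoc)
    then have "q' ** (T ** q') = q' ** T"
      using T by (auto simp: adj_mult lie_g_iff matrix_eq matrix_apply)
    then have q'T [simp]: "q' *v (T *v (q' *v v)) = q' *v (T *v v)" for v
      by (metis matrix_vector_mul_assoc)
    define r where "r = mat 1 - q - q'"
    have r: "r *v v = v - q *v v - q' *v v" for v
      by (simp add: r_def matrix_apply)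
    \<comment> \<open>A one-parameter group in U(V_H): weights 1, 0 and -1 on the images of
      \<open>q\<close>, \<open>r\<close> and \<open>q'\<close>. Weights opposite on dual submodules
      preserve \<open>h\<close>, and \<open>e\<close> lies in the image of \<open>r\<close>.\<close>
    define lam where "lam t = t *\<^sub>R q + r + inverse t *\<^sub>R q'" for t :: real
    have adj_lam: "adj (lam t) = t *\<^sub>R q' + r + inverse t *\<^sub>R q" for t
      by (simp add: lam_def r_def adj_add adj_scaleR adj_diff)
    have lam: "lam t \<in> U_VH h e" if "t \<noteq> 0" for t
    proof -
      have "adj (lam t) *v (lam t *v v) = v" for v
        unfolding adj_lam using that by (simp add: lam_def matrix_apply r)
      then show ?thesis
        by (simp add: U_VH_iff U_V_iff matrix_eq) (simp add: lam_def matrix_apply r flip: matrix_vector_mul_assoc)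
    qed
    \<comment> \<open>\<open>T\<close> is block upper triangular for \<open>q\<close>,
      \<open>r\<close>, \<open>q'\<close>. Conjugation by \<open>lam t\<close> multiplies blocks one
      step above the diagonal by \<open>t\<close> and the corner by its square, so the limit at 0 is
      the block diagonal \<open>T0\<close>.\<close>
    define T0 where "T0 = q ** T ** q + r ** T ** r + q' ** T ** q'"
    define T1 where "T1 = q ** T ** r + r ** T ** q'"
    have conj: "lam t ** T ** adj (lam t) = T0 + t *\<^sub>R T1 + (t * t) *\<^sub>R (q ** T ** q')" if "t \<noteq> 0" for t
      unfolding adj_lam using that
      by (simp add: matrix_eq lam_def T0_def T1_def matrix_apply r algebra_simps)
    have "(\<lambda>n. T0 + (1 / real (Suc n)) *\<^sub>R T1 + (1 / real (Suc n) * (1 / real (Suc n))) *\<^sub>R (q ** T ** q'))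
        \<longlonglongrightarrow> T0 + 0 *\<^sub>R T1 + (0 * 0) *\<^sub>R (q ** T ** q')"
      by (intro tendsto_intros LIMSEQ_Suc[OF lim_1_over_n])
    then have "(\<lambda>n. lam (1 / real (Suc n)) ** T ** adj (lam (1 / real (Suc n)))) \<longlonglongrightarrow> T0"
      by (simp add: conj del: of_nat_Suc)
    then obtain x where x: "x \<in> U_VH h e" "T0 = x ** T ** adj x"
      using stable_limit[OF T stab, of "\<lambda>n. lam (1 / real (Suc n))" T0] lam by (auto simp del: of_nat_Suc)
    have xU: "x \<in> U_V h" and x_e: "x *v e = e"
      using x by (auto simp: U_VH_iff)
    \<comment> \<open>The generator of \<open>lam\<close> commutes with the limit \<open>T0\<close>.
      Conjugated back by \<open>x\<close> it stabilizes \<open>T\<close> and kills \<open>e\<close>,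
      so it must vanish, yet it fixes \<open>u\<close>.\<close>
    define X where "X = q - q'"
    have "X ** T0 = T0 ** X"
      by (simp add: matrix_eq X_def T0_def matrix_apply r)
    then have XT: "X *v (x *v (T *v (adj x *v v))) = x *v (T *v (adj x *v (X *v v)))" for v
      by (metis x(2) matrix_vector_mul_assoc)
    have "adj x ** X ** x = 0"
    proof (rule no_stabilizing_lie_element[OF T stab])
      have "X \<in> lie_g h"
        by (simp add: lie_g_iff X_def adj_diff)
      then show "adj x ** X ** x \<in> lie_g h"
        using conj_in_lie_g_iff xU by blast
      show "(adj x ** X ** x) *v e = 0"
        by (simp add: matrix_apply x_e X_def)
      show "adj x ** X ** x ** T = T ** (adj x ** X ** x)"
      proof -
        have "adj x *v (X *v (x *v (T *v v))) = T *v (adj x *v (X *v (x *v v)))" for v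
          using XT[of "x *v v"] xU by simp
        then show ?thesis
          by (simp add: matrix_eq matrix_apply)
      qed
    qed
    then have "x *v ((adj x ** X ** x) *v (adj x *v u)) = 0"
      by simp
    then have "X *v u = 0"
      using xU by (simp add: matrix_apply)
    then show False
      using u q_I[of u] by (simp add: X_def matrix_apply)
  qed
qed

section \<open>Comparison of norms\<close>

lemma inner_product_lower_bound:
  assumes B: "inner_product_on (g_wedge h) B"
  shows "\<exists>c>0. \<forall>S\<in>lie_g h. c * norm S \<le> sqrt (B (xi S) (xi S))"
proof (rule positive_bilinear_lower_bound[where b = "\<lambda>S T. B (xi S) (xi T)", OF _ subspace_lie_g])
  have sym: "B (xi S) (xi T) = B (xi T) (xi S)" for S T
    using B xi_in_g_wedge by (simp add: inner_product_on_def)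
  have add: "B (xi (S + S')) (xi T) = B (xi S) (xi T) + B (xi S') (xi T)" for S S' T
    unfolding xi_add
    by (rule B[unfolded inner_product_on_def, THEN conjunct2, THEN conjunct1, rule_format])
       (rule xi_in_g_wedge)+
  have scale: "B (xi (r *\<^sub>R S)) (xi T) = r * B (xi S) (xi T)" for S r T
    unfolding xi_scaleR
    by (rule B[unfolded inner_product_on_def, THEN conjunct2, THEN conjunct2, THEN conjunct1, rule_format])
       (rule xi_in_g_wedge)+
  have add': "B (xi T) (xi (S + S')) = B (xi T) (xi S) + B (xi T) (xi S')"
    and scale': "B (xi T) (xi (r *\<^sub>R S)) = r * B (xi T) (xi S)" for S S' r T
    using sym add scale by metis+
  show "bilinear (\<lambda>S T. B (xi S) (xi T))"
    unfolding bilinear_def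
    by (intro conjI allI linearI) (simp_all add: add scale add' scale')
  fix S assume S: "S \<in> lie_g h" "S \<noteq> 0"
  have "xi 0 = (\<lambda>_. 0)"
    using xi_scaleR[of 0 0] by simp
  then have "xi S \<noteq> (\<lambda>_. 0)"
    using S xi_inject[of S 0] subspace_0[OF subspace_lie_g] by auto
  then show "0 < B (xi S) (xi S)"
    using B xi_in_g_wedge by (simp add: inner_product_on_def)
qed

lemma End_g_norm_bound:
  assumes N: "norm_on (End_g h) N"
  shows "\<exists>C>0. \<forall>T\<in>End_g h. \<forall>k\<ge>0. (\<forall>X\<in>lie_g h. norm (T X) \<le> k * norm X) \<longrightarrow> N T \<le> C * k"
proof -
  \<comment> \<open>Rank-one maps that span End(g). Their images \<open>skew b\<close> span the Lie
    algebra but may be linearly dependent, so an explicit choice of coefficients replaces a basis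
    expansion.\<close>
  define E where "E p = (\<lambda>X. if X \<in> lie_g h then (X \<bullet> fst p) *\<^sub>R skew (snd p) else 0)"
    for p :: "('e^'m^'m) \<times> ('e^'m^'m)"
  let ?I = "(Basis :: ('e^'m^'m) set) \<times> (Basis :: ('e^'m^'m) set)"
  note sub = subspace_add[OF subspace_lie_g] subspace_scale[OF subspace_lie_g] subspace_0[OF subspace_lie_g]
  have E: "E p \<in> End_g h" for p
    using skew_in_lie_g
    by (auto simp: End_g_def linear_on_g_def E_def sub inner_add_left scaleR_add_left)
  have N0: "0 \<le> N (E p)" for p
    using N E by (simp add: norm_on_def)
  define C where "C = (\<Sum>p\<in>?I. norm (skew (fst p)) * N (E p))"
  have "N T \<le> (C + 1) * k" if T: "T \<in> End_g h" and k: "k \<ge> 0" "\<And>X. X \<in> lie_g h \<Longrightarrow> norm (T X) \<le> k * norm X" for T k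
  proof -
    define a where "a p = T (skew (fst p)) \<bullet> snd p" for p
    have TX: "T X = (\<Sum>p\<in>?I. a p *\<^sub>R E p X)" for X
    proof (cases "X \<in> lie_g h")
      case True
      have lin: "linear (\<lambda>X. T (skew X))"
        using T skew_in_lie_g
        by (auto intro!: linearI simp: End_g_def linear_on_g_def linear_add[OF linear_skew] linear_scale[OF linear_skew])
      have T_in: "T (skew X) \<in> lie_g h" for X
        using T skew_in_lie_g by (auto simp: End_g_def)
      have expand: "T (skew b) = (\<Sum>b'\<in>Basis. (T (skew b) \<bullet> b') *\<^sub>R skew b')" for b
      proof -
        have "T (skew b) = skew (\<Sum>b'\<in>Basis. (T (skew b) \<bullet> b') *\<^sub>R b')"
          by (simp add: euclidean_representation skew_lie_g T_in)
        then show ?thesis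
          by (simp add: linear_sum[OF linear_skew] linear_scale[OF linear_skew])
      qed
      have "T X = T (skew (\<Sum>b\<in>Basis. (X \<bullet> b) *\<^sub>R b))"
        using True by (simp add: euclidean_representation skew_lie_g)
      also have "\<dots> = (\<Sum>b\<in>Basis. (X \<bullet> b) *\<^sub>R T (skew b))"
        by (simp add: linear_sum[OF lin] linear_scale[OF lin])
      also have "\<dots> = (\<Sum>b\<in>Basis. (X \<bullet> b) *\<^sub>R (\<Sum>b'\<in>Basis. (T (skew b) \<bullet> b') *\<^sub>R skew b'))"
        by (subst expand) (rule refl)
      also have "\<dots> = (\<Sum>p\<in>?I. a p *\<^sub>R E p X)"
        using True by (simp add: sum.cartesian_product' scaleR_sum_right a_def E_def mult.commute)
      finally show ?thesis .
    next
      case False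
      then show ?thesis
        using T by (simp add: End_g_def linear_on_g_def E_def)
    qed
    have "N (\<lambda>X. \<Sum>p\<in>?I. a p *\<^sub>R E p X) \<le> (\<Sum>p\<in>?I. \<bar>a p\<bar> * N (E p))"
      by (rule norm_on_sum_le[OF N, THEN conjunct2])
         (auto simp: E, auto simp: End_g_def linear_on_g_def sub image_subset_iff algebra_simps)
    also have "\<dots> \<le> (\<Sum>p\<in>?I. k * (norm (skew (fst p)) * N (E p)))"
    proof (rule sum_mono)
      fix p assume "p \<in> ?I"
      then have "\<bar>a p\<bar> \<le> norm (T (skew (fst p)))"
        unfolding a_def by (auto simp: Basis_le_norm)
      also have "\<dots> \<le> k * norm (skew (fst p))"
        using k skew_in_lie_g by blast
      finally show "\<bar>a p\<bar> * N (E p) \<le> k * (norm (skew (fst p)) * N (E p))"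
        using N0[of p] by (metis mult.assoc mult_right_mono)
    qed
    also have "\<dots> = C * k"
      by (simp add: C_def sum_distrib_left mult.commute)
    also have "\<dots> \<le> (C + 1) * k"
      using k by (simp add: mult_right_mono)
    also have "(\<lambda>X. \<Sum>p\<in>?I. a p *\<^sub>R E p X) = T"
      using TX by auto
    finally show ?thesis .
  qed
  moreover have "C \<ge> 0"
    unfolding C_def using N0 by (intro sum_nonneg) auto
  ultimately show ?thesis
    by (intro exI[of _ "C + 1"]) auto
qed

text \<open>Applied with \<open>A\<close> the projection onto V_H, because z - 1 is c - 1 times that
  projection.\<close>

lemma End_V_norm_bound:
  fixes A :: "'e^'m^'m"
  assumes N: "norm_on End_V N"
  shows "\<exists>C>0. \<forall>\<eta>. N (\<lambda>v. \<eta> *s (A *v v)) \<le> C * norm (\<eta>::'e)"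
proof -
  define F where "F b = (\<lambda>v. b *s (A *v v))" for b :: 'e
  have F: "F b \<in> End_V" for b
    by (auto simp: End_V_def F_def image_iff fun_eq_iff intro!: exI[of _ "mat b ** A"])
       (simp add: matrix_apply)
  have N0: "0 \<le> N (F b)" for b
    using N F by (simp add: norm_on_def)
  define C where "C = (\<Sum>b\<in>Basis. N (F b))"
  have "N (\<lambda>v. \<eta> *s (A *v v)) \<le> (C + 1) * norm \<eta>" for \<eta> :: 'e
  proof -
    have "\<eta> *s (A *v v) = (\<Sum>b\<in>Basis. (\<eta> \<bullet> b) *\<^sub>R F b v)" for v
    proof -
      have lin: "linear (\<lambda>\<eta>. \<eta> *s (A *v v))"
        by (rule linearI) (simp_all add: vec_eq_iff algebra_simps)
      have "\<eta> *s (A *v v) = (\<Sum>b\<in>Basis. (\<eta> \<bullet> b) *\<^sub>R b) *s (A *v v)"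
        by (simp add: euclidean_representation)
      also have "\<dots> = (\<Sum>b\<in>Basis. (\<eta> \<bullet> b) *\<^sub>R F b v)"
        by (simp add: linear_sum[OF lin] linear_scale[OF lin] F_def)
      finally show ?thesis .
    qed
    then have "N (\<lambda>v. \<eta> *s (A *v v)) = N (\<lambda>v. \<Sum>b\<in>Basis. (\<eta> \<bullet> b) *\<^sub>R F b v)"
      by simp
    also have "\<dots> \<le> (\<Sum>b\<in>Basis. \<bar>\<eta> \<bullet> b\<bar> * N (F b))"
    proof (rule norm_on_sum_le[OF N, THEN conjunct2])
      show "(\<lambda>_. 0) \<in> (End_V :: ('e^'m \<Rightarrow> 'e^'m) set)"
        unfolding End_V_def by (rule image_eqI[of _ _ 0]) auto
      show "(\<lambda>x. f x + g x) \<in> End_V" if "f \<in> End_V" "g \<in> End_V" for f g :: "'e^'m \<Rightarrow> 'e^'m"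
        using that unfolding End_V_def
        by (auto simp: image_iff fun_eq_iff simp flip: matrix_vector_mult_add_rdistrib)
      show "(\<lambda>x. r *\<^sub>R f x) \<in> End_V" if "f \<in> End_V" for f :: "'e^'m \<Rightarrow> 'e^'m" and r
        using that unfolding End_V_def
        by (auto simp: image_iff fun_eq_iff simp flip: matrix_vector_mult_scaleR_left)
    qed (auto simp: F)
    also have "\<dots> \<le> (\<Sum>b\<in>Basis. norm \<eta> * N (F b))"
      by (intro sum_mono mult_right_mono N0) (simp add: Basis_le_norm)
    also have "\<dots> = C * norm \<eta>"
      by (simp add: C_def sum_distrib_left mult.commute)
    also have "\<dots> \<le> (C + 1) * norm \<eta>"
      by (simp add: mult_right_mono)
    finally show ?thesis .
  qed
  moreover have "C \<ge> 0"
    unfolding C_def using N0 by (intro sum_nonneg) auto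
  ultimately show ?thesis
    by (intro exI[of _ "C + 1"]) auto
qed

section \<open>The invariants \<open>\<langle>T\<^sup>k e, e\<rangle>\<close>\<close>

lemma continuous_pow_e: "continuous_on UNIV (\<lambda>T. pow_e T k)"
  by (induction k) (auto simp: pow_e_Suc intro!: continuous_intros continuous_on_bilinear)

text \<open>The size bound is carried through the induction because the next difference contains (A
  - B) applied to the k-th vector of \<open>B\<close>.\<close>

lemma pow_e_lipschitz:
  "\<exists>C\<ge>0. \<forall>A B. norm A \<le> \<rho> \<longrightarrow> norm B \<le> \<rho> \<longrightarrow>
     norm (pow_e A k - pow_e B k) \<le> C * norm (A - B) \<and> norm (pow_e A k) \<le> C"
proof (induction k)
  case 0
  then show ?case
    by (intro exI[of _ "norm e"]) auto
next
  case (Suc k)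
  then obtain C where C: "C \<ge> 0" "\<And>A B. norm A \<le> \<rho> \<Longrightarrow> norm B \<le> \<rho> \<Longrightarrow> norm (pow_e A k - pow_e B k) \<le> C * norm (A - B)"
     "\<And>A. norm A \<le> \<rho> \<Longrightarrow> norm (pow_e A k) \<le> C"
    by blast
  obtain D where D: "D > 0" "\<And>(A::'e^'m^'m) v. norm (A *v v) \<le> norm A * norm v * D"
    using bounded_bilinear.pos_bounded[OF bounded_bilinear_matrix_vector_mult] by blast
  let ?C = "\<bar>\<rho>\<bar> * C * D + C * D"
  have "norm (pow_e A (Suc k) - pow_e B (Suc k)) \<le> ?C * norm (A - B) \<and> norm (pow_e A (Suc k)) \<le> ?C"
    if AB: "norm A \<le> \<rho>" "norm B \<le> \<rho>" for A B
  proof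
    have "pow_e A (Suc k) - pow_e B (Suc k) = A *v (pow_e A k - pow_e B k) + (A - B) *v pow_e B k"
      by (simp add: pow_e_Suc matrix_apply)
    also have "norm \<dots> \<le> norm A * norm (pow_e A k - pow_e B k) * D + norm (A - B) * norm (pow_e B k) * D"
      by (intro order_trans[OF norm_triangle_ineq] add_mono D)
    also have "\<dots> \<le> \<bar>\<rho>\<bar> * (C * norm (A - B)) * D + norm (A - B) * C * D"
      using AB C D by (intro add_mono mult_right_mono mult_mono mult_left_mono) auto
    finally show "norm (pow_e A (Suc k) - pow_e B (Suc k)) \<le> ?C * norm (A - B)"
      by (simp add: algebra_simps)
    have "norm (pow_e A (Suc k)) \<le> norm A * norm (pow_e A k) * D"
      by (simp add: pow_e_Suc D)
    also have "\<dots> \<le> \<bar>\<rho>\<bar> * C * D"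
      using AB C D by (intro mult_right_mono mult_mono) auto
    also have "\<dots> \<le> ?C"
      using C D by simp
    finally show "norm (pow_e A (Suc k)) \<le> ?C" .
  qed
  moreover have "?C \<ge> 0"
    using C D by simp
  ultimately show ?case
    by blast
qed

lemma invariants_lipschitz:
  "\<exists>L\<ge>0. \<forall>k<n. \<forall>A B. norm A \<le> \<rho> \<longrightarrow> norm B \<le> \<rho> \<longrightarrow>
     norm (h (pow_e A k) e - h (pow_e B k) e) \<le> L * norm (A - B)"
proof -
  obtain D where D: "D > 0" "\<And>u v. norm (h u v) \<le> norm u * norm v * D"
    using bounded_bilinear.pos_bounded[OF bounded_bilinear_h] by blast
  obtain C where C: "\<And>k. C k \<ge> 0" "\<And>k A B. norm A \<le> \<rho> \<Longrightarrow> norm B \<le> \<rho> \<Longrightarrow>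
     norm (pow_e A k - pow_e B k) \<le> C k * norm (A - B)"
    using pow_e_lipschitz[of \<rho>] by metis
  define L where "L = (\<Sum>k<n. C k * norm e * D)"
  have "norm (h (pow_e A k) e - h (pow_e B k) e) \<le> L * norm (A - B)"
    if "k < n" "norm A \<le> \<rho>" "norm B \<le> \<rho>" for k A B
  proof -
    have "norm (h (pow_e A k) e - h (pow_e B k) e) \<le> norm (pow_e A k - pow_e B k) * norm e * D"
      unfolding h_diff_left[symmetric] by (rule D)
    also have "\<dots> \<le> C k * norm (A - B) * norm e * D"
      using C that D by (intro mult_right_mono) auto
    also have "\<dots> = C k * norm e * D * norm (A - B)"
      by simp
    also have "C k * norm e * D \<le> L"
      unfolding L_def using that C D by (intro member_le_sum) auto
    finally show ?thesis
      by (simp add: mult_right_mono)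
  qed
  moreover have "L \<ge> 0"
    unfolding L_def using C D by (intro sum_nonneg) auto
  ultimately show ?thesis
    by blast
qed

text \<open>If h(Q T^k e, T^l e) vanishes for all k and l, cyclicity applied to \<open>Q\<close> and
  then to its adjoint gives Q = 0. Working with pairs (k, l) allows compactness over the full unit
  sphere of matrices; commutation with the skew \<open>T\<close> afterwards moves the power l to the
  left, up to sign.\<close>

lemma centralizer_bound:
  assumes K: "compact K" and KT: "\<And>T. T \<in> K \<Longrightarrow> T \<in> lie_g h \<and> xi T \<in> g_stab h e"
  shows "\<exists>n. \<exists>c>0. \<forall>T\<in>K. \<forall>Q. Q ** T = T ** Q \<longrightarrow> (\<exists>j<n. c * norm Q \<le> norm (h (Q *v pow_e T j) e))"
proof -
  define f where "f j p = norm (h (snd p *v pow_e (fst p) (fst (prod_decode j))) (pow_e (fst p) (snd (prod_decode j))))"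
    for j and p :: "('e^'m^'m) \<times> ('e^'m^'m)"
  have cpow: "continuous_on UNIV (\<lambda>p::('e^'m^'m) \<times> ('e^'m^'m). pow_e (fst p) k)" for k
    by (rule continuous_on_compose2[OF continuous_pow_e]) (auto intro!: continuous_intros)
  have "\<exists>n. \<exists>c>0. \<forall>p\<in>K \<times> sphere 0 1. \<exists>j<n. c \<le> \<bar>f j p\<bar>"
  proof (rule compact_uniformly_nonzero)
    show "compact (K \<times> sphere (0::'e^'m^'m) 1)"
      using K by (intro compact_Times) auto
    show "continuous_on UNIV (f j)" for j
      unfolding f_def
      by (intro continuous_on_norm bounded_bilinear.continuous_on[OF bounded_bilinear_h]
          continuous_on_bilinear continuous_on_snd continuous_on_id cpow)
    fix p assume "p \<in> K \<times> sphere (0::'e^'m^'m) 1"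
    then obtain T Q where p: "p = (T, Q)" "T \<in> K" "norm Q = 1"
      by auto
    show "\<exists>j. f j p \<noteq> 0"
    proof (rule ccontr)
      assume no: "\<nexists>j. f j p \<noteq> 0"
      have 0: "h (Q *v pow_e T k) (pow_e T l) = 0" for k l
      proof -
        have "f (prod_encode (k, l)) p = 0"
          using no by blast
        then show ?thesis
          by (simp add: f_def p)
      qed
      have "Q *v pow_e T k = 0" for k
        using stable_imp_cyclic[of T "Q *v pow_e T k"] KT p 0 by blast
      then have "h (adj Q *v y) (pow_e T k) = 0" for y k
        by (simp add: h_adj_right)
      then have "adj Q *v y = 0" for y
        using stable_imp_cyclic[of T "adj Q *v y"] KT p by blast
      then have "adj Q = 0"
        by (simp add: matrix_eq)
      then have "Q = 0"
        by (metis adj_0 adj_adj)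
      then show False
        using p by simp
    qed
  qed
  then obtain n0 c where c: "c > 0" "\<And>p. p \<in> K \<times> sphere 0 1 \<Longrightarrow> \<exists>j<n0. c \<le> \<bar>f j p\<bar>"
    by blast
  \<comment> \<open>A strict bound for k + l over all pairs with code below \<open>n0\<close>; the
    successor also makes it positive for the case Q = 0.\<close>
  define n where "n = Suc (\<Sum>j<n0. fst (prod_decode j) + snd (prod_decode j))"
  have "\<exists>j<n. c * norm Q \<le> norm (h (Q *v pow_e T j) e)" if T: "T \<in> K" and Q: "Q ** T = T ** Q" for T Q
  proof (cases "Q = 0")
    case True
    then show ?thesis
      by (auto simp: n_def)
  next
    case False
    let ?Q = "Q /\<^sub>R norm Q"
    obtain j where j: "j < n0" "c \<le> \<bar>f j (T, ?Q)\<bar>"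
      using c(2)[of "(T, ?Q)"] T False by auto
    obtain k l where kl: "prod_decode j = (k, l)"
      by fastforce
    have QT: "Q *v (T *v v) = T *v (Q *v v)" for v
      by (simp add: Q matrix_vector_mul_assoc)
    have shift: "norm (h (Q *v pow_e T k) (pow_e T l)) = norm (h (Q *v pow_e T (k + l)) e)" for k l
    proof (induction l arbitrary: k)
      case (Suc l)
      have "h (Q *v pow_e T k) (pow_e T (Suc l)) = - h (Q *v pow_e T (Suc k)) (pow_e T l)"
        using KT[OF T] lie_g_skew[of T "Q *v pow_e T k"] by (simp add: pow_e_Suc QT)
      then show ?case
        using Suc[of "Suc k"] by simp
    qed simp
    have "c \<le> norm (h (Q *v pow_e T k) (pow_e T l)) / norm Q"
      using j by (simp add: f_def kl matrix_apply h_simps divide_inverse mult.commute)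
    then have "c * norm Q \<le> norm (h (Q *v pow_e T (k + l)) e)"
      using False by (simp add: shift field_simps)
    moreover have "k + l \<le> (\<Sum>j<n0. fst (prod_decode j) + snd (prod_decode j))"
      using member_le_sum[of j "{..<n0}" "\<lambda>j. fst (prod_decode j) + snd (prod_decode j)"] j kl by simp
    ultimately show ?thesis
      by (intro exI[of _ "k + l"]) (simp add: n_def)
  qed
  then show ?thesis
    using c(1) by blast
qed

section \<open>The key identity\<close>

primrec mpow :: "'e^'m^'m \<Rightarrow> nat \<Rightarrow> 'e^'m^'m" where
  "mpow T 0 = mat 1"
| "mpow T (Suc k) = T ** mpow T k"

lemma pow_e_eq_mpow: "pow_e T k = mpow T k *v e"
  by (induction k) (simp_all add: pow_e_Suc matrix_apply)

lemma mpow_commute: "g ** T = T ** g \<Longrightarrow> g ** mpow T k = mpow T k ** g"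
  by (induction k) (simp, metis matrix_mul_assoc mpow.simps(2))

lemma pow_e_conj:
  assumes "y \<in> U_V h"
  shows "pow_e (y ** T ** adj y) k = y *v (mpow T k *v (adj y *v e))"
  using assms by (induction k) (simp_all add: pow_e_Suc matrix_apply)

definition \<nu> :: "'e^'m^'m \<Rightarrow> 'e" where "\<nu> g = h (adj g *v e) e * \<epsilon>"

text \<open>The matrix R of the overview, with \<open>\<sigma> c\<close> and \<open>adj g\<close> in
  place of the inverses, so that it is defined for arbitrary \<open>g\<close> and
  \<open>c\<close>.\<close>

definition defect :: "'e^'m^'m \<Rightarrow> 'e \<Rightarrow> 'e^'m^'m" where
  "defect g c = mat (\<nu> g) ** g - mat (\<nu> g * \<sigma> (\<nu> g))
     - mat (\<sigma> c) ** (mat (\<sigma> (\<nu> g)) ** adj g - mat (\<nu> g * \<sigma> (\<nu> g)))"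

text \<open>With \<open>a = z\<^sup>-\<^sup>1 g\<^sup>-\<^sup>1 e = \<sigma>(c) g\<^sup>-\<^sup>1 e + (1 - \<sigma>(c)) \<nu> e\<close>, the \<open>k\<close>-th invariant of \<open>g z T\<close> is
  \<open>\<langle>T\<^sup>k a, a\<rangle>\<close>, and \<open>g\<close> commutes with \<open>T\<close>.\<close>

lemma invariant_difference:
  assumes g: "g \<in> U_V h" "g ** T = T ** g" and z: "z \<in> U_VH h e"
    and c: "c * \<sigma> c = 1" and zc: "\<And>v. v \<in> V_H h e \<Longrightarrow> z *v v = c *s v"
  shows "h (pow_e (g ** z ** T ** adj (g ** z)) k) e - h (pow_e T k) e
    = h ((mat (c - 1) ** defect g c) *v pow_e T k) e"
proof -
  have zU: "z \<in> U_V h" and ze: "z *v e = e"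
    using z by (auto simp: U_VH_iff)
  define m where "m = mpow T k"
  define u where "u = adj g *v e"
  define \<omega> where "\<omega> = \<sigma> c"
  have s\<omega>: "\<sigma> \<omega> = c"
    by (simp add: \<omega>_def)
  have \<omega>c: "\<omega> * c = 1"
    using c by (simp add: \<omega>_def mult.commute)
  have \<nu>: "\<nu> g = h u e * \<epsilon>"
    by (simp add: \<nu>_def u_def)
  obtain w where w: "w \<in> V_H h e" "u = \<nu> g *s e + w"
    unfolding \<nu> by (rule decompose)
  have ze': "adj z *v e = e"
    by (metis U_V_apply(1) zU ze)
  have zw: "adj z *v w = \<omega> *s w"
  proof -
    have "w = c *s (adj z *v w)"
      using U_V_apply(1)[OF zU, of w] by (simp add: zc[OF w(1)] matrix_apply)
    then have "\<omega> *s w = \<omega> *s (c *s (adj z *v w))"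
      by simp
    then show ?thesis
      by (simp add: vector_smult_assoc \<omega>c)
  qed
  define a where "a = adj (g ** z) *v e"
  have a: "a = \<omega> *s u + ((1 - \<omega>) * \<nu> g) *s e"
  proof -
    have "a = adj z *v u"
      by (simp add: a_def u_def adj_mult matrix_apply)
    also have "\<dots> = \<nu> g *s e + \<omega> *s w"
      by (simp add: w(2) matrix_apply ze' zw)
    also have "\<dots> = \<omega> *s u + ((1 - \<omega>) * \<nu> g) *s e"
      by (simp add: w(2) vec_eq_iff algebra_simps)
    finally show ?thesis .
  qed
  have gm: "g *v (m *v v) = m *v (g *v v)" for v
    using mpow_commute[OF g(2), of k] by (simp add: m_def matrix_vector_mul_assoc)
  have g'm: "m *v (adj g *v v) = adj g *v (m *v v)" for v
  proof -
    have "adj g *v (m *v v) = adj g *v (m *v (g *v (adj g *v v)))"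
      using g by simp
    also have "\<dots> = m *v (adj g *v v)"
      unfolding gm[symmetric] using g by simp
    finally show ?thesis ..
  qed
  define A where "A = h (m *v e) e"
  define B where "B = h (adj g *v (m *v e)) e"
  define D where "D = h (g *v (m *v e)) e"
  have 1: "h (m *v u) u = A" "h (m *v u) e = B" "h (m *v e) u = D"
    using U_V_preserves[OF U_V_adj[OF g(1)]] by (simp_all add: u_def g'm A_def B_def D_def h_adj_left)
  have "h (pow_e (g ** z ** T ** adj (g ** z)) k) e = h (m *v a) a"
    unfolding pow_e_conj[OF U_V_mult[OF g(1) zU]] by (simp add: h_adj_left a_def m_def)
  also have "\<dots> = (\<omega> * c) * A + (\<omega> * (1 - c)) * (\<sigma> (\<nu> g) * B) + ((1 - \<omega>) * c) * (\<nu> g * D)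
      + ((1 - \<omega>) * (1 - c)) * (\<nu> g * \<sigma> (\<nu> g) * A)"
    by (simp add: a matrix_apply h_simps 1 s\<omega> flip: A_def) (simp add: algebra_simps)
  \<comment> \<open>Everything becomes a multiple of c - 1: since \<omega> c = 1, the coefficient
    \<omega> - 1 is -(c - 1) \<omega>, and the last one is (c - 1) \<omega> - (c - 1).\<close>
  also have "\<dots> = A + (c - 1) * (\<nu> g * D) - (c - 1) * (\<nu> g * \<sigma> (\<nu> g) * A)
      - ((c - 1) * \<omega>) * (\<sigma> (\<nu> g) * B - \<nu> g * \<sigma> (\<nu> g) * A)"
  proof -
    have eqs: "\<omega> * (1 - c) = \<omega> - 1" "(1 - \<omega>) * c = c - 1" "(1 - \<omega>) * (1 - c) = 2 - \<omega> - c"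
        "(c - 1) * \<omega> = 1 - \<omega>"
      using \<omega>c by (simp_all add: algebra_simps)
    show ?thesis
      unfolding eqs \<omega>c by (simp add: algebra_simps)
  qed
  also have "\<dots> = A + h ((mat (c - 1) ** defect g c) *v (m *v e)) e"
    by (simp add: defect_def matrix_apply h_simps D_def B_def A_def \<omega>_def algebra_simps)
  finally show ?thesis
    by (simp add: pow_e_eq_mpow m_def A_def)
qed

section \<open>From the defect to \<open>Ad g\<close> minus the identity\<close>

definition \<Theta> :: "'e^'m^'m \<Rightarrow> 'e \<Rightarrow> 'e^'m^'m \<Rightarrow> 'e^'m^'m" where
  "\<Theta> g c Y = mat (\<nu> g) ** Y + mat (\<sigma> c * \<sigma> (\<nu> g)) ** (adj g ** Y ** adj g)"

text \<open>Scalar terms drop out of the commutator. The commutators with \<open>g\<close> and with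
  its inverse have opposite signs, as have their coefficients in \<open>defect\<close>, so the two
  contributions add instead of cancelling.\<close>

lemma defect_commutator:
  assumes "g \<in> U_V h"
  shows "(defect g c ** X - X ** defect g c) ** adj g = \<Theta> g c (g ** X ** adj g - X)"
  using assms
  by (simp add: matrix_eq defect_def \<Theta>_def matrix_apply vector_smult_assoc vector_ssub_ldistrib algebra_simps)

lemma Theta_near_identity:
  "\<exists>r>0. \<forall>g c. norm (g - mat 1) < r \<longrightarrow> norm (c - 1) < r \<longrightarrow> (\<forall>Y. norm (\<Theta> g c Y - 2 *\<^sub>R Y) \<le> norm Y)"
proof -
  define \<Psi> where "\<Psi> p = (\<Sum>b\<in>Basis. norm (\<Theta> (fst p) (snd p) b - 2 *\<^sub>R b))" for p
  have sig: "continuous_on S (\<lambda>x. \<sigma> (f x))" if "continuous_on S f" for f and S :: "(('e^'m^'m) \<times> 'e) set"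
    using that linear_sigma
    by (intro bounded_linear.continuous_on[of \<sigma>]) (simp_all add: linear_conv_bounded_linear)
  have ad: "continuous_on S (\<lambda>x. adj (f x))" if "continuous_on S f" for f and S :: "(('e^'m^'m) \<times> 'e) set"
    using that linear_adj
    by (intro bounded_linear.continuous_on[of adj]) (simp_all add: linear_conv_bounded_linear)
  have nu: "continuous_on S (\<lambda>p. \<nu> (fst p))" for S :: "(('e^'m^'m) \<times> 'e) set"
    unfolding \<nu>_def
    by (intro continuous_on_bilinear bounded_bilinear.continuous_on[OF bounded_bilinear_h] ad continuous_intros)
  have "continuous_on UNIV \<Psi>"
    unfolding \<Psi>_def \<Theta>_def
    by (intro continuous_on_sum continuous_on_norm continuous_on_diff continuous_on_add
        continuous_on_bilinear continuous_on_mat continuous_on_const sig nu ad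
        continuous_on_fst continuous_on_snd continuous_on_id)
  then have "open {p. \<Psi> p < 1}"
    by (intro open_Collect_less continuous_on_const)
  moreover have "\<Psi> (mat 1, 1) = 0"
    by (simp add: \<Psi>_def \<Theta>_def \<nu>_def flip: scaleR_2)
  ultimately obtain d where d: "d > 0" "ball (mat 1, 1) d \<subseteq> {p. \<Psi> p < 1}"
    by (metis (mono_tags, lifting) mem_Collect_eq open_contains_ball zero_less_one)
  have "norm (\<Theta> g c Y - 2 *\<^sub>R Y) \<le> norm Y" if "norm (g - mat 1) < d/2" "norm (c - 1) < d/2" for g c Y
  proof -
    have "dist (g, c) (mat 1, 1) = norm (g - mat 1, c - 1)"
      by (simp add: dist_norm)
    also have "\<dots> \<le> norm (g - mat 1) + norm (c - 1)"
      by (rule norm_Pair_le)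
    finally have "dist (g, c) (mat 1, 1) \<le> norm (g - mat 1) + norm (c - 1)" .
    then have "(g, c) \<in> ball (mat 1, 1) d"
      using that by (simp add: dist_commute)
    then have "\<Psi> (g, c) < 1"
      using d by blast
    moreover have "linear (\<lambda>Y. \<Theta> g c Y - 2 *\<^sub>R Y)"
      by (rule linearI) (simp_all add: \<Theta>_def matrix_add_ldistrib matrix_mul_add_left
          matrix_mul_scaleR_left matrix_mul_scaleR_right algebra_simps)
    then have "norm (\<Theta> g c Y - 2 *\<^sub>R Y) \<le> \<Psi> (g, c) * norm Y"
      using linear_norm_le_sum_Basis[of "\<lambda>Y. \<Theta> g c Y - 2 *\<^sub>R Y" Y] by (simp add: \<Psi>_def)
    ultimately show ?thesis
      by (smt (verit) mult_left_le_one_le mult_right_mono norm_ge_zero mult_1)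
  qed
  then show ?thesis
    using d(1) by (intro exI[of _ "d/2"]) auto
qed

text \<open>Since \<Theta> differs from twice the identity by at most 1 in operator norm, |Y| is at
  most |\<Theta> Y|, which is a commutator with the defect times a bounded factor.\<close>

lemma Ad_minus_1_bound:
  "\<exists>C>0. \<exists>r>0. \<forall>g\<in>U_V h. \<forall>c. norm (g - mat 1) < r \<longrightarrow> norm (c - 1) < r \<longrightarrow>
     (\<forall>X. norm (g ** X ** adj g - X) \<le> C * norm (defect g c) * norm X)"
proof -
  obtain r where r: "r > 0" "\<And>g c Y. norm (g - mat 1) < r \<Longrightarrow> norm (c - 1) < r \<Longrightarrow>
      norm (\<Theta> g c Y - 2 *\<^sub>R Y) \<le> norm Y"
    using Theta_near_identity by blast
  obtain Cm where Cm: "Cm > 0" "\<And>(A :: 'e^'m^'m) (B :: 'e^'m^'m). norm (A ** B) \<le> Cm * norm A * norm B"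
    by (rule matrix_mult_norm_bound[where 'e = 'e and 'm = 'm]) blast
  obtain Ca where Ca: "Ca > 0" "\<And>A. norm (adj A) \<le> Ca * norm A"
    using linear_bounded_pos[OF linear_adj] by blast
  define M where "M = Ca * (norm (mat 1 :: 'e^'m^'m) + 1)"
  have M: "M > 0"
    using Ca by (simp add: M_def add_nonneg_pos)
  have "norm (g ** X ** adj g - X) \<le> (2 * Cm * Cm * M) * norm (defect g c) * norm X"
    if g: "g \<in> U_V h" "norm (g - mat 1) < min r 1" and c: "norm (c - 1) < min r 1" for g c X
  proof -
    let ?Y = "g ** X ** adj g - X" and ?R = "defect g c"
    have "2 * norm ?Y = norm (\<Theta> g c ?Y - (\<Theta> g c ?Y - 2 *\<^sub>R ?Y))"
      by simp
    also have "\<dots> \<le> norm (\<Theta> g c ?Y) + norm (\<Theta> g c ?Y - 2 *\<^sub>R ?Y)"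
      by (rule norm_triangle_ineq4)
    also have "\<dots> \<le> norm (\<Theta> g c ?Y) + norm ?Y"
      using r g c by simp
    finally have "norm ?Y \<le> norm (\<Theta> g c ?Y)"
      by simp
    also have "\<dots> = norm ((?R ** X - X ** ?R) ** adj g)"
      using defect_commutator[OF g(1)] by simp
    also have "\<dots> \<le> Cm * norm (?R ** X - X ** ?R) * norm (adj g)"
      by (rule Cm)
    also have "\<dots> \<le> Cm * (2 * (Cm * norm ?R * norm X)) * M"
    proof (intro mult_mono mult_left_mono)
      have "norm (?R ** X - X ** ?R) \<le> norm (?R ** X) + norm (X ** ?R)"
        by (rule norm_triangle_ineq4)
      also have "\<dots> \<le> Cm * norm ?R * norm X + Cm * norm X * norm ?R"
        by (intro add_mono Cm)
      finally show "norm (?R ** X - X ** ?R) \<le> 2 * (Cm * norm ?R * norm X)"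
        by (simp add: mult_ac)
      have "norm g \<le> norm (g - mat 1) + norm (mat 1 :: 'e^'m^'m)"
        using norm_triangle_ineq[of "g - mat 1" "mat 1"] by simp
      then have "norm g \<le> norm (mat 1 :: 'e^'m^'m) + 1"
        using g by simp
      then show "norm (adj g) \<le> M"
        unfolding M_def using Ca by (meson mult_left_mono order_less_imp_le order_trans)
    qed (use Cm in auto)
    finally show ?thesis
      by (simp add: mult_ac)
  qed
  then show ?thesis
    using r Cm M by (intro exI[of _ "2 * Cm * Cm * M"] conjI exI[of _ "min r 1"]) auto
qed

text \<open>Near 1, a norm-one \<open>c\<close> satisfies c - 1 = b \<delta> (c + 1) with b in F.
  Here \<delta> (c + 1) is a unit with controlled inverse and b is a field scalar, so multiplication
  by c - 1 loses only a constant factor.\<close>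

lemma unit_minus_1_bound:
  "\<exists>C>0. \<exists>r>0. \<forall>c. c * \<sigma> c = 1 \<longrightarrow> norm (c - 1) < r \<longrightarrow>
     (\<forall>R::'e^'m^'m. norm (c - 1) * norm R \<le> C * norm (mat (c - 1) ** R))"
proof -
  obtain Cs where Cs: "Cs > 0" "\<And>c (A :: 'e^'m^'m). norm (mat c ** A) \<le> Cs * norm c * norm A"
    by (rule mat_mult_norm_bound[where 'e = 'e and 'm = 'm]) blast
  obtain Ce where Ce: "Ce > 0" "\<And>(x::'e) y. norm (x * y) \<le> norm x * norm y * Ce"
    using bounded_bilinear.pos_bounded[OF bounded_bilinear_algebra_mult] by blast
  obtain Ci where Ci: "Ci > 0" "\<And>a. norm (\<iota> a) \<le> Ci * norm a"
    using linear_bounded_pos[OF linear_iota] by blast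
  \<comment> \<open>The bound 1 controls |c + 1|, \<open>1 / Ce\<close> makes c + 1 invertible, and
    \<open>1 / Cs\<close> lets |(c - 1) R| be absorbed into 2 |R|.\<close>
  define r where "r = min 1 (min (1 / Cs) (1 / (Ce)))"
  have r: "r > 0"
    using Cs Ce by (simp add: r_def)
  define M where "M = norm \<delta> * (norm (2::'e) + 1) * Ce"
  define C where "C = Ci * M * Ce * (Cs * norm \<delta>') * (Cs * Ci)"
  have mat_mat: "mat a ** (mat b ** A) = mat (a * b) ** A" for a b and A :: "'e^'m^'m"
    by (simp add: matrix_eq matrix_apply vector_smult_assoc mult.commute)
  have "norm (c - 1) * norm R \<le> C * norm (mat (c - 1) ** R)"
    if c: "c * \<sigma> c = 1" "norm (c - 1) < r" for c and R :: "'e^'m^'m"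
  proof -
    have "\<exists>y. (c + 1) * y = 1"
    proof -
      have "linear (\<lambda>y. (c + 1) * y)"
        by (rule linearI) (simp_all add: algebra_simps)
      moreover have "y = 0" if "(c + 1) * y = 0" for y
      proof (rule ccontr)
        assume "y \<noteq> 0"
        have "2 *\<^sub>R y = (c + 1) * y - (c - 1) * y"
          by (simp add: algebra_simps scaleR_2)
        then have "norm (2 *\<^sub>R y) = norm ((c - 1) * y)"
          using that by simp
        then have "2 * norm y = norm ((c - 1) * y)"
          by simp
        also have "\<dots> \<le> norm (c - 1) * norm y * Ce"
          by (rule Ce)
        also have "\<dots> \<le> 1 / Ce * norm y * Ce"
          using c Ce by (intro mult_right_mono) (auto simp: r_def)
        also have "\<dots> = norm y"
          using Ce by simp
        finally show False
          using \<open>y \<noteq> 0\<close> by simp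
      qed
      ultimately have "surj (\<lambda>y. (c + 1) * y)"
        using linear_injective_0 linear_injective_imp_surjective by blast
      then show ?thesis
        by (metis surjD)
    qed
    then obtain y where y: "(c + 1) * y = 1"
      by blast
    have sy: "\<sigma> c * \<sigma> y = y"
    proof -
      have "(c + 1) * (\<sigma> c * \<sigma> y) = (c * \<sigma> c + \<sigma> c) * \<sigma> y"
        by (simp add: algebra_simps)
      also have "\<dots> = \<sigma> ((c + 1) * y)"
        by (simp add: c algebra_simps)
      finally have "(c + 1) * (\<sigma> c * \<sigma> y) = 1"
        by (simp only: y sigma_1)
      then have "y * ((c + 1) * (\<sigma> c * \<sigma> y)) = y"
        by simp
      then show ?thesis
        using y by (metis mult.assoc mult.commute mult_1_left)
    qed
    have "\<sigma> ((c - 1) * y) = \<sigma> c * \<sigma> y - \<sigma> y"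
      by (simp add: algebra_simps)
    also have "\<sigma> y = c * y"
      using c sy by (metis mult.assoc mult.left_neutral)
    finally have "\<sigma> ((c - 1) * y) = - ((c - 1) * y)"
      using sy \<open>\<sigma> y = c * y\<close> by (simp add: algebra_simps)
    \<comment> \<open>As \<sigma> inverts \<open>c\<close>, it negates the quotient (c - 1) / (c +
      1), which therefore lies in F \<delta>.\<close>
    then obtain b where b: "(c - 1) * y = \<iota> b * \<delta>"
      by (rule sigma_skew)
    have c1: "c - 1 = \<iota> b * (\<delta> * (c + 1))"
    proof -
      have "c - 1 = (c - 1) * y * (c + 1)"
        using y by (simp add: mult.assoc mult.commute[of y])
      then show ?thesis
        by (simp add: b mult.assoc)
    qed
    let ?S = "mat (\<delta> * (c + 1)) ** R"
    have "norm (c + 1) \<le> norm (2::'e) + 1"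
      using norm_triangle_ineq[of "c - 1" 2] c by (simp add: r_def add.commute)
    then have "norm (\<delta> * (c + 1)) \<le> M"
      unfolding M_def using Ce
      by (intro order_trans[OF Ce(2)] mult_right_mono mult_left_mono) auto
    then have n1: "norm (c - 1) \<le> Ci * norm b * M * Ce"
    proof -
      have "norm (c - 1) \<le> norm (\<iota> b) * norm (\<delta> * (c + 1)) * Ce"
        unfolding c1 by (rule Ce)
      also have "\<dots> \<le> Ci * norm b * M * Ce"
        using Ci Ce \<open>norm (\<delta> * (c + 1)) \<le> M\<close> by (intro mult_right_mono mult_mono) auto
      finally show ?thesis .
    qed
    have n2: "norm R \<le> Cs * norm \<delta>' * norm ?S"
    proof -
      have "mat (c + 1) ** R - mat (c - 1) ** R = R + R"
        unfolding matrix_eq matrix_apply by (simp add: vec_eq_iff algebra_simps)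
      then have "mat (c + 1) ** R - mat (c - 1) ** R = 2 *\<^sub>R R"
        by (simp only: scaleR_2)
      then have "2 * norm R = norm (mat (c + 1) ** R - mat (c - 1) ** R)"
        by simp
      also have "\<dots> \<le> norm (mat (c + 1) ** R) + norm (mat (c - 1) ** R)"
        by (rule norm_triangle_ineq4)
      also have "norm (mat (c - 1) ** R) \<le> Cs * norm (c - 1) * norm R"
        by (rule Cs)
      also have "\<dots> \<le> Cs * (1 / Cs) * norm R"
        using c Cs by (intro mult_right_mono mult_left_mono) (auto simp: r_def)
      also have "\<dots> = norm R"
        using Cs by simp
      finally have "norm R \<le> norm (mat (c + 1) ** R)"
        by simp
      also have "mat (c + 1) ** R = mat \<delta>' ** ?S"
        by (simp add: mat_mat flip: mult.assoc)
      also have "norm \<dots> \<le> Cs * norm \<delta>' * norm ?S"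
        by (rule Cs)
      finally show ?thesis .
    qed
    \<comment> \<open>The constant is independent of \<open>b\<close> because the norm of the field
      is multiplicative.\<close>
    have n3: "norm b * norm ?S \<le> Cs * Ci * norm (mat (c - 1) ** R)"
    proof (cases "b = 0")
      case False
      have "?S = mat (\<iota> (inverse b)) ** (mat (\<iota> b) ** ?S)"
        using False by (simp add: mat_mat flip: iota_mult mult.assoc)
      then have "norm ?S \<le> Cs * norm (\<iota> (inverse b)) * norm (mat (\<iota> b) ** ?S)"
        using Cs by metis
      also have "\<dots> \<le> Cs * (Ci * norm (inverse b)) * norm (mat (\<iota> b) ** ?S)"
        using Cs Ci by (intro mult_right_mono mult_left_mono) auto
      also have "mat (\<iota> b) ** ?S = mat (c - 1) ** R"
        by (simp add: mat_mat c1)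
      finally have "norm b * norm ?S \<le> norm b * (Cs * (Ci * norm (inverse b)) * norm (mat (c - 1) ** R))"
        by (intro mult_left_mono) auto
      also have "\<dots> = (norm b * norm (inverse b)) * (Cs * Ci * norm (mat (c - 1) ** R))"
        by simp
      also have "norm b * norm (inverse b) = 1"
        using False by (simp add: norm_inverse)
      finally show ?thesis
        by simp
    qed (use Cs Ci in simp)
    have "norm (c - 1) * norm R \<le> (Ci * norm b * M * Ce) * (Cs * norm \<delta>' * norm ?S)"
      using n1 n2 Ci Ce by (intro mult_mono) (auto simp: M_def)
    also have "\<dots> = (Ci * M * Ce * (Cs * norm \<delta>')) * (norm b * norm ?S)"
      by simp
    also have "\<dots> \<le> (Ci * M * Ce * (Cs * norm \<delta>')) * (Cs * Ci * norm (mat (c - 1) ** R))"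
      using Ci Ce Cs by (intro mult_left_mono n3) (auto simp: M_def)
    finally show ?thesis
      by (simp add: C_def mult_ac)
  qed
  moreover have "C \<ge> 0"
    using Ci Ce Cs by (simp add: C_def M_def)
  ultimately have "norm (c - 1) * norm R \<le> (C + 1) * norm (mat (c - 1) ** R)"
    if "c * \<sigma> c = 1" "norm (c - 1) < r" for c and R :: "'e^'m^'m"
    using that by (smt (verit) mult_right_mono norm_ge_zero)
  then show ?thesis
    using r \<open>C \<ge> 0\<close> by (intro exI[of _ "C + 1"] conjI exI[of _ r]) auto
qed

section \<open>The quotient by the center\<close>

lemma center_mult:
  assumes "z \<in> center_of (U_V h)" "z' \<in> center_of (U_V h)"
  shows "z ** z' \<in> center_of (U_V h)"
proof -
  have "z ** z' ** g = g ** (z ** z')" if "g \<in> U_V h" for g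
  proof -
    have "z ** z' ** g = z ** (z' ** g)"
      by (simp add: matrix_mul_assoc)
    also have "z' ** g = g ** z'"
      using assms that by (simp add: center_of_def)
    also have "z ** (g ** z') = z ** g ** z'"
      by (simp add: matrix_mul_assoc)
    also have "z ** g = g ** z"
      using assms that by (simp add: center_of_def)
    finally show ?thesis
      by (simp add: matrix_mul_assoc)
  qed
  moreover have "z ** z' \<in> U_V h"
    using assms U_V_mult unfolding center_of_def by blast
  ultimately show ?thesis
    unfolding center_of_def by blast
qed

lemma center_adj:
  assumes z: "z \<in> center_of (U_V h)"
  shows "adj z \<in> center_of (U_V h)"
proof -
  have zU: "z \<in> U_V h"
    using z by (simp add: center_of_def)
  have "adj z ** g = g ** adj z" if "g \<in> U_V h" for g
  proof -
    have "adj (z ** adj g) = adj (adj g ** z)"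
      using z U_V_adj[OF that] by (simp add: center_of_def)
    then show ?thesis
      by (simp add: adj_mult)
  qed
  then show ?thesis
    using U_V_adj[OF zU] by (simp add: center_of_def)
qed

lemma coset_Z_mult:
  assumes z: "z \<in> center_of (U_V h)"
  shows "coset_Z h (g ** z) = coset_Z h g"
proof -
  have zU: "z \<in> U_V h"
    using z by (simp add: center_of_def)
  show ?thesis
    unfolding coset_Z_def
  proof (intro equalityI subsetI; elim imageE)
    fix x z' assume "x = g ** z ** z'" "z' \<in> center_of (U_V h)"
    then show "x \<in> (**) g ` center_of (U_V h)"
      using center_mult[OF z] by (auto simp flip: matrix_mul_assoc)
  next
    fix x z' assume x: "x = g ** z'" "z' \<in> center_of (U_V h)"
    have "x = g ** z ** (adj z ** z')"
      by (simp add: x matrix_eq matrix_apply zU)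
    then show "x \<in> (**) (g ** z) ` center_of (U_V h)"
      using center_mult[OF center_adj[OF z]] x by blast
  qed
qed

lemma coset_Z_eqD:
  assumes "coset_Z h g = coset_Z h g'"
  obtains z where "z \<in> center_of (U_V h)" "g' = g ** z"
proof -
  have "mat 1 \<in> center_of (U_V h)"
    by (simp add: center_of_def U_V_mat_1)
  then have "g' \<in> coset_Z h g'"
    unfolding coset_Z_def by (metis image_eqI matrix_mul_rid)
  then show ?thesis
    using that assms by (auto simp: coset_Z_def)
qed

text \<open>The saturation of the ball is the union of its translates by the center, each relatively
  open in the group.\<close>

lemma openin_Gbar_ball:
  "openin (Gbar_topology h) (coset_Z h ` {g \<in> U_V h. norm (g - mat 1) < r})"
  unfolding openin_Gbar_topology
proof
  let ?W = "{g \<in> U_V h. norm (g - mat 1) < r}"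
  show "coset_Z h ` ?W \<subseteq> coset_Z h ` U_V h"
    by auto
  have "{g \<in> U_V h. coset_Z h g \<in> coset_Z h ` ?W}
      = (\<Union>z\<in>center_of (U_V h). U_V h \<inter> {g. norm (g ** z - mat 1) < r})"
  proof (intro equalityI subsetI)
    fix g assume "g \<in> {g \<in> U_V h. coset_Z h g \<in> coset_Z h ` ?W}"
    then obtain g' where g: "g \<in> U_V h" "coset_Z h g = coset_Z h g'" "norm (g' - mat 1) < r"
      by auto
    from g(2) obtain z where "z \<in> center_of (U_V h)" "g' = g ** z"
      by (rule coset_Z_eqD)
    then show "g \<in> (\<Union>z\<in>center_of (U_V h). U_V h \<inter> {g. norm (g ** z - mat 1) < r})"
      using g by auto
  next
    fix g assume "g \<in> (\<Union>z\<in>center_of (U_V h). U_V h \<inter> {g. norm (g ** z - mat 1) < r})"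
    then obtain z where z: "z \<in> center_of (U_V h)" "g \<in> U_V h" "norm (g ** z - mat 1) < r"
      by auto
    then have "g ** z \<in> ?W"
      by (auto simp: center_of_def U_V_mult)
    then have "coset_Z h (g ** z) \<in> coset_Z h ` ?W"
      by (rule imageI)
    then show "g \<in> {g \<in> U_V h. coset_Z h g \<in> coset_Z h ` ?W}"
      using z by (simp add: coset_Z_mult)
  qed
  also have "openin (top_of_set (U_V h)) \<dots>"
    by (intro openin_Union ballI openin_open_Int open_Collect_less continuous_intros
        continuous_on_bilinear imageI) (auto intro!: openin_open_Int open_Collect_less continuous_intros continuous_on_bilinear)
  finally show "openin (top_of_set (U_V h)) {g \<in> U_V h. coset_Z h g \<in> coset_Z h ` ?W}" .
qed

section \<open>Independence of the representative modulo the center\<close>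

lemma center_conj:
  assumes z: "z \<in> center_of (U_V h)" and X: "X \<in> lie_g h"
  shows "z *v (X *v (adj z *v v)) = X *v v"
proof -
  have "z *v (X *v w) = X *v (z *v w)" for w
    using center_commutes_lie_g[OF z X] by (simp add: matrix_vector_mul_assoc)
  moreover have "z \<in> U_V h"
    using z by (simp add: center_of_def)
  ultimately show ?thesis
    by simp
qed

lemma coAd_mult_center:
  assumes g: "g \<in> U_V h" and z: "z \<in> center_of (U_V h)" and T: "T \<in> lie_g h"
  shows "coAd (g ** z) (xi T) = coAd g (xi T)"
proof -
  have "g ** z \<in> U_V h"
    using g z by (simp add: center_of_def U_V_mult)
  moreover have "g ** z ** T ** adj (g ** z) = g ** T ** adj g"
    by (simp add: matrix_eq adj_mult matrix_apply center_conj[OF z T])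
  ultimately show ?thesis
    by (simp add: coAd_xi g)
qed

lemma Ad_minus_1_mult_center:
  assumes g: "g \<in> U_V h" and z: "z \<in> center_of (U_V h)"
  shows "Ad_minus_1 h (g ** z) = Ad_minus_1 h g"
proof -
  have gz: "g ** z \<in> U_V h"
    using g z by (simp add: center_of_def U_V_mult)
  have "g ** z ** X ** adj (g ** z) = g ** X ** adj g" if "X \<in> lie_g h" for X
    by (simp add: matrix_eq adj_mult matrix_apply center_conj[OF z that])
  then show ?thesis
    unfolding Ad_minus_1_def Ad_def matrix_inv_U_V[OF gz] matrix_inv_U_V[OF g] by auto
qed

lemma Ad_minus_1_in_End_g:
  assumes g: "g \<in> U_V h"
  shows "Ad_minus_1 h g \<in> End_g h"
proof -
  note sub = subspace_add[OF subspace_lie_g] subspace_scale[OF subspace_lie_g] subspace_0[OF subspace_lie_g]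
    subspace_diff[OF subspace_lie_g]
  show ?thesis
    unfolding End_g_def linear_on_g_def Ad_minus_1_def Ad_def matrix_inv_U_V[OF g]
    using conj_in_lie_g[of _ g]
    by (auto simp: sub matrix_mul_scaleR_left matrix_mul_scaleR_right matrix_add_ldistrib
        matrix_mul_add_left algebra_simps)
qed

section \<open>The distance to the orbit\<close>

text \<open>\<open>H\<close> fixes \<open>e\<close>, so each invariant is constant on the orbit, and
  its change from T to T' bounds the distance from T' to every orbit point. One of these changes
  dominates the commuting matrix Q.\<close>

lemma dist_lower_bound:
  assumes B: "inner_product_on (g_wedge h) B" and K: "compact K" "K \<subseteq> g_stab h e"
  shows "\<exists>C>0. \<forall>\<tau>\<in>K. \<forall>g\<in>U_V h. \<forall>z\<in>U_VH h e. \<forall>c.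
    norm g \<le> M \<longrightarrow> norm z \<le> M \<longrightarrow> coAd g \<tau> = \<tau> \<longrightarrow> c * \<sigma> c = 1 \<longrightarrow> (\<forall>v\<in>V_H h e. z *v v = c *s v) \<longrightarrow>
    norm (mat (c - 1) ** defect g c) \<le> C * dist_to B (coAd g (coAd z \<tau>)) (H_orbit h e \<tau>)"
proof -
  have KT: "T \<in> lie_g h \<and> xi T \<in> g_stab h e" if "T \<in> xi_inv ` K" for T
    using that K(2) xi_inv_in_lie_g by (auto simp: xi_xi_inv g_stab_def)
  have cK: "compact (xi_inv ` K)"
    using K(1) continuous_xi_inv by (intro compact_continuous_image) auto
  then obtain n c0 where n: "c0 > 0" "\<And>T Q. T \<in> xi_inv ` K \<Longrightarrow> Q ** T = T ** Q \<Longrightarrow>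
      \<exists>j<n. c0 * norm Q \<le> norm (h (Q *v pow_e T j) e)"
    using centralizer_bound[OF cK KT] by metis
  obtain cB where cB: "cB > 0" "\<And>S. S \<in> lie_g h \<Longrightarrow> cB * norm S \<le> sqrt (B (xi S) (xi S))"
    using inner_product_lower_bound[OF B] by metis
  obtain Cm where Cm: "Cm > 0" "\<And>(A :: 'e^'m^'m) (B :: 'e^'m^'m). norm (A ** B) \<le> Cm * norm A * norm B"
    by (rule matrix_mult_norm_bound[where 'e = 'e and 'm = 'm]) blast
  obtain Ca where Ca: "Ca > 0" "\<And>A. norm (adj A) \<le> Ca * norm A"
    using linear_bounded_pos[OF linear_adj] by blast
  obtain MK where MK: "MK > 0" "\<And>T. T \<in> xi_inv ` K \<Longrightarrow> norm T \<le> MK"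
    using compact_imp_bounded[OF cK] by (auto simp: bounded_pos)
  define m where "m = Cm * \<bar>M\<bar> * \<bar>M\<bar>"
  \<comment> \<open>A common bound for \<open>T\<close> and its conjugate \<open>T'\<close> by
    \<open>g ** z\<close>. The Lipschitz constant below is taken on radius \<rho> + 1, to admit
    orbit points within distance 1 of \<open>T'\<close>.\<close>
  define \<rho> where "\<rho> = MK + Cm * (Cm * m * MK) * (Ca * m)"
  have m0: "m \<ge> 0"
    using Cm by (simp add: m_def)
  have \<rho>0: "\<rho> \<ge> 0"
    using m0 Cm Ca MK by (simp add: \<rho>_def)
  obtain L where L: "L \<ge> 0" "\<And>k A B. k < n \<Longrightarrow> norm A \<le> \<rho> + 1 \<Longrightarrow> norm B \<le> \<rho> + 1 \<Longrightarrow>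
     norm (h (pow_e A k) e - h (pow_e B k) e) \<le> L * norm (A - B)"
    using invariants_lipschitz[of n "\<rho> + 1"] by blast
  define q where "q = L * (1 + 2 * \<rho>) + 1"
  have q: "q > 0"
    using L \<rho>0 by (simp add: q_def add_nonneg_pos)
  define C where "C = q / (c0 * cB)"
  have C: "C > 0"
    using n cB q by (simp add: C_def)
  have "norm (mat (c - 1) ** defect g c) \<le> C * dist_to B (coAd g (coAd z \<tau>)) (H_orbit h e \<tau>)"
    if \<tau>: "\<tau> \<in> K" and g: "g \<in> U_V h" "norm g \<le> M" "coAd g \<tau> = \<tau>"
      and z: "z \<in> U_VH h e" "norm z \<le> M" and c: "c * \<sigma> c = 1" "\<And>v. v \<in> V_H h e \<Longrightarrow> z *v v = c *s v"
    for \<tau> g z c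
  proof -
    define T where "T = xi_inv \<tau>"
    have TK: "T \<in> xi_inv ` K" and T: "T \<in> lie_g h"
      using \<tau> by (auto simp: T_def xi_inv_in_lie_g)
    have \<tau>T: "\<tau> = xi T"
      using \<tau> K(2) by (auto simp: T_def xi_xi_inv g_stab_def)
    have gT: "g ** T = T ** g"
      using g T coAd_fix_iff by (simp add: \<tau>T)
    have zU: "z \<in> U_V h"
      using z by (simp add: U_VH_iff)
    define Q where "Q = mat (c - 1) ** defect g c"
    define T' where "T' = g ** z ** T ** adj (g ** z)"
    have g'T: "adj g ** T = T ** adj g"
    proof -
      have "adj (g ** T) = adj (T ** g)"
        by (simp add: gT)
      then show ?thesis
        using T by (simp add: adj_mult lie_g_iff matrix_eq matrix_apply)
    qed
    have QT: "Q ** T = T ** Q"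
    proof -
      have "g *v (T *v v) = T *v (g *v v)" "adj g *v (T *v v) = T *v (adj g *v v)" for v
        by (simp_all add: gT g'T matrix_vector_mul_assoc)
      then show ?thesis
        by (simp add: Q_def defect_def matrix_eq matrix_apply)
    qed
    obtain j where j: "j < n" "c0 * norm Q \<le> norm (h (Q *v pow_e T j) e)"
      using n(2)[OF TK QT] by blast
    have diff: "h (Q *v pow_e T j) e = h (pow_e T' j) e - h (pow_e T j) e"
      using invariant_difference[OF g(1) gT z(1) c] by (simp add: Q_def T'_def)
    have T'_xi: "coAd g (coAd z \<tau>) = xi T'"
      by (simp add: \<tau>T coAd_xi zU g(1) T'_def adj_mult matrix_mul_assoc)
    have T'_lie: "T' \<in> lie_g h"
      unfolding T'_def by (rule conj_in_lie_g[OF T])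
    have nT: "norm T \<le> \<rho>"
      using MK(2)[OF TK] m0 Cm Ca MK by (simp add: \<rho>_def add_increasing2)
    have nT': "norm T' \<le> \<rho>"
    proof -
      have gz: "norm (g ** z) \<le> m"
      proof -
        have "norm (g ** z) \<le> Cm * norm g * norm z"
          by (rule Cm)
        also have "\<dots> \<le> Cm * \<bar>M\<bar> * \<bar>M\<bar>"
          using g z Cm by (intro mult_mono) auto
        finally show ?thesis
          by (simp add: m_def)
      qed
      have "norm T' \<le> Cm * norm (g ** z ** T) * norm (adj (g ** z))"
        unfolding T'_def by (rule Cm)
      also have "\<dots> \<le> Cm * (Cm * m * MK) * (Ca * m)"
      proof (intro mult_mono mult_left_mono)
        have "norm (g ** z ** T) \<le> Cm * norm (g ** z) * norm T"
          by (rule Cm)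
        also have "\<dots> \<le> Cm * m * MK"
          using MK(2)[OF TK] gz Cm m0 by (intro mult_mono) auto
        finally show "norm (g ** z ** T) \<le> Cm * m * MK" .
        show "norm (adj (g ** z)) \<le> Ca * m"
          using Ca gz by (meson mult_left_mono order_less_imp_le order_trans)
      qed (use Cm m0 MK in auto)
      also have "\<dots> \<le> \<rho>"
        using MK by (simp add: \<rho>_def)
      finally show ?thesis .
    qed
    have orbit: "norm Q / C \<le> sqrt (B (\<lambda>X. xi T' X - \<eta> X) (\<lambda>X. xi T' X - \<eta> X))"
      if \<eta>: "\<eta> \<in> H_orbit h e \<tau>" for \<eta>
    proof -
      obtain x where x: "x \<in> U_VH h e" "\<eta> = coAd x \<tau>"
        using \<eta> by (auto simp: H_orbit_def)
      then have xU: "x \<in> U_V h" and xe: "x *v e = e"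
        by (auto simp: U_VH_iff)
      have xe': "adj x *v e = e"
        by (metis U_V_apply(1) xU xe)
      define S where "S = x ** T ** adj x"
      have \<eta>S: "\<eta> = xi S"
        by (simp add: x \<tau>T coAd_xi xU S_def)
      have S: "S \<in> lie_g h"
        unfolding S_def by (rule conj_in_lie_g[OF T])
      have inv: "h (pow_e S j) e = h (pow_e T j) e"
        unfolding S_def pow_e_conj[OF xU] by (simp add: h_adj_left xe' pow_e_eq_mpow)
      let ?d = "norm (T' - S)"
      \<comment> \<open>The orbit may be unbounded, so the Lipschitz estimate covers only orbit
        points \<open>S\<close> near \<open>T'\<close>. For distant ones, \<open>?d\<close> exceeds
        1 and comparing \<open>T'\<close> with \<open>T\<close> itself suffices.\<close>
      have "norm (h (pow_e T' j) e - h (pow_e T j) e) \<le> L * (1 + 2 * \<rho>) * ?d"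
      proof (cases "?d \<le> 1")
        case True
        have "norm S \<le> norm T' + ?d"
          by (metis norm_minus_commute norm_triangle_sub)
        then have "norm (h (pow_e T' j) e - h (pow_e S j) e) \<le> L * ?d"
          using True nT' j by (intro L) auto
        also have "\<dots> \<le> L * (1 + 2 * \<rho>) * ?d"
          using L \<rho>0 by (intro mult_right_mono) (auto simp: mult_le_cancel_left1)
        finally show ?thesis
          by (simp add: inv)
      next
        case False
        have "norm (h (pow_e T' j) e - h (pow_e T j) e) \<le> L * norm (T' - T)"
          using nT nT' j by (intro L) auto
        also have "\<dots> \<le> L * (1 + 2 * \<rho>)"
          using norm_triangle_ineq4[of T' T] nT nT' L by (intro mult_left_mono) auto
        also have "\<dots> \<le> L * (1 + 2 * \<rho>) * ?d"
          using False L(1) \<rho>0 mult_left_mono[of 1 ?d "L * (1 + 2 * \<rho>)"] by simp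
        finally show ?thesis .
      qed
      also have "\<dots> \<le> (L * (1 + 2 * \<rho>) + 1) * ?d"
        by (intro mult_right_mono) auto
      finally have "c0 * norm Q \<le> (L * (1 + 2 * \<rho>) + 1) * ?d"
        using j diff by simp
      then have *: "cB * (c0 * norm Q) \<le> cB * (q * ?d)"
        using cB(1) by (simp add: q_def)
      have "norm Q / C = cB * (c0 * norm Q) / q"
        by (simp add: C_def)
      also have "\<dots> \<le> cB * (q * ?d) / q"
        using q by (intro divide_right_mono[OF *]) simp
      also have "\<dots> = cB * ?d"
        using q by simp
      also have "\<dots> \<le> sqrt (B (xi (T' - S)) (xi (T' - S)))"
        using T'_lie S by (intro cB subspace_diff[OF subspace_lie_g])
      finally show ?thesis
        by (simp add: \<eta>S xi_diff)
    qed
    have "mat 1 \<in> U_VH h e"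
      by (simp add: U_VH_iff U_V_mat_1)
    then have "H_orbit h e \<tau> \<noteq> {}"
      by (auto simp: H_orbit_def)
    then have "norm Q / C \<le> dist_to B (xi T') (H_orbit h e \<tau>)"
      unfolding dist_to_def by (intro cINF_greatest orbit)
    then show ?thesis
      using C by (simp add: T'_xi Q_def field_simps)
  qed
  then show ?thesis
    using C by (intro exI[of _ C]) auto
qed

lemma Ad_minus_1_dist_bound:
  assumes B: "inner_product_on (g_wedge h) B" and N_Ad: "norm_on (End_g h) N_Ad"
    and N_V: "norm_on End_V N_V" and K: "compact K" "K \<subseteq> g_stab h e"
  shows "\<exists>U V0. \<exists>C::real.
    openin (Gbar_topology h) U \<and> coset_Z h (mat 1) \<in> U \<and>
    openin (top_of_set (center_of (U_VH h e))) V0 \<and> mat 1 \<in> V0 \<and>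
    C > 0 \<and>
    (\<forall>\<tau>\<in>K. \<forall>g\<in>U_V h. coset_Z h g \<in> U \<and> coAd g \<tau> = \<tau> \<longrightarrow>
      (\<forall>z\<in>V0. N_V (\<lambda>v. z *v v - v) * N_Ad (Ad_minus_1 h g)
        \<le> C * dist_to B (coAd g (coAd z \<tau>)) (H_orbit h e \<tau>)))"
proof -
  obtain \<zeta> where \<zeta>: "linear \<zeta>" "\<zeta> (mat 1) = 1"
    "\<And>z. z \<in> center_of (U_VH h e) \<Longrightarrow> \<zeta> z * \<sigma> (\<zeta> z) = 1"
    "\<And>z v. z \<in> center_of (U_VH h e) \<Longrightarrow> v \<in> V_H h e \<Longrightarrow> z *v v = \<zeta> z *s v"
    by (rule center_H_scalar) blast
  obtain C1 r1 where C1: "C1 > 0" "r1 > 0" "\<And>g c X. g \<in> U_V h \<Longrightarrow> norm (g - mat 1) < r1 \<Longrightarrow>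
      norm (c - 1) < r1 \<Longrightarrow> norm (g ** X ** adj g - X) \<le> C1 * norm (defect g c) * norm X"
    using Ad_minus_1_bound by blast
  obtain C2 r2 where C2: "C2 > 0" "r2 > 0" "\<And>c (R::'e^'m^'m). c * \<sigma> c = 1 \<Longrightarrow>
      norm (c - 1) < r2 \<Longrightarrow> norm (c - 1) * norm R \<le> C2 * norm (mat (c - 1) ** R)"
    using unit_minus_1_bound by blast
  obtain CA where CA: "CA > 0" "\<And>T k. T \<in> End_g h \<Longrightarrow> k \<ge> 0 \<Longrightarrow>
      (\<And>X. X \<in> lie_g h \<Longrightarrow> norm (T X) \<le> k * norm X) \<Longrightarrow> N_Ad T \<le> CA * k"
    using End_g_norm_bound[OF N_Ad] by blast
  \<comment> \<open>The projection onto V_H along \<open>e\<close>.\<close>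
  define P where "P = mat 1 - rank1 (\<epsilon> *s e) e"
  obtain CV where CV: "CV > 0" "\<And>\<eta>. N_V (\<lambda>v. \<eta> *s (P *v v)) \<le> CV * norm \<eta>"
    using End_V_norm_bound[OF N_V] by blast
  define r where "r = min 1 (min r1 r2)"
  have r: "r > 0" "r \<le> 1" "r \<le> r1" "r \<le> r2"
    using C1 C2 by (auto simp: r_def)
  define M where "M = norm (mat 1 :: 'e^'m^'m) + 1"
  obtain C3 where C3: "C3 > 0" "\<And>\<tau> g z c. \<tau> \<in> K \<Longrightarrow> g \<in> U_V h \<Longrightarrow> z \<in> U_VH h e \<Longrightarrow>
    norm g \<le> M \<Longrightarrow> norm z \<le> M \<Longrightarrow> coAd g \<tau> = \<tau> \<Longrightarrow> c * \<sigma> c = 1 \<Longrightarrow> (\<forall>v\<in>V_H h e. z *v v = c *s v) \<Longrightarrow>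
    norm (mat (c - 1) ** defect g c) \<le> C3 * dist_to B (coAd g (coAd z \<tau>)) (H_orbit h e \<tau>)"
    using dist_lower_bound[OF B K, of M] by metis
  define W where "W = {g \<in> U_V h. norm (g - mat 1) < r}"
  \<comment> \<open>The first condition bounds \<open>z\<close> by \<open>M\<close>; the second
    brings the scalar of \<open>z\<close> into the range of both local estimates.\<close>
  define V0 where "V0 = center_of (U_VH h e) \<inter> {z. norm (z - mat 1) < 1 \<and> norm (\<zeta> z - 1) < r}"
  define C where "C = CV * CA * C1 * C2 * C3"
  have "openin (top_of_set (center_of (U_VH h e))) V0"
  proof -
    have "continuous_on UNIV \<zeta>"
      using \<zeta>(1) by (simp add: linear_continuous_on linear_conv_bounded_linear)
    then have "open {z. norm (z - mat 1) < 1 \<and> norm (\<zeta> z - 1) < r}"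
      by (intro open_Collect_conj open_Collect_less continuous_intros)
    then show ?thesis
      unfolding V0_def by (rule openin_open_Int)
  qed
  moreover have "mat 1 \<in> V0"
    using \<zeta>(2) r U_V_mat_1 by (simp add: V0_def center_of_def U_VH_iff)
  moreover have "openin (Gbar_topology h) (coset_Z h ` W)"
    unfolding W_def by (rule openin_Gbar_ball)
  moreover have "coset_Z h (mat 1) \<in> coset_Z h ` W"
    using r U_V_mat_1 by (intro imageI) (simp add: W_def)
  moreover have "C > 0"
    using CV CA C1 C2 C3 by (simp add: C_def)
  moreover have "N_V (\<lambda>v. z *v v - v) * N_Ad (Ad_minus_1 h g)
      \<le> C * dist_to B (coAd g (coAd z \<tau>)) (H_orbit h e \<tau>)"
    if \<tau>: "\<tau> \<in> K" and g: "g \<in> U_V h" "coset_Z h g \<in> coset_Z h ` W" "coAd g \<tau> = \<tau>" and z: "z \<in> V0"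
    for \<tau> g z
  proof -
    \<comment> \<open>Membership of the coset in the neighborhood only says that some representative
      is near 1. Both sides of the estimate and the condition of fixing \<tau> depend on the coset
      alone, so \<open>g\<close> may be replaced by \<open>g0\<close>.\<close>
    obtain g0 where g0: "g0 \<in> U_V h" "norm (g0 - mat 1) < r" "coset_Z h g = coset_Z h g0"
      using g(2) by (auto simp: W_def)
    from g0(3) obtain y where y: "y \<in> center_of (U_V h)" "g0 = g ** y"
      by (rule coset_Z_eqD)
    have "\<tau> \<in> g_wedge h"
      using \<tau> K(2) by (auto simp: g_stab_def)
    then obtain T where T: "T \<in> lie_g h" "\<tau> = xi T"
      using xi_xi_inv xi_inv_in_lie_g by metis
    have zc: "z \<in> center_of (U_VH h e)" and zr: "norm (z - mat 1) < 1" "norm (\<zeta> z - 1) < r"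
      using z by (auto simp: V0_def)
    then have zH: "z \<in> U_VH h e"
      by (simp add: center_of_def)
    then have zU: "z \<in> U_V h" and ze: "z *v e = e"
      by (auto simp: U_VH_iff)
    have fix0: "coAd g0 \<tau> = \<tau>"
      using g(3) T coAd_mult_center[OF g(1) y(1)] by (simp add: y(2))
    have coAd0: "coAd g0 (coAd z \<tau>) = coAd g (coAd z \<tau>)"
      unfolding T(2) coAd_xi[OF zU] y(2) by (rule coAd_mult_center[OF g(1) y(1) conj_in_lie_g[OF T(1)]])
    have Ad0: "Ad_minus_1 h g = Ad_minus_1 h g0"
      using Ad_minus_1_mult_center[OF g(1) y(1)] by (simp add: y(2))
    let ?c = "\<zeta> z" and ?R = "defect g0 (\<zeta> z)"
    have zv: "z *v v - v = (?c - 1) *s (P *v v)" for v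
    proof -
      define a where "a = (h v e * \<epsilon>) *s e"
      obtain w where w: "w \<in> V_H h e" "v = a + w"
        unfolding a_def by (rule decompose)
      have "P *v v = v - a"
        by (simp add: P_def a_def matrix_apply rank1_apply vector_smult_assoc)
      then have "P *v v = w"
        by (simp add: w(2))
      moreover have "z *v a = a"
        by (simp add: a_def matrix_apply ze)
      then have "z *v v = a + ?c *s w"
        by (simp add: w(2) matrix_apply \<zeta>(4)[OF zc w(1)])
      ultimately show ?thesis
        by (simp add: w(2) vector_sub_rdistrib)
    qed
    have 1: "N_V (\<lambda>v. z *v v - v) \<le> CV * norm (?c - 1)"
      unfolding zv by (rule CV)
    have 2: "N_Ad (Ad_minus_1 h g0) \<le> CA * (C1 * norm ?R)"
    proof (rule CA(2)[OF Ad_minus_1_in_End_g[OF g0(1)]])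
      show "norm (Ad_minus_1 h g0 X) \<le> C1 * norm ?R * norm X" if "X \<in> lie_g h" for X
        using that C1(3)[OF g0(1), of ?c X] g0 zr r
        by (simp add: Ad_minus_1_def Ad_def matrix_inv_U_V)
    qed (use C1 in auto)
    have norms: "norm A \<le> M" if "norm (A - mat 1) < 1" for A :: "'e^'m^'m"
      using norm_triangle_ineq[of "A - mat 1" "mat 1"] that by (simp add: M_def)
    have 0: "0 \<le> N_Ad (Ad_minus_1 h g0)"
      using N_Ad Ad_minus_1_in_End_g[OF g0(1)] by (simp add: norm_on_def)
    have "N_V (\<lambda>v. z *v v - v) * N_Ad (Ad_minus_1 h g0) \<le> (CV * norm (?c - 1)) * (CA * (C1 * norm ?R))"
      using 0 1 2 CV by (intro mult_mono) auto
    also have "\<dots> = CV * CA * C1 * (norm (?c - 1) * norm ?R)"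
      by simp
    also have "\<dots> \<le> CV * CA * C1 * (C2 * norm (mat (?c - 1) ** ?R))"
      using CV CA C1 zr r by (intro mult_left_mono C2 \<zeta>(3)[OF zc]) auto
    also have "\<dots> \<le> CV * CA * C1 * (C2 * (C3 * dist_to B (coAd g0 (coAd z \<tau>)) (H_orbit h e \<tau>)))"
      using CV CA C1 C2 g0 zr r \<zeta>(3,4)[OF zc] zH
      by (intro mult_left_mono C3(2)[OF \<tau> g0(1) zH _ _ fix0] norms) auto
    finally show ?thesis
      by (simp add: C_def Ad0 coAd0 mult.assoc)
  qed
  ultimately show ?thesis
    by (intro exI[of _ "coset_Z h ` W"] exI[of _ V0] exI[of _ C]) auto
qed

end

theorem theorem16:
  fixes \<sigma> :: "'e::{comm_ring_1,real_algebra_1,euclidean_space} \<Rightarrow> 'e"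
    and h :: "'e^'m \<Rightarrow> 'e^'m \<Rightarrow> 'e"
    and e :: "'e^'m"
    and B :: "('e^'m^'m \<Rightarrow> complex) \<Rightarrow> ('e^'m^'m \<Rightarrow> complex) \<Rightarrow> real"
    and N_Ad :: "('e^'m^'m \<Rightarrow> 'e^'m^'m) \<Rightarrow> real"
    and N_V :: "('e^'m \<Rightarrow> 'e^'m) \<Rightarrow> real"
    and K :: "('e^'m^'m \<Rightarrow> complex) set"
  assumes "(\<exists>\<iota>::real \<Rightarrow> 'e. unitary_GGP \<iota> \<sigma> h e) \<or> (\<exists>\<iota>::complex \<Rightarrow> 'e. unitary_GGP \<iota> \<sigma> h e)"
    and "inner_product_on (g_wedge h) B"
    and "norm_on (End_g h) N_Ad"
    and "norm_on End_V N_V"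
    and "compact K"
    and "K \<subseteq> g_stab h e"
  shows "\<exists>U V0. \<exists>C::real.
    openin (Gbar_topology h) U \<and> coset_Z h (mat 1) \<in> U \<and>
    openin (top_of_set (center_of (U_VH h e))) V0 \<and> mat 1 \<in> V0 \<and>
    C > 0 \<and>
    (\<forall>\<tau>\<in>K. \<forall>g\<in>U_V h. coset_Z h g \<in> U \<and> coAd g \<tau> = \<tau> \<longrightarrow>
      (\<forall>z\<in>V0. N_V (\<lambda>v. z *v v - v) * N_Ad (Ad_minus_1 h g)
        \<le> C * dist_to B (coAd g (coAd z \<tau>)) (H_orbit h e \<tau>)))"
  using assms(1)
proof (elim disjE exE)
  fix \<iota> :: "real \<Rightarrow> 'e" assume "unitary_GGP \<iota> \<sigma> h e"
  then interpret unitary_pair \<iota> \<sigma> h e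
    by (rule unitary_pair.intro)
  show ?thesis
    using assms(2-) by (rule Ad_minus_1_dist_bound)
next
  fix \<iota> :: "complex \<Rightarrow> 'e" assume "unitary_GGP \<iota> \<sigma> h e"
  then interpret unitary_pair \<iota> \<sigma> h e
    by (rule unitary_pair.intro)
  show ?thesis
    using assms(2-) by (rule Ad_minus_1_dist_bound)
qed

end
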